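(* Let $\alpha,\alpha',\beta,\beta',\gamma,\rho,a\in\mathbb{C}$ with $\operatorname{Re}(\gamma)>0$ and $a\ne0$, and let $\mu$ be a real number, such that $\mu>0$ and $\operatorname{Re}(\rho)>\max\{\operatorname{Re}(-\beta'),\operatorname{Re}(\alpha'+\beta-\gamma),\operatorname{Re}(\alpha+\alpha'-\gamma)+[\operatorname{Re}(\gamma)]+1\}$. Then for every $x>0$, $$\left(\mathcal{D}_{-}^{\alpha,\alpha',\beta,\beta',\gamma}\left(t^{-\rho}I^{m,n}_{p,q}\left[at^{-\mu}\,\middle|\begin{matrix}(a_i,A_i,\alpha_i)_{1,p}\\(b_j,B_j,\beta_j)_{1,q}\end{matrix}\right]\right)\right)(x)=x^{\alpha+\alpha'-\gamma-\rho}\,I^{m,n+3}_{p+3,q+3}\left[ax^{-\mu}\,\middle|\begin{matrix}U\\L\end{matrix}\right],$$ where the list of upper triples is $$U=(1-\beta'-\rho,\mu,1),\ (1+\alpha+\alpha'-\gamma-\rho,\mu,1),\ (1+\alpha'+\beta-\gamma-\rho,\mu,1),\ (a_i,A_i,\alpha_i)_{1,p}$$ and the list of lower triples is $$L=(b_j,B_j,\beta_j)_{1,q},\ (1-\rho,\mu,1),\ (1+\alpha'-\beta'-\rho,\mu,1),\ (1+\alpha+\alpha'+\beta-\gamma-\rho,\mu,1).$$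
   Context: **$I$-function.** Let $m,n,p,q$ be integers with $0\le m\le q$, $0\le n\le p$; let $a_i\in\mathbb{C}$, $A_i,\alpha_i>0$ $(1\le i\le p)$ and $b_j\in\mathbb{C}$, $B_j,\beta_j>0$ $(1\le j\le q)$. For $z\neq0$ (with a chosen value of $\arg z$; $z^{-s}=e^{-s(\log|z|+i\arg z)}$), $$I^{m,n}_{p,q}\left[z\,\middle|\begin{matrix}(a_i,A_i,\alpha_i)_{1,p}\\(b_j,B_j,\beta_j)_{1,q}\end{matrix}\right]=\frac{1}{2\pi i}\int_{C}\chi(s)z^{-s}\,ds,\qquad \chi(s)=\frac{\prod_{j=1}^{m}\Gamma^{\beta_j}(b_j+B_js)\prod_{i=1}^{n}\Gamma^{\alpha_i}(1-a_i-A_is)}{\prod_{j=m+1}^{q}\Gamma^{\beta_j}(1-b_j-B_js)\prod_{i=n+1}^{p}\Gamma^{\alpha_i}(a_i+A_is)}.$$ Here $(a_i,A_i,\alpha_i)_{1,p}$ is the ordered list of triples for $i=1,\dots,p$ (the first $n$ upper triples and the first $m$ lower triples enter the numerator), $\Gamma^{\kappa}(w)=(\Gamma(w))^{\kappa}$, with the branch of non-integer powers fixed along $C$ and the same for the same triple in all $I$-functions considered; empty products equal $1$. The singularities of $\Gamma^{\beta_j}(b_j+B_js)$, $j\le m$, lie to the left of $C$ and those of $\Gamma^{\alpha_i}(1-a_i-A_is)$, $i\le n$, to the right. **Standing assumptions.** The contour $C$ is the imaginary axis $\operatorname{Re}(s)=0$, traversed upwards, and for each $I$-function occurring the following conditions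 for absolute convergence hold: with (computed from the parameters of that $I$-function) $\mu^*=\sum_{j=1}^q\beta_jB_j-\sum_{i=1}^p\alpha_iA_i$, $\Omega=\sum_{i=1}^p(\frac12-\operatorname{Re}(a_i))\alpha_i-\sum_{j=1}^q(\frac12-\operatorname{Re}(b_j))\beta_j$, $\Delta=\sum_{j=1}^m\beta_jB_j-\sum_{j=m+1}^q\beta_jB_j+\sum_{i=1}^n\alpha_iA_i-\sum_{i=n+1}^p\alpha_iA_i$, either $\Delta>0$ and $|\arg z|<\frac{\pi}{2}\Delta$, or $\Delta\ge0$, $|\arg z|=\frac{\pi}{2}\Delta$ and one of: $\mu^*=0$ and $\Omega<-1$; or $\mu^*\ne0$ and $\Omega+\sigma\mu^*<-1$ where $\sigma=\operatorname{Re}(s)$ on $C$ (so $\sigma=0$). For $t>0$, $\arg(at^{\pm\mu})=\arg a$. **Operators.** For $\operatorname{Re}(\gamma)>0$, $x>0$, the right-sided Marichev–Saigo–Maeda (MSM) fractional integral is $$\left(\mathcal{I}_{-}^{\alpha,\alpha',\beta,\beta',\gamma}f\right)(x)=\frac{x^{-\alpha'}}{\Gamma(\gamma)}\int_x^{\infty}(t-x)^{\gamma-1}t^{-\alpha}F_3\left(\alpha,\alpha',\beta,\beta';\gamma;1-\tfrac{x}{t},1-\tfrac{t}{x}\right)f(t)\,dt ,$$ and the right-sided MSM fractional derivative is $$\left(\mathcal{D}_{-}^{\alpha,\alpha',\beta,\beta',\gamma}f\right)(x)=\left(-\frac{d}{dx}\right)^{N}\left(\mathcal{I}_{-}^{-\alpha',-\alpha,-\beta',-\beta+N,-\gamma+N}f\right)(x),\qquad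 N=[\operatorname{Re}(\gamma)]+1,$$ $[\cdot]$ denoting the integer part. $F_3(\alpha,\alpha',\beta,\beta';\gamma;u,v)=\sum_{k,l\ge0}\frac{(\alpha)_k(\alpha')_l(\beta)_k(\beta')_l}{(\gamma)_{k+l}}\frac{u^kv^l}{k!\,l!}$ for $\max\{|u|,|v|\}<1$ (third Appell function, $(\cdot)_k$ the Pochhammer symbol), and for $u\in[0,1)$, $v\le0$ it denotes the analytic continuation $\sum_{k\ge0}\frac{(\alpha)_k(\beta)_k}{(\gamma)_k}\frac{u^k}{k!}\,{}_2F_1(\alpha',\beta';\gamma+k;v)$. *)

theory Defs
  imports "HOL-Complex_Analysis.Complex_Analysis"
begin

section \<open>Hypergeometric functions\<close>

definition hyp2F1_series :: "complex \<Rightarrow> complex \<Rightarrow> complex \<Rightarrow> complex \<Rightarrow> complex" where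
  "hyp2F1_series a b c z =
     (\<Sum>k. pochhammer a k * pochhammer b k / pochhammer c k * z ^ k / fact k)"

text \<open>
  The principal branch of the Gauss function: the analytic continuation of the series from \<open>0\<close>
  to \<open>z\<close> along the straight segment, which is possible for every \<open>z\<close> outside the cut
  \<open>[1, \<infinity>)\<close>.  The value does not depend on \<open>S\<close> and \<open>f\<close> by the identity theorem.
\<close>

definition hyp2F1 :: "complex \<Rightarrow> complex \<Rightarrow> complex \<Rightarrow> complex \<Rightarrow> complex" where
  "hyp2F1 a b c z =
     (THE w. \<exists>S f. open S \<and> closed_segment 0 z \<subseteq> S \<and> f holomorphic_on S \<and>
        (\<forall>\<^sub>F y in nhds 0. f y = hyp2F1_series a b c y) \<and> f z = w)"

text \<open>
  The third Appell function: its double series, respectively (for real \<open>0 \<le> u < 1\<close>, \<open>v \<le> 0\<close>,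
  the only arguments met by the operators below) its continuation in \<open>v\<close>.  The two expressions
  agree where both are available, so the order of the cases is immaterial.
\<close>

definition appell_F3 ::
    "complex \<Rightarrow> complex \<Rightarrow> complex \<Rightarrow> complex \<Rightarrow> complex \<Rightarrow> complex \<Rightarrow> complex \<Rightarrow> complex" where
  "appell_F3 \<alpha> \<alpha>' \<beta> \<beta>' \<gamma> u v =
     (if u \<in> \<real> \<and> 0 \<le> Re u \<and> Re u < 1 \<and> v \<in> \<real> \<and> Re v \<le> 0 then
        (\<Sum>k. pochhammer \<alpha> k * pochhammer \<beta> k / pochhammer \<gamma> k * u ^ k / fact k
               * hyp2F1 \<alpha>' \<beta>' (\<gamma> + of_nat k) v)
      else
        (\<Sum>\<^sub>\<infinity>(k, l)\<in>UNIV.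
           pochhammer \<alpha> k * pochhammer \<alpha>' l * pochhammer \<beta> k * pochhammer \<beta>' l
             / pochhammer \<gamma> (k + l) * (u ^ k * v ^ l) / (fact k * fact l)))"

section \<open>Right-sided Marichev-Saigo-Maeda operators\<close>

definition msm_integrand ::
    "complex \<Rightarrow> complex \<Rightarrow> complex \<Rightarrow> complex \<Rightarrow> complex \<Rightarrow> (real \<Rightarrow> complex) \<Rightarrow> real \<Rightarrow> real \<Rightarrow> complex"
where
  "msm_integrand \<alpha> \<alpha>' \<beta> \<beta>' \<gamma> f x t =
     of_real (t - x) powr (\<gamma> - 1) * of_real t powr (- \<alpha>)
       * appell_F3 \<alpha> \<alpha>' \<beta> \<beta>' \<gamma> (of_real (1 - x / t)) (of_real (1 - t / x)) * f t"

definition msm_integral ::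
    "complex \<Rightarrow> complex \<Rightarrow> complex \<Rightarrow> complex \<Rightarrow> complex \<Rightarrow> (real \<Rightarrow> complex) \<Rightarrow> real \<Rightarrow> complex"
where
  "msm_integral \<alpha> \<alpha>' \<beta> \<beta>' \<gamma> f x =
     of_real x powr (- \<alpha>') / Gamma \<gamma> * (LBINT t:{x<..}. msm_integrand \<alpha> \<alpha>' \<beta> \<beta>' \<gamma> f x t)"

definition msm_integral_exists ::
    "complex \<Rightarrow> complex \<Rightarrow> complex \<Rightarrow> complex \<Rightarrow> complex \<Rightarrow> (real \<Rightarrow> complex) \<Rightarrow> real \<Rightarrow> bool"
where
  "msm_integral_exists \<alpha> \<alpha>' \<beta> \<beta>' \<gamma> f x \<longleftrightarrow>
     set_integrable lborel {x<..} (msm_integrand \<alpha> \<alpha>' \<beta> \<beta>' \<gamma> f x)"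

definition neg_ddx :: "(real \<Rightarrow> complex) \<Rightarrow> real \<Rightarrow> complex" where
  "neg_ddx g x = - vector_derivative g (at x)"

definition msm_order :: "complex \<Rightarrow> nat" where
  "msm_order \<gamma> = nat \<lfloor>Re \<gamma>\<rfloor> + 1"

definition msm_derivative ::
    "complex \<Rightarrow> complex \<Rightarrow> complex \<Rightarrow> complex \<Rightarrow> complex \<Rightarrow> (real \<Rightarrow> complex) \<Rightarrow> real \<Rightarrow> complex"
where
  "msm_derivative \<alpha> \<alpha>' \<beta> \<beta>' \<gamma> f x =
     (let N = msm_order \<gamma> in
       (neg_ddx ^^ N)
         (msm_integral (- \<alpha>') (- \<alpha>) (- \<beta>') (- \<beta> + of_nat N) (- \<gamma> + of_nat N) f) x)"

text \<open>
  Integrals and derivatives are total functions in HOL; this predicate says that those occurring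
  in \<^const>\<open>msm_derivative\<close> at the point \<open>x\<close> are genuine.
\<close>

definition msm_derivative_exists ::
    "complex \<Rightarrow> complex \<Rightarrow> complex \<Rightarrow> complex \<Rightarrow> complex \<Rightarrow> (real \<Rightarrow> complex) \<Rightarrow> real \<Rightarrow> bool"
where
  "msm_derivative_exists \<alpha> \<alpha>' \<beta> \<beta>' \<gamma> f x \<longleftrightarrow>
     (let N = msm_order \<gamma> in
       (\<forall>\<^sub>F y in nhds x.
          msm_integral_exists (- \<alpha>') (- \<alpha>) (- \<beta>') (- \<beta> + of_nat N) (- \<gamma> + of_nat N) f y \<and>
          (\<forall>k<N. (neg_ddx ^^ k)
             (msm_integral (- \<alpha>') (- \<alpha>) (- \<beta>') (- \<beta> + of_nat N) (- \<gamma> + of_nat N) f)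
               differentiable (at y))))"

section \<open>The I-function\<close>

text \<open>A triple \<open>(c, C, \<kappa>)\<close> contributes a factor \<open>\<Gamma>\<^sup>\<kappa>(c + C s)\<close> or \<open>\<Gamma>\<^sup>\<kappa>(1 - c - C s)\<close>.\<close>

type_synonym triple = "complex \<times> real \<times> real"

text \<open>
  A choice of branches assigns to every gamma factor \<open>\<Gamma>\<^sup>\<kappa>(u + v s)\<close> a continuous logarithm
  \<open>lg u v \<kappa>\<close> of \<open>\<Gamma>(u + v s)\<close> on the contour \<open>Re s = 0\<close> (with the at most one pole on it
  removed).  Since \<open>(u, v, \<kappa>)\<close> is determined by the triple and the shape of the factor, the
  branch is the same for the same triple in all I-functions formed with \<open>lg\<close>.
\<close>

type_synonym gamma_branch = "complex \<Rightarrow> real \<Rightarrow> real \<Rightarrow> complex \<Rightarrow> complex"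

definition is_gamma_branch :: "gamma_branch \<Rightarrow> bool" where
  "is_gamma_branch lg \<longleftrightarrow>
     (\<forall>u v \<kappa>. v \<noteq> 0 \<longrightarrow> \<kappa> > 0 \<longrightarrow>
        continuous_on {s. Re s = 0 \<and> u + of_real v * s \<notin> \<int>\<^sub>\<le>\<^sub>0} (lg u v \<kappa>) \<and>
        (\<forall>s. Re s = 0 \<and> u + of_real v * s \<notin> \<int>\<^sub>\<le>\<^sub>0 \<longrightarrow>
           exp (lg u v \<kappa> s) = Gamma (u + of_real v * s)))"

text \<open>
  At a pole of the gamma function the value \<open>0\<close> together with \<open>1 / 0 = 0\<close> gives
  \<open>1 / \<Gamma>\<^sup>\<kappa>\<close> its correct value \<open>0\<close>; factors in the numerator have no poles on the contour.
\<close>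

definition Gamma_pow :: "gamma_branch \<Rightarrow> complex \<Rightarrow> real \<Rightarrow> real \<Rightarrow> complex \<Rightarrow> complex" where
  "Gamma_pow lg u v \<kappa> s =
     (if u + of_real v * s \<in> \<int>\<^sub>\<le>\<^sub>0 then 0 else exp (of_real \<kappa> * lg u v \<kappa> s))"

definition Gamma_plus :: "gamma_branch \<Rightarrow> triple \<Rightarrow> complex \<Rightarrow> complex" where
  "Gamma_plus lg T s = (case T of (c, C, \<kappa>) \<Rightarrow> Gamma_pow lg c C \<kappa> s)"

definition Gamma_minus :: "gamma_branch \<Rightarrow> triple \<Rightarrow> complex \<Rightarrow> complex" where
  "Gamma_minus lg T s = (case T of (c, C, \<kappa>) \<Rightarrow> Gamma_pow lg (1 - c) (- C) \<kappa> s)"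

text \<open>
  Below \<open>up\<close> is the list of upper triples \<open>(a\<^sub>i, A\<^sub>i, \<alpha>\<^sub>i)\<close> and \<open>lo\<close> that of the lower triples
  \<open>(b\<^sub>j, B\<^sub>j, \<beta>\<^sub>j)\<close>, so that \<open>p = length up\<close> and \<open>q = length lo\<close>; list indices start at \<open>0\<close>.
\<close>

definition I_chi ::
    "gamma_branch \<Rightarrow> nat \<Rightarrow> nat \<Rightarrow> triple list \<Rightarrow> triple list \<Rightarrow> complex \<Rightarrow> complex" where
  "I_chi lg m n up lo s =
     ((\<Prod>j<m. Gamma_plus lg (lo ! j) s) * (\<Prod>i<n. Gamma_minus lg (up ! i) s))
     / ((\<Prod>j=m..<length lo. Gamma_minus lg (lo ! j) s)
        * (\<Prod>i=n..<length up. Gamma_plus lg (up ! i) s))"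

text \<open>
  The I-function at \<open>z\<close> with chosen argument \<open>\<theta>\<close> of \<open>z\<close>; the contour is parametrised by
  \<open>s = \<i> \<tau>\<close>, \<open>ds = \<i> d\<tau>\<close>.
\<close>

definition I_function ::
    "gamma_branch \<Rightarrow> nat \<Rightarrow> nat \<Rightarrow> triple list \<Rightarrow> triple list \<Rightarrow> complex \<Rightarrow> real \<Rightarrow> complex" where
  "I_function lg m n up lo z \<theta> =
     1 / (2 * of_real pi * \<i>) *
       (LBINT \<tau>. (let s = \<i> * of_real \<tau> in
          I_chi lg m n up lo s * exp (- s * (of_real (ln (cmod z)) + \<i> * of_real \<theta>)) * \<i>))"

definition I_mu_star :: "triple list \<Rightarrow> triple list \<Rightarrow> real" where
  "I_mu_star up lo = (\<Sum>(b, B, \<beta>)\<leftarrow>lo. \<beta> * B) - (\<Sum>(a, A, \<alpha>)\<leftarrow>up. \<alpha> * A)"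

definition I_Omega :: "triple list \<Rightarrow> triple list \<Rightarrow> real" where
  "I_Omega up lo =
     (\<Sum>(a, A, \<alpha>)\<leftarrow>up. (1/2 - Re a) * \<alpha>) - (\<Sum>(b, B, \<beta>)\<leftarrow>lo. (1/2 - Re b) * \<beta>)"

definition I_Delta :: "nat \<Rightarrow> nat \<Rightarrow> triple list \<Rightarrow> triple list \<Rightarrow> real" where
  "I_Delta m n up lo =
     (\<Sum>(b, B, \<beta>)\<leftarrow>take m lo. \<beta> * B) - (\<Sum>(b, B, \<beta>)\<leftarrow>drop m lo. \<beta> * B)
     + (\<Sum>(a, A, \<alpha>)\<leftarrow>take n up. \<alpha> * A) - (\<Sum>(a, A, \<alpha>)\<leftarrow>drop n up. \<alpha> * A)"

text \<open>Absolute convergence along \<open>Re s = \<sigma>\<close> at argument \<open>\<theta>\<close>.\<close>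

definition I_abs_conv ::
    "nat \<Rightarrow> nat \<Rightarrow> triple list \<Rightarrow> triple list \<Rightarrow> real \<Rightarrow> real \<Rightarrow> bool" where
  "I_abs_conv m n up lo \<sigma> \<theta> \<longleftrightarrow>
     I_Delta m n up lo > 0 \<and> \<bar>\<theta>\<bar> < pi / 2 * I_Delta m n up lo \<or>
     I_Delta m n up lo \<ge> 0 \<and> \<bar>\<theta>\<bar> = pi / 2 * I_Delta m n up lo \<and>
       (I_mu_star up lo = 0 \<and> I_Omega up lo < -1 \<or>
        I_mu_star up lo \<noteq> 0 \<and> I_Omega up lo + \<sigma> * I_mu_star up lo < -1)"

text \<open>
  The imaginary axis separates the singularities of the two groups of gamma factors in the
  numerator.
\<close>

definition I_separated :: "nat \<Rightarrow> nat \<Rightarrow> triple list \<Rightarrow> triple list \<Rightarrow> bool" where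
  "I_separated m n up lo \<longleftrightarrow>
     (\<forall>(b, B, \<beta>)\<in>set (take m lo). \<forall>s. b + of_real B * s \<in> \<int>\<^sub>\<le>\<^sub>0 \<longrightarrow> Re s < 0) \<and>
     (\<forall>(a, A, \<alpha>)\<in>set (take n up). \<forall>s. 1 - a - of_real A * s \<in> \<int>\<^sub>\<le>\<^sub>0 \<longrightarrow> Re s > 0)"

end

theory Submission
  imports Defs "HOL-Real_Asymp.Real_Asymp"
begin

text \<open>
The operator acts diagonally on powers: under the stated bounds on \<open>Re w\<close> the fractional integral maps
\<open>t\<^sup>-\<^sup>w\<close> to \<open>M(w)\<close> times a power of \<open>x\<close>, where \<open>M\<close> is a quotient of three gamma functions by three others
(\<open>msm_integral_power\<close>).  The Mellin-Barnes integral writes \<open>t\<^sup>-\<^sup>\<rho> I[a t\<^sup>-\<^sup>\<mu>]\<close> as a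
superposition of powers \<open>t\<^sup>-\<^sup>w\<close> with \<open>w = \<rho> - \<mu> s\<close>, all with the same real part \<open>Re \<rho>\<close>.  Fubini's theorem
(\<open>msm_integral_powers_integral\<close>) therefore multiplies the density by \<open>M(\<rho> - \<mu> s)\<close>.  Each application of
\<open>- d/dx\<close> to \<open>x\<^sup>-\<^sup>q\<close> brings down a factor, so that \<open>N\<close> of them give \<open>(q)\<^sub>N\<close> (\<open>neg_ddx_powers_integral\<close>), and
\<open>\<Gamma>(q) (q)\<^sub>N = \<Gamma>(q + N)\<close> absorbs it into one factor of \<open>M\<close>.  The six gamma functions that result are exactly
those of the three new upper and the three new lower triples (\<open>I_chi_extend\<close>).

The integral of a power is computed with \<open>z = 1 - x/t\<close>.  Pfaff's transformation (\<open>hyp2F1_pfaff\<close>) turns the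
Gauss functions at negative arguments inside \<open>F\<^sub>3\<close> into power series in \<open>z\<close>, and what remains is a double
series of Beta integrals over \<open>(0,1)\<close>.  Both the inner and the outer sum are instances of Gauss's
summation theorem (\<open>gauss_summation\<close>), which is proved here in a regularised form valid for every third
parameter.  The delicate point is the exchange of the outer sum with the integral: the double series
need not converge absolutely when the second parameter of \<open>F\<^sub>3\<close>, here called \<open>a'\<close>,
has negative real part.  The integrals of the absolute values of the inner sums nevertheless decay at the rate of the integrals themselves (\<open>kernel_norm_bigo\<close>).  If
\<open>Re a' > 0\<close>, the inner sum is dominated by the same sum with real parameters, whose integral is known;
a contiguous relation reduces the other cases to this one.

Fubini's theorem and differentiation under the integral need the densities to be integrable.  This is
what the convergence conditions express, once the gamma function is bounded from both sides on vertical
lines by \<open>|y|\<close> to the power \<open>x - 1/2\<close> times \<open>exp (- \<pi>|y|/2)\<close>.  On the line \<open>Re s = 1/2\<close> the reflection formula gives the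
modulus exactly.  In the strip \<open>1/2 \<le> x \<le> 3/2\<close> the quotient \<open>\<Gamma>(x) / |\<Gamma>(x + iy)|\<close> is an infinite
product whose logarithm is convex in \<open>x\<close>, which bounds \<open>1/\<Gamma>\<close>; the functional equation moves the bound to all
vertical lines and the reflection formula converts it into one for \<open>\<Gamma>\<close>.  The condition on the extended
I-function controls the highest derivative, and all lower ones are dominated by it because \<open>Re q > 0\<close>.
\<close>

section \<open>Growth of Pochhammer symbols\<close>

lemma Re_pos_not_nonpos_Int: "Re z > 0 \<Longrightarrow> z \<notin> \<int>\<^sub>\<le>\<^sub>0"
  by (auto elim!: nonpos_Ints_cases)

text \<open>
This is the Gauss limit \<open>\<Gamma>(a)\<inverse> = lim (a)\<^sub>n\<^sub>+\<^sub>1 / (n! n\<^sup>a)\<close> in absolute value, shifted by one index and normalised so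
that it makes sense for \<open>n = 0\<close> as well.
\<close>

lemma norm_pochhammer_asymp:
  fixes a :: complex
  shows "(\<lambda>n. norm (pochhammer a n) / (fact n * real (n + 1) powr (Re a - 1))) \<longlonglongrightarrow> norm (rGamma a)"
proof -
  define r :: "nat \<Rightarrow> real" where "r n = real n powr Re a / (real (n + 1) * real (n + 2) powr (Re a - 1))" for n
  have "r \<longlonglongrightarrow> 1" unfolding r_def by real_asymp
  moreover have "(\<lambda>n. norm (rGamma_series a n)) \<longlonglongrightarrow> norm (rGamma a)"
    by (intro tendsto_intros)
  ultimately have "(\<lambda>n. norm (rGamma_series a n) * r n) \<longlonglongrightarrow> norm (rGamma a) * 1"
    by (intro tendsto_mult)
  also have "?this \<longleftrightarrow> (\<lambda>n. norm (pochhammer a (Suc n)) / (fact (Suc n) * real (Suc n + 1) powr (Re a - 1))) \<longlonglongrightarrow> norm (rGamma a) * 1"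
  proof (rule filterlim_cong[OF refl refl], rule eventually_mono[OF eventually_gt_at_top[of 0]])
    fix n :: nat assume n: "n > 0"
    have "norm (exp (a * of_real (ln (real n)))) = real n powr Re a"
      using n by (simp add: powr_def mult.commute)
    thus "norm (rGamma_series a n) * r n =
       norm (pochhammer a (Suc n)) / (fact (Suc n) * real (Suc n + 1) powr (Re a - 1))"
      using n by (simp add: rGamma_series_def r_def norm_mult norm_divide field_simps
         del: of_nat_Suc exp_of_real of_nat_add)
  qed
  finally show ?thesis by (subst (asm) filterlim_sequentially_Suc) simp
qed

lemma pochhammer_bigo:
  "(\<lambda>n. norm (pochhammer a n)) \<in> O(\<lambda>n. fact n * real (n + 1) powr (Re a - 1))"
  by (rule bigoI_tendsto[OF norm_pochhammer_asymp]) simp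

lemma inverse_pochhammer_bigo:
  fixes a :: complex
  assumes "a \<notin> \<int>\<^sub>\<le>\<^sub>0"
  shows "(\<lambda>n. inverse (norm (pochhammer a n))) \<in> O(\<lambda>n. inverse (fact n * real (n + 1) powr (Re a - 1)))"
proof (rule bigoI_tendsto)
  show "(\<lambda>n. inverse (norm (pochhammer a n)) / inverse (fact n * real (n + 1) powr (Re a - 1)))
      \<longlonglongrightarrow> inverse (norm (rGamma a))"
    using tendsto_inverse[OF norm_pochhammer_asymp[of a]] assms
    by (simp add: rGamma_eq_zero_iff field_simps)
qed simp

lemma norm_pochhammer_ge:
  assumes "Re c > 0"
  shows "pochhammer (Re c) n \<le> norm (pochhammer c n)"
proof -
  have "pochhammer (Re c) n = (\<Prod>i<n. Re c + real i)"
    by (simp add: pochhammer_prod atLeast0LessThan)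
  also have "\<dots> \<le> (\<Prod>i<n. norm (c + of_nat i))"
  proof (rule prod_mono)
    fix i show "0 \<le> Re c + real i \<and> Re c + real i \<le> norm (c + of_nat i)"
      using assms complex_Re_le_cmod[of "c + of_nat i"] by simp
  qed
  also have "\<dots> = norm (pochhammer c n)"
    by (simp add: pochhammer_prod atLeast0LessThan prod_norm)
  finally show ?thesis .
qed

text \<open>
Both sides have the same growth in \<open>n\<close>, so replacing a parameter by its real part costs only a constant.
Together with \<open>norm_pochhammer_ge\<close> this lets series with complex parameters be dominated by series with
real ones.
\<close>

lemma norm_pochhammer_le_real:
  assumes d: "Re d > 0"
  obtains C where "C > 0" "\<And>n. norm (pochhammer d n) \<le> C * pochhammer (Re d) n"
proof -
  define w where "w n = fact n * real (n + 1) powr (Re d - 1)" for n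
  have pos: "pochhammer (Re d) n > 0" for n using d by (rule pochhammer_pos)
  have nrm: "norm (pochhammer (complex_of_real (Re d)) n) = pochhammer (Re d) n" for n
    using pos[of n] by (simp only: pochhammer_of_real norm_of_real abs_of_pos)
  have "rGamma (complex_of_real (Re d)) \<noteq> 0"
    using Re_pos_not_nonpos_Int[of "of_real (Re d)"] d by (simp add: rGamma_eq_zero_iff)
  hence "(\<lambda>n. (norm (pochhammer d n) / w n) / (norm (pochhammer (complex_of_real (Re d)) n) / w n))
      \<longlonglongrightarrow> norm (rGamma d) / norm (rGamma (complex_of_real (Re d)))"
    using norm_pochhammer_asymp[of "of_real (Re d)"] unfolding w_def
    by (intro tendsto_divide norm_pochhammer_asymp) simp_all
  hence "(\<lambda>n. norm (pochhammer d n) / pochhammer (Re d) n) \<longlonglongrightarrow> norm (rGamma d) / norm (rGamma (complex_of_real (Re d)))"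
    by (simp add: nrm w_def)
  hence "Bseq (\<lambda>n. norm (pochhammer d n) / pochhammer (Re d) n)"
    by (intro convergent_imp_Bseq convergentI)
  then obtain C where "C > 0" "\<And>n. norm (norm (pochhammer d n) / pochhammer (Re d) n) \<le> C"
    unfolding Bseq_def by blast
  with that[of C] pos show ?thesis by (simp add: abs_of_pos pos_divide_le_eq)
qed

text \<open>
If \<open>Re c > 0\<close> this is the lower bound for \<open>(c)\<^sub>n\<close>, as \<open>1/\<Gamma>(c + n) = 1/(\<Gamma>(c) (c)\<^sub>n)\<close>.  The functional equation
\<open>1/\<Gamma>(w) = w / \<Gamma>(w + 1)\<close> then moves \<open>c\<close> to the left, past the poles.
\<close>

lemma rGamma_bigo:
  "(\<lambda>n. norm (rGamma (c + of_nat n))) \<in> O(\<lambda>n. inverse (fact n * real (n + 1) powr (Re c - 1)))"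
proof -
  have "(\<lambda>n. norm (rGamma (c + of_nat n))) \<in> O(\<lambda>n. inverse (fact n * real (n + 1) powr (Re c - 1)))"
    if "real m > - Re c" for m and c :: complex
    using that
  proof (induction m arbitrary: c)
    case 0
    hence c: "c \<notin> \<int>\<^sub>\<le>\<^sub>0" by (intro Re_pos_not_nonpos_Int) simp
    have "norm (rGamma (c + of_nat n)) = norm (rGamma c) * inverse (norm (pochhammer c n))" for n
    proof -
      have "pochhammer c n \<noteq> 0" using c by (auto simp: pochhammer_eq_0_iff)
      thus ?thesis using pochhammer_rGamma[of c n] by (simp add: norm_mult)
    qed
    with inverse_pochhammer_bigo[OF c] show ?case by simp
  next
    case (Suc m)
    have "(\<lambda>n. norm (c + of_nat n) * norm (rGamma (c + 1 + of_nat n)))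
        \<in> O(\<lambda>n. real (n + 1) * inverse (fact n * real (n + 1) powr (Re (c + 1) - 1)))"
    proof (intro landau_o.big.mult Suc.IH)
      show "(\<lambda>n. norm (c + of_nat n)) \<in> O(\<lambda>n. real (n + 1))"
      proof (rule bigoI[of _ "norm c + 1"], rule always_eventually, rule allI)
        fix n
        have "norm (c + of_nat n) \<le> norm c + real n" using norm_triangle_ineq[of c "of_nat n"] by simp
        also have "\<dots> \<le> (norm c + 1) * real (n + 1)" by (simp add: algebra_simps)
        finally show "norm (norm (c + of_nat n)) \<le> (norm c + 1) * norm (real (n + 1))" by simp
      qed
    qed (use Suc.prems in simp)
    also have "(\<lambda>n. real (n + 1) * inverse (fact n * real (n + 1) powr (Re (c + 1) - 1))) =
        (\<lambda>n. inverse (fact n * real (n + 1) powr (Re c - 1)))"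
      by (rule ext) (simp add: powr_diff field_simps del: of_nat_Suc of_nat_add)
    also have "(\<lambda>n. norm (c + of_nat n) * norm (rGamma (c + 1 + of_nat n))) = (\<lambda>n. norm (rGamma (c + of_nat n)))"
      using rGamma_plus1[of "c + of_nat _"] by (simp add: add_ac flip: norm_mult)
    finally show ?case .
  qed
  moreover obtain m :: nat where "real m > - Re c" using reals_Archimedean2 by blast
  ultimately show ?thesis by simp
qed

section \<open>Gauss's summation theorem\<close>

text \<open>
Dividing by \<open>\<Gamma>(c + n)\<close> instead of \<open>(c)\<^sub>n\<close> makes the terms entire in \<open>c\<close>, so no exceptional values of \<open>c\<close> have
to be excluded.  This matters because \<open>c\<close> varies along the contour of a Mellin-Barnes integral.
\<close>

definition gauss_term :: "complex \<Rightarrow> complex \<Rightarrow> complex \<Rightarrow> nat \<Rightarrow> complex" where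
  "gauss_term a b c n = pochhammer a n * pochhammer b n / fact n * rGamma (c + of_nat n)"

lemma gauss_term_bigo:
  "(\<lambda>n. norm (gauss_term a b c n)) \<in> O(\<lambda>n. real (n + 1) powr (Re (a + b - c) - 1))"
proof -
  let ?w = "\<lambda>a n. fact n * real (n + 1) powr (Re a - 1)"
  have "(\<lambda>n. norm (pochhammer a n) * norm (pochhammer b n) / fact n * norm (rGamma (c + of_nat n)))
      \<in> O(\<lambda>n. ?w a n * ?w b n / fact n * inverse (?w c n))"
    by (intro landau_o.big.mult landau_o.big.divide pochhammer_bigo rGamma_bigo) auto
  also have "(\<lambda>n. ?w a n * ?w b n / fact n * inverse (?w c n)) = (\<lambda>n. real (n + 1) powr (Re (a + b - c) - 1))"
    by (rule ext) (simp add: powr_add powr_diff field_simps del: of_nat_Suc of_nat_add)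
  finally show ?thesis by (simp add: gauss_term_def norm_mult norm_divide)
qed

abbreviation hyp2F1_coeff :: "complex \<Rightarrow> complex \<Rightarrow> complex \<Rightarrow> nat \<Rightarrow> complex" where
  "hyp2F1_coeff a b c n \<equiv> pochhammer a n * pochhammer b n / (pochhammer c n * fact n)"

lemma hyp2F1_coeff_eq_gauss_term:
  assumes "c \<notin> \<int>\<^sub>\<le>\<^sub>0"
  shows "hyp2F1_coeff a b c n = Gamma c * gauss_term a b c n"
proof -
  have "pochhammer c n \<noteq> 0" "Gamma c \<noteq> 0"
    using assms by (auto simp: pochhammer_eq_0_iff Gamma_eq_zero_iff)
  moreover from this have "Gamma c * rGamma (c + of_nat n) = 1 / pochhammer c n"
    using pochhammer_rGamma[of c n] by (simp add: rGamma_inverse_Gamma[of c] field_simps)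
  moreover have "Gamma c * gauss_term a b c n = pochhammer a n * pochhammer b n / fact n * (Gamma c * rGamma (c + of_nat n))"
    by (simp add: gauss_term_def)
  ultimately show ?thesis by simp
qed

lemma summable_powr_Suc: "e < -1 \<Longrightarrow> summable (\<lambda>n. norm (real (n + 1) powr e))"
  using summable_real_powr_iff[of e] summable_iff_shift[of "\<lambda>n. real n powr e" 1] by simp

lemma summable_norm_gauss_term:
  assumes "Re (c - a - b) > 0"
  shows "summable (\<lambda>n. norm (gauss_term a b c n))"
  by (rule summable_comparison_test_bigo[OF summable_powr_Suc gauss_term_bigo]) (use assms in simp)

text \<open>
The difference of the two sides telescopes: with \<open>X\<^sub>n\<close> equal to \<open>n\<close> times the \<open>n\<close>-th term for \<open>c\<close>, its \<open>n\<close>-th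
term is \<open>X\<^sub>n - X\<^sub>n\<^sub>+\<^sub>1\<close>.  Here \<open>X\<^sub>0 = 0\<close>, and \<open>X\<^sub>n\<close> tends to \<open>0\<close> precisely because \<open>Re (c - a - b) > 0\<close>.
\<close>

lemma gauss_sum_contiguous:
  assumes "Re (c - a - b) > 0"
  shows "(c - a - b) * (\<Sum>n. gauss_term a b c n) = (c - a) * (c - b) * (\<Sum>n. gauss_term a b (c + 1) n)"
proof -
  define X where "X n = of_nat n * gauss_term a b c n" for n
  have sum1: "summable (gauss_term a b c)"
    using summable_norm_gauss_term[OF assms] by (rule summable_norm_cancel)
  have sum2: "summable (gauss_term a b (c + 1))"
    by (rule summable_norm_cancel, rule summable_norm_gauss_term) (use assms in simp)
  have X: "X \<longlonglongrightarrow> 0"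
  proof -
    have "(\<lambda>n. real n * norm (gauss_term a b c n)) \<in> O(\<lambda>n. real n * real (n + 1) powr (Re (a + b - c) - 1))"
      by (intro landau_o.big.mult gauss_term_bigo) simp
    also have "(\<lambda>n. real n * real (n + 1) powr (e - 1)) \<in> o(\<lambda>n. 1)" if "e < 0" for e
      using that by real_asymp
    finally have "(\<lambda>n. real n * norm (gauss_term a b c n)) \<in> o(\<lambda>n. 1)" using assms by simp
    thus ?thesis
      by (auto dest!: smalloD_tendsto simp: X_def norm_mult intro!: tendsto_norm_zero_cancel[of X])
  qed
  have "(\<lambda>n. X (Suc n) - X n) sums (0 - X 0)" by (rule telescope_sums[OF X])
  hence 1: "(\<lambda>n. X n - X (Suc n)) sums 0"
    using sums_minus[of "\<lambda>n. X (Suc n) - X n" "0 - X 0"] by (simp add: X_def)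
  have eq: "X n - X (Suc n) = (c - a - b) * gauss_term a b c n - (c - a) * (c - b) * gauss_term a b (c + 1) n" for n
  proof -
    define g where "g = pochhammer a n * pochhammer b n / fact n"
    define R where "R = rGamma (c + of_nat n + 1)"
    have R: "rGamma (c + of_nat n) = (c + of_nat n) * R" by (simp add: R_def rGamma_plus1)
    have "X (Suc n) = (a + of_nat n) * (b + of_nat n) * g * R"
    proof -
      have R': "rGamma (c + of_nat (Suc n)) = R" by (simp add: R_def add_ac)
      have "s * (pa * (a + of_nat n) * (pb * (b + of_nat n)) / (s * f) * R) = (a + of_nat n) * (b + of_nat n) * (pa * pb / f) * R"
        if "s \<noteq> 0" "f \<noteq> 0" for s f pa pb :: complex using that by simp
      from this[of "of_nat (Suc n)" "fact n"] show ?thesis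
        unfolding X_def gauss_term_def g_def pochhammer_Suc R' fact_Suc of_nat_fact of_nat_mult
        by (simp del: of_nat_Suc)
    qed
    moreover have "X n = of_nat n * g * ((c + of_nat n) * R)"
      by (simp add: X_def gauss_term_def g_def R)
    moreover have "gauss_term a b c n = g * ((c + of_nat n) * R)"
      by (simp add: gauss_term_def g_def R)
    moreover have "gauss_term a b (c + 1) n = g * R"
      by (simp add: gauss_term_def g_def R_def add_ac)
    ultimately show ?thesis by (simp only:) (simp add: algebra_simps)
  qed
  have "(\<lambda>n. X n - X (Suc n)) sums ((c - a - b) * (\<Sum>n. gauss_term a b c n) - (c - a) * (c - b) * (\<Sum>n. gauss_term a b (c + 1) n))"
    unfolding eq by (intro sums_diff sums_mult summable_sums sum1 sum2)
  from sums_unique2[OF this 1] show ?thesis by simp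
qed

lemma gauss_sum_shift:
  assumes "Re (c - a - b) > 0"
  shows "pochhammer (c - a - b) m * (\<Sum>n. gauss_term a b c n)
       = pochhammer (c - a) m * pochhammer (c - b) m * (\<Sum>n. gauss_term a b (c + of_nat m) n)"
proof (induction m)
  case (Suc m)
  have "(c + of_nat m - a - b) * (\<Sum>n. gauss_term a b (c + of_nat m) n) =
     (c + of_nat m - a) * (c + of_nat m - b) * (\<Sum>n. gauss_term a b (c + of_nat m + 1) n)"
    using assms by (intro gauss_sum_contiguous) auto
  moreover have "c + of_nat m - a - b = c - a - b + of_nat m" "c + of_nat m - a = c - a + of_nat m"
    "c + of_nat m - b = c - b + of_nat m" "c + of_nat m + 1 = c + of_nat (Suc m)" by simp_all
  ultimately have *: "(c - a - b + of_nat m) * (\<Sum>n. gauss_term a b (c + of_nat m) n) =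
     (c - a + of_nat m) * (c - b + of_nat m) * (\<Sum>n. gauss_term a b (c + of_nat (Suc m)) n)"
    by (simp only:)
  have "pochhammer (c - a - b) (Suc m) * (\<Sum>n. gauss_term a b c n)
      = (c - a - b + of_nat m) * (pochhammer (c - a - b) m * (\<Sum>n. gauss_term a b c n))"
    by (simp only: pochhammer_Suc mult_ac)
  also have "\<dots> = pochhammer (c - a) m * pochhammer (c - b) m *
      ((c - a - b + of_nat m) * (\<Sum>n. gauss_term a b (c + of_nat m) n))"
    by (subst Suc.IH) (simp only: mult_ac)
  also have "\<dots> = pochhammer (c - a) (Suc m) * pochhammer (c - b) (Suc m) *
      (\<Sum>n. gauss_term a b (c + of_nat (Suc m)) n)"
    by (simp only: * pochhammer_Suc mult_ac)
  finally show ?case .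
qed auto

text \<open>
Each Pochhammer symbol is replaced by its Gauss product; the powers of \<open>m\<close> cancel since
\<open>(c - a) + (c - b) = c + (c - a - b)\<close>.
\<close>

lemma gauss_limit_coeff:
  fixes a b c :: complex
  assumes c: "c \<notin> \<int>\<^sub>\<le>\<^sub>0" and d: "c - a - b \<notin> \<int>\<^sub>\<le>\<^sub>0"
  shows "(\<lambda>m. pochhammer (c - a) m * pochhammer (c - b) m / (pochhammer c m * pochhammer (c - a - b) m))
     \<longlonglongrightarrow> rGamma (c - a) * rGamma (c - b) / (rGamma c * rGamma (c - a - b))"
proof -
  have nz: "rGamma c \<noteq> 0" "rGamma (c - a - b) \<noteq> 0" using assms by (auto simp: rGamma_eq_zero_iff)
  have "(\<lambda>m. rGamma_series (c - a) m * rGamma_series (c - b) m / (rGamma_series c m * rGamma_series (c - a - b) m))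
     \<longlonglongrightarrow> rGamma (c - a) * rGamma (c - b) / (rGamma c * rGamma (c - a - b))"
    using nz by (intro tendsto_intros) auto
  also have "?this \<longleftrightarrow> (\<lambda>m. pochhammer (c - a) (Suc m) * pochhammer (c - b) (Suc m) / (pochhammer c (Suc m) * pochhammer (c - a - b) (Suc m)))
     \<longlonglongrightarrow> rGamma (c - a) * rGamma (c - b) / (rGamma c * rGamma (c - a - b))"
  proof (rule filterlim_cong[OF refl refl], rule eventually_mono[OF eventually_gt_at_top[of 0]])
    fix n :: nat assume "n > 0"
    define E where "E z = exp (z * complex_of_real (ln (real n)))" for z
    have E: "E (c - a) * E (c - b) = E c * E (c - a - b)"
      by (simp add: E_def exp_add [symmetric] algebra_simps)
    have Enz: "E z \<noteq> 0" for z by (simp add: E_def)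
    have *: "rGamma_series z n = pochhammer z (Suc n) / (fact n * E z)" for z
      by (simp add: rGamma_series_def E_def)
    have "rGamma_series (c - a) n * rGamma_series (c - b) n / (rGamma_series c n * rGamma_series (c - a - b) n) =
      pochhammer (c - a) (Suc n) * pochhammer (c - b) (Suc n) / (pochhammer c (Suc n) * pochhammer (c - a - b) (Suc n))
       * ((E c * E (c - a - b)) / (E (c - a) * E (c - b)))"
      unfolding * using Enz by (simp add: field_simps)
    also have "\<dots> = pochhammer (c - a) (Suc n) * pochhammer (c - b) (Suc n) / (pochhammer c (Suc n) * pochhammer (c - a - b) (Suc n))"
      unfolding E using Enz by simp
    finally show "rGamma_series (c - a) n * rGamma_series (c - b) n / (rGamma_series c n * rGamma_series (c - a - b) n) =
      pochhammer (c - a) (Suc n) * pochhammer (c - b) (Suc n) / (pochhammer c (Suc n) * pochhammer (c - a - b) (Suc n))" .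
  qed
  finally show ?thesis by (subst (asm) filterlim_sequentially_Suc)
qed

text \<open>
All terms but the first tend to \<open>0\<close>, and \<open>|(c + m)\<^sub>n| \<ge> |(c)\<^sub>n|\<close> gives a summable majorant for Tannery's theorem.
\<close>

lemma gauss_sum_limit:
  assumes "Re (c - a - b) > 0" "Re c > 0"
  shows "(\<lambda>m. \<Sum>n. hyp2F1_coeff a b (c + of_nat m) n) \<longlonglongrightarrow> 1"
proof -
  define h where "h n = norm (hyp2F1_coeff a b c n)" for n
  have c: "c \<notin> \<int>\<^sub>\<le>\<^sub>0" using assms by (intro Re_pos_not_nonpos_Int)
  have nz: "pochhammer c n \<noteq> 0" for n using c by (auto simp: pochhammer_eq_0_iff)
  have summ: "summable h" unfolding h_def hyp2F1_coeff_eq_gauss_term[OF c] norm_mult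
    by (intro summable_mult summable_norm_gauss_term assms)
  have "(\<lambda>m. \<Sum>n. hyp2F1_coeff a b (c + of_nat m) n) \<longlonglongrightarrow>
     (\<Sum>n. if n = 0 then 1 else 0)"
  proof (rule tannerys_theorem[THEN conjunct2, THEN conjunct2])
    show "\<forall>\<^sub>F (n, m) in at_top \<times>\<^sub>F at_top. norm (hyp2F1_coeff a b (c + of_nat m) n) \<le> h n"
    proof (rule always_eventually, safe)
      fix n m
      have "norm (pochhammer c n) \<le> norm (pochhammer (c + of_nat m) n)"
        unfolding pochhammer_prod prod_norm [symmetric]
      proof (rule prod_mono, safe)
        fix i
        have "\<bar>Re (c + of_nat i)\<bar> \<le> \<bar>Re (c + of_nat m + of_nat i)\<bar>" using assms by simp
        moreover have "Im (c + of_nat i) = Im (c + of_nat m + of_nat i)" by simp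
        ultimately show "norm (c + of_nat i) \<le> norm (c + of_nat m + of_nat i)"
          unfolding cmod_def by (intro real_sqrt_le_mono add_mono) (auto simp: abs_le_square_iff)
      qed auto
      thus "norm (hyp2F1_coeff a b (c + of_nat m) n) \<le> h n"
        unfolding h_def norm_mult norm_divide using nz
        by (intro divide_left_mono mult_mono mult_pos_pos) (auto intro: less_le_trans[of 0 "norm (pochhammer c n)"])
    qed
    fix n
    show "(\<lambda>m. hyp2F1_coeff a b (c + of_nat m) n) \<longlonglongrightarrow> (if n = 0 then 1 else 0)"
    proof (cases "n = 0")
      case False
      have "filterlim (\<lambda>m. pochhammer (c + of_nat m) n * fact n) at_infinity at_top"
      proof -
        have lb: "real m \<le> norm (pochhammer (c + of_nat m) n * fact n)" if "m > 0" for m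
        proof -
          have "1 * real m \<le> fact n * norm (pochhammer (c + of_nat m) n)"
          proof (rule mult_mono)
            have "real m = real m ^ 1" by simp
            also have "\<dots> \<le> real m ^ n" using that False by (intro power_increasing) auto
            also have "\<dots> = (\<Prod>i = 0..<n. real m)" by simp
            also have "\<dots> \<le> (\<Prod>i = 0..<n. norm (c + of_nat m + of_nat i))"
            proof (rule prod_mono, safe)
              fix i show "real m \<le> norm (c + of_nat m + of_nat i)"
                using complex_Re_le_cmod[of "c + of_nat m + of_nat i"] assms by simp
            qed auto
            finally show "real m \<le> norm (pochhammer (c + of_nat m) n)" by (simp add: pochhammer_prod prod_norm)
          qed auto
          thus ?thesis by (simp add: norm_mult mult.commute)
        qed
        show ?thesis unfolding filterlim_at_infinity_conv_norm_at_top
          by (rule filterlim_at_top_mono[OF filterlim_real_sequentially])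
             (use lb in \<open>auto intro: eventually_mono[OF eventually_gt_at_top[of 0]]\<close>)
      qed
      thus ?thesis using False by (auto intro!: tendsto_divide_0 tendsto_const)
    qed simp
  qed (use summ in auto)
  also have "(\<Sum>n. if n = 0 then 1 else 0 :: complex) = 1"
    using sums_single[of 0 "\<lambda>_. 1 :: complex"] by (simp add: sums_iff)
  finally show ?thesis .
qed

text \<open>
For \<open>Re c > 0\<close> the contiguous relation is iterated and its limit taken.  This reaches every
other \<open>c\<close> from the right, since both sides obey the same recursion in \<open>c\<close>.
\<close>

theorem gauss_summation:
  assumes "Re (c - a - b) > 0"
  shows "gauss_term a b c sums (Gamma (c - a - b) * rGamma (c - a) * rGamma (c - b))"
proof -
  have *: "(\<Sum>n. gauss_term a b c n) = Gamma (c - a - b) * rGamma (c - a) * rGamma (c - b)"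
    if "Re (c - a - b) > 0" "Re c > 0" for c
  proof -
    have c: "c \<notin> \<int>\<^sub>\<le>\<^sub>0" "c - a - b \<notin> \<int>\<^sub>\<le>\<^sub>0" using that by (auto intro!: Re_pos_not_nonpos_Int)
    have nz: "pochhammer c n \<noteq> 0" "pochhammer (c - a - b) n \<noteq> 0" for n
      using c by (auto simp: pochhammer_eq_0_iff)
    define Q where "Q m = pochhammer (c - a) m * pochhammer (c - b) m / (pochhammer c m * pochhammer (c - a - b) m)" for m
    define W where "W m = (\<Sum>n. hyp2F1_coeff a b (c + of_nat m) n)" for m
    have eq: "(\<Sum>n. gauss_term a b c n) = rGamma c * (Q m * W m)" for m
    proof -
      have cm: "c + of_nat m \<notin> \<int>\<^sub>\<le>\<^sub>0" using that by (intro Re_pos_not_nonpos_Int) simp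
      have "summable (gauss_term a b (c + of_nat m))"
        by (rule summable_norm_cancel, rule summable_norm_gauss_term) (use that in simp)
      hence "W m = Gamma (c + of_nat m) * (\<Sum>n. gauss_term a b (c + of_nat m) n)"
        unfolding W_def hyp2F1_coeff_eq_gauss_term[OF cm] by (rule suminf_mult)
      hence "(\<Sum>n. gauss_term a b (c + of_nat m) n) = rGamma (c + of_nat m) * W m"
        using cm by (simp add: rGamma_inverse_Gamma Gamma_eq_zero_iff)
      also have "rGamma (c + of_nat m) = rGamma c / pochhammer c m"
        using pochhammer_rGamma[of c m] nz(1)[of m] by (simp add: field_simps)
      finally show ?thesis
        using gauss_sum_shift[OF that(1), of m] nz[of m] by (simp add: Q_def field_simps)
    qed
    have "(\<lambda>m. rGamma c * (Q m * W m)) \<longlonglongrightarrow> rGamma c * (rGamma (c - a) * rGamma (c - b) / (rGamma c * rGamma (c - a - b)) * 1)"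
      unfolding Q_def W_def using that c by (intro tendsto_mult tendsto_const gauss_limit_coeff gauss_sum_limit) auto
    hence "(\<Sum>n. gauss_term a b c n) = rGamma c * (rGamma (c - a) * rGamma (c - b) / (rGamma c * rGamma (c - a - b)) * 1)"
      unfolding eq[symmetric] by (simp add: LIMSEQ_const_iff)
    thus ?thesis using c by (simp add: rGamma_eq_zero_iff rGamma_inverse_Gamma Gamma_eq_zero_iff field_simps)
  qed
  obtain m :: nat where "real m > - Re c" using reals_Archimedean2 by blast
  hence m: "Re (c + of_nat m) > 0" by simp
  have d: "c - a - b \<notin> \<int>\<^sub>\<le>\<^sub>0" using assms by (auto intro!: Re_pos_not_nonpos_Int)
  have nz: "pochhammer (c - a - b) m \<noteq> 0" using d by (auto simp: pochhammer_eq_0_iff)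
  have dm: "c - a - b + of_nat m \<notin> \<int>\<^sub>\<le>\<^sub>0" using assms by (auto intro!: Re_pos_not_nonpos_Int)
  have "pochhammer (c - a - b) m * (\<Sum>n. gauss_term a b c n)
      = pochhammer (c - a) m * pochhammer (c - b) m * (Gamma (c + of_nat m - a - b) * rGamma (c + of_nat m - a) * rGamma (c + of_nat m - b))"
    using gauss_sum_shift[OF assms, of m] *[of "c + of_nat m"] m assms by simp
  also have "\<dots> = Gamma (c - a - b + of_nat m) * rGamma (c - a) * rGamma (c - b)"
    using pochhammer_rGamma[of "c - a" m] pochhammer_rGamma[of "c - b" m] by (simp add: algebra_simps)
  also have "Gamma (c - a - b + of_nat m) = pochhammer (c - a - b) m * Gamma (c - a - b)"
    using pochhammer_Gamma[OF d, of m] d by (simp add: Gamma_eq_zero_iff)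
  finally have "(\<Sum>n. gauss_term a b c n) = Gamma (c - a - b) * rGamma (c - a) * rGamma (c - b)"
    using nz by simp
  with summable_norm_gauss_term[OF assms, THEN summable_norm_cancel] show ?thesis
    by (simp add: sums_iff)
qed

section \<open>The Gauss function on the negative axis\<close>

definition hyp2F1_fps :: "complex \<Rightarrow> complex \<Rightarrow> complex \<Rightarrow> complex fps" where
  "hyp2F1_fps a b c = Abs_fps (\<lambda>n. hyp2F1_coeff a b c n)"

lemma eval_hyp2F1_fps: "eval_fps (hyp2F1_fps a b c) z = hyp2F1_series a b c z"
  by (simp add: eval_fps_def hyp2F1_series_def hyp2F1_fps_def field_simps)

lemma summable_powr_times_power:
  fixes r e :: real
  assumes "0 \<le> r" "r < 1"
  shows "summable (\<lambda>n. real (n + 1) powr e * r ^ n)"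
proof (cases "r = 0")
  case False
  hence r: "r > 0" using assms by simp
  have "(\<lambda>n. real (n + 1) powr e * r ^ n) \<in> O(\<lambda>n. real n powr (-2))"
    using r assms by real_asymp
  moreover have "summable (\<lambda>n. norm (real n powr (-2)))"
    using summable_real_powr_iff[of "-2"] by simp
  ultimately show ?thesis by (rule summable_comparison_test_bigo[rotated])
next
  case True
  thus ?thesis by (intro summable_finite[of "{0}"]) auto
qed

lemma hyp2F1_coeff_bigo:
  assumes "c \<notin> \<int>\<^sub>\<le>\<^sub>0"
  shows "(\<lambda>n. norm (hyp2F1_coeff a b c n)) \<in> O(\<lambda>n. real (n + 1) powr (Re (a + b - c) - 1))"
  unfolding hyp2F1_coeff_eq_gauss_term[OF assms] norm_mult using gauss_term_bigo by simp

lemma summable_norm_hyp2F1_series: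
  fixes a b c z :: complex
  assumes "c \<notin> \<int>\<^sub>\<le>\<^sub>0" "norm z < 1"
  shows "summable (\<lambda>n. norm (hyp2F1_coeff a b c n) * norm z ^ n)"
proof (rule summable_comparison_test_bigo)
  show "summable (\<lambda>n. norm (real (n + 1) powr (Re (a + b - c) - 1) * norm z ^ n))"
    using summable_powr_times_power[of "norm z" "Re (a + b - c) - 1"] assms by simp
qed (intro landau_o.big.mult hyp2F1_coeff_bigo assms landau_o.big_refl)

lemma hyp2F1_series_sums:
  assumes "c \<notin> \<int>\<^sub>\<le>\<^sub>0" "norm z < 1"
  shows "(\<lambda>n. hyp2F1_coeff a b c n * z ^ n) sums hyp2F1_series a b c z"
proof -
  have "summable (\<lambda>n. hyp2F1_coeff a b c n * z ^ n)"
    using summable_norm_hyp2F1_series[OF assms, of a b]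
    by (intro summable_norm_cancel[of "\<lambda>n. hyp2F1_coeff a b c n * z ^ n"]) (simp add: norm_mult norm_power norm_divide)
  thus ?thesis by (simp add: hyp2F1_series_def sums_iff field_simps)
qed

lemma fps_conv_radius_hyp2F1_fps:
  assumes "c \<notin> \<int>\<^sub>\<le>\<^sub>0"
  shows "fps_conv_radius (hyp2F1_fps a b c) \<ge> 1"
  unfolding fps_conv_radius_def
proof (rule conv_radius_geI_ex)
  fix r :: real assume r: "0 < r" "ereal r < 1"
  show "\<exists>z. norm z = r \<and> summable (\<lambda>n. fps_nth (hyp2F1_fps a b c) n * z ^ n)"
  proof (intro exI[of _ "of_real r"] conjI, goal_cases)
    case 2
    show ?case
    proof (rule summable_norm_cancel)
      show "summable (\<lambda>n. norm (fps_nth (hyp2F1_fps a b c) n * of_real r ^ n))"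
        using summable_norm_hyp2F1_series[OF assms, of "of_real r" a b] r
        by (simp add: hyp2F1_fps_def norm_mult norm_power norm_divide)
    qed
  qed (use r in auto)
qed

text \<open>
Uniqueness of the continuation: two candidates agree near \<open>0\<close>, hence on the connected component of the
intersection of their domains that contains the segment.
\<close>

lemma hyp2F1_eqI:
  assumes "open S" "closed_segment 0 z \<subseteq> S" "f holomorphic_on S"
    and "\<forall>\<^sub>F y in nhds 0. f y = hyp2F1_series a b c y"
  shows "hyp2F1 a b c z = f z"
  unfolding hyp2F1_def
proof (rule the_equality)
  show "\<exists>S g. open S \<and> closed_segment 0 z \<subseteq> S \<and> g holomorphic_on S \<and>
          (\<forall>\<^sub>F y in nhds 0. g y = hyp2F1_series a b c y) \<and> g z = f z"
    using assms by blast
  fix w assume "\<exists>S f. open S \<and> closed_segment 0 z \<subseteq> S \<and> f holomorphic_on S \<and>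
          (\<forall>\<^sub>F y in nhds 0. f y = hyp2F1_series a b c y) \<and> f z = w"
  then obtain T g where g: "open T" "closed_segment 0 z \<subseteq> T" "g holomorphic_on T"
    "\<forall>\<^sub>F y in nhds 0. g y = hyp2F1_series a b c y" "g z = w" by blast
  define A where "A = connected_component_set (S \<inter> T) 0"
  have sub: "A \<subseteq> S \<inter> T" unfolding A_def by (rule connected_component_subset)
  have seg: "closed_segment 0 z \<subseteq> A" unfolding A_def
    using assms g by (intro connected_component_maximal) auto
  have "(\<lambda>y. g y - f y) z = 0"
  proof (rule has_fps_expansion_0_analytic_continuation[where f = "\<lambda>y. g y - f y" and A = A])
    show "(\<lambda>y. g y - f y) has_fps_expansion 0" unfolding has_fps_expansion_0_iff
      using assms(4) g(4) by eventually_elim simp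
    show "(\<lambda>y. g y - f y) holomorphic_on A"
      using sub assms g by (intro holomorphic_intros) (auto elim: holomorphic_on_subset)
    show "open A" unfolding A_def using assms g by (intro open_connected_component open_Int)
    show "connected A" unfolding A_def by simp
    show "0 \<in> A" "z \<in> A" using seg by auto
  qed
  thus "w = f z" using g by simp
qed

lemma fps_mult_compose_nth:
  fixes A F K :: "'a :: comm_ring_1 fps"
  assumes "fps_nth K 0 = 0"
  shows "fps_nth (A * (F oo K)) n = (\<Sum>i=0..n. fps_nth F i * fps_nth (A * K ^ i) n)"
proof -
  have "fps_nth (A * (F oo K)) n = (\<Sum>j=0..n. fps_nth A j * fps_nth (F oo K) (n - j))"
    by (simp add: fps_mult_nth)
  also have "\<dots> = (\<Sum>j=0..n. fps_nth A j * (\<Sum>i=0..n. fps_nth F i * fps_nth (K ^ i) (n - j)))"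
  proof (rule sum.cong[OF refl], rule arg_cong[where f = "\<lambda>x. _ * x"])
    fix j assume "j \<in> {0..n}"
    have "(\<Sum>i=0..n-j. fps_nth F i * fps_nth (K ^ i) (n - j)) = (\<Sum>i=0..n. fps_nth F i * fps_nth (K ^ i) (n - j))"
      using assms by (intro sum.mono_neutral_left) (auto simp: startsby_zero_power_prefix)
    thus "fps_nth (F oo K) (n - j) = (\<Sum>i=0..n. fps_nth F i * fps_nth (K ^ i) (n - j))"
      by (simp add: fps_compose_nth)
  qed
  also have "\<dots> = (\<Sum>j=0..n. \<Sum>i=0..n. fps_nth F i * (fps_nth A j * fps_nth (K ^ i) (n - j)))"
    by (simp add: sum_distrib_left mult_ac)
  also have "\<dots> = (\<Sum>i=0..n. \<Sum>j=0..n. fps_nth F i * (fps_nth A j * fps_nth (K ^ i) (n - j)))"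
    by (rule sum.swap)
  also have "\<dots> = (\<Sum>i=0..n. fps_nth F i * fps_nth (A * K ^ i) n)"
    by (simp add: fps_mult_nth sum_distrib_left)
  finally show ?thesis .
qed

text \<open>
The coefficient identity behind Pfaff's transformation.  After \<open>(a)\<^sub>i (a + i)\<^sub>n\<^sub>-\<^sub>i = (a)\<^sub>n\<close> is factored out, the sum
is the terminating Gauss series of the Chu-Vandermonde identity.
\<close>

lemma pfaff_coeff:
  fixes a d c :: complex
  assumes c: "c \<notin> \<int>\<^sub>\<le>\<^sub>0"
  shows "(\<Sum>i=0..n. fps_nth (hyp2F1_fps a d c) i * ((- a - of_nat i) gchoose (n - i))) =
     (-1) ^ n * fps_nth (hyp2F1_fps a (c - d) c) n"
proof -
  have "(\<Sum>i=0..n. fps_nth (hyp2F1_fps a d c) i * ((- a - of_nat i) gchoose (n - i)))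
     = (\<Sum>i=0..n. (-1) ^ n * pochhammer a n / fact n * ((pochhammer d i * pochhammer (- of_nat n) i) / (of_nat (fact i) * pochhammer c i)))"
  proof (rule sum.cong[OF refl])
    fix i assume i: "i \<in> {0..n}"
    have 1: "(- a - of_nat i) gchoose (n - i) = (-1) ^ (n - i) * pochhammer (a + of_nat i) (n - i) / fact (n - i)"
      by (simp add: gbinomial_pochhammer add_ac)
    have 2: "pochhammer a n = pochhammer a i * pochhammer (a + of_nat i) (n - i)"
      using i by (intro pochhammer_product) auto
    have 3: "pochhammer (- of_nat n :: complex) i = (-1) ^ i * fact n / fact (n - i)"
    proof -
      have "of_nat n - of_nat i + 1 = (1 + of_nat (n - i) :: complex)" using i by (simp add: of_nat_diff)
      moreover have "(fact n :: complex) = fact (n - i) * pochhammer (1 + of_nat (n - i)) i"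
        using pochhammer_product[of "n - i" n "1 :: complex"] i
        by (simp only: pochhammer_fact diff_diff_cancel diff_le_self atLeastAtMost_iff)
      ultimately show ?thesis by (simp add: pochhammer_minus add_ac del: of_nat_diff)
    qed
    have 4: "(-1) ^ n = (-1) ^ (n - i) * (-1 :: complex) ^ i"
      using i by (simp flip: power_add)
    show "fps_nth (hyp2F1_fps a d c) i * ((- a - of_nat i) gchoose (n - i)) =
      (-1) ^ n * pochhammer a n / fact n * ((pochhammer d i * pochhammer (- of_nat n) i) / (of_nat (fact i) * pochhammer c i))"
      unfolding 1 2 3 4 by (simp add: hyp2F1_fps_def field_simps flip: power_mult_distrib)
  qed
  also have "\<dots> = (-1) ^ n * pochhammer a n / fact n *
     (\<Sum>i=0..n. (pochhammer d i * pochhammer (- of_nat n) i) / (of_nat (fact i) * pochhammer c i))"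
    by (simp only: sum_distrib_left)
  also have "(\<Sum>i=0..n. (pochhammer d i * pochhammer (- of_nat n) i) / (of_nat (fact i) * pochhammer c i)) =
     pochhammer (c - d) n / pochhammer c n"
    using c by (intro Vandermonde_pochhammer) auto
  finally show ?thesis by (simp add: hyp2F1_fps_def mult_ac)
qed

text \<open>
Substituting \<open>z = - y\<close>, the left-hand side is the composition of the series with \<open>z / (1 + z)\<close> times the binomial
series of exponent \<open>- a\<close>.  Powers of \<open>1 / (1 + z)\<close> merge with the latter, so its coefficients are the
sums of \<open>pfaff_coeff\<close>.
\<close>

lemma pfaff_near_0:
  assumes c: "c \<notin> \<int>\<^sub>\<le>\<^sub>0"
  shows "\<forall>\<^sub>F y in nhds 0. (1 - y) powr (- a) * hyp2F1_series a (c - b) c (y / (y - 1)) = hyp2F1_series a b c y"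
proof -
  define F where "F = hyp2F1_fps a (c - b) c"
  define K where "K = fps_X * (fps_binomial (-1) :: complex fps)"
  have F: "eval_fps F has_fps_expansion F"
    using fps_conv_radius_hyp2F1_fps[OF c, of a "c - b"] unfolding F_def has_fps_expansion_def
    by (auto intro: less_le_trans[of 0 1])
  have K0: "fps_nth K 0 = 0" by (simp add: K_def)
  have K: "(\<lambda>z. z * (1 + z) powr (-1)) has_fps_expansion K"
    unfolding K_def by (intro fps_expansion_intros)
  have "(\<lambda>z. (1 + z) powr (- a) * (eval_fps F \<circ> (\<lambda>z. z * (1 + z) powr (-1))) z) has_fps_expansion (fps_binomial (-a) * (F oo K))"
    by (intro fps_expansion_intros F K K0)
  moreover have "fps_binomial (-a) * (F oo K) = hyp2F1_fps a b c oo (- fps_X)"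
  proof (rule fps_ext)
    fix n
    have "fps_nth (fps_binomial (-a) * (F oo K)) n = (\<Sum>i=0..n. fps_nth F i * fps_nth (fps_binomial (- a) * K ^ i) n)"
      by (rule fps_mult_compose_nth[OF K0])
    also have "\<dots> = (\<Sum>i=0..n. fps_nth F i * ((- a - of_nat i) gchoose (n - i)))"
    proof (rule sum.cong[OF refl])
      fix i assume i: "i \<in> {0..n}"
      have "fps_binomial (- a) * K ^ i = fps_X ^ i * (fps_binomial (- a) * fps_binomial (of_nat i * (-1)))"
        unfolding K_def power_mult_distrib fps_binomial_power by (simp only: mult_ac)
      also have "\<dots> = fps_X ^ i * fps_binomial (- a - of_nat i)"
        by (subst fps_binomial_add_mult [symmetric]) simp
      finally show "fps_nth F i * fps_nth (fps_binomial (- a) * K ^ i) n = fps_nth F i * ((- a - of_nat i) gchoose (n - i))"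
        using i by (simp add: fps_X_power_mult_nth)
    qed
    also have "\<dots> = (-1) ^ n * fps_nth (hyp2F1_fps a (c - (c - b)) c) n"
      unfolding F_def by (rule pfaff_coeff[OF c])
    also have "\<dots> = fps_nth (hyp2F1_fps a b c oo (- fps_X)) n"
      by (simp add: fps_compose_uminus')
    finally show "fps_nth (fps_binomial (-a) * (F oo K)) n = fps_nth (hyp2F1_fps a b c oo (- fps_X)) n" .
  qed
  ultimately have 1: "(\<lambda>z. (1 + z) powr (- a) * (eval_fps F \<circ> (\<lambda>z. z * (1 + z) powr (-1))) z) has_fps_expansion (hyp2F1_fps a b c oo (- fps_X))"
    by simp
  have G: "eval_fps (hyp2F1_fps a b c) has_fps_expansion hyp2F1_fps a b c"
    using fps_conv_radius_hyp2F1_fps[OF c, of a b] unfolding has_fps_expansion_def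
    by (auto intro: less_le_trans[of 0 1])
  have 2: "(eval_fps (hyp2F1_fps a b c) \<circ> (\<lambda>z. - z)) has_fps_expansion (hyp2F1_fps a b c oo (- fps_X))"
    by (intro fps_expansion_intros G) simp
  have "\<forall>\<^sub>F z in nhds 0. (1 + z) powr (- a) * (eval_fps F \<circ> (\<lambda>z. z * (1 + z) powr (-1))) z = eval_fps (hyp2F1_fps a b c) (- z)"
    using 1[unfolded has_fps_expansion_def, THEN conjunct2] 2[unfolded has_fps_expansion_def, THEN conjunct2]
    by eventually_elim (simp add: o_def)
  moreover have "filterlim (\<lambda>z. - z :: complex) (nhds 0) (nhds 0)"
    using tendsto_minus[OF filterlim_ident, of "0::complex"] by simp
  ultimately have "\<forall>\<^sub>F z in nhds 0. (1 + (- z)) powr (- a) * (eval_fps F \<circ> (\<lambda>z. z * (1 + z) powr (-1))) (- z) = eval_fps (hyp2F1_fps a b c) (- (- z))"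
    by (rule eventually_compose_filterlim)
  moreover have "\<forall>\<^sub>F z in nhds 0. (z :: complex) \<noteq> 1"
    by (rule t1_space_nhds) simp
  ultimately show ?thesis
  proof eventually_elim
    case (elim z)
    have "- z * (1 - z) powr (- 1) = z / (z - 1)" using elim by (simp add: powr_minus field_simps)
    with elim show ?case by (simp add: F_def eval_hyp2F1_fps)
  qed
qed

lemma norm_pfaff_arg_less: "Re z < 1 / 2 \<Longrightarrow> norm (z / (z - 1)) < 1"
proof -
  assume z: "Re z < 1 / 2"
  hence "z \<noteq> 1" by auto
  have "(norm z)\<^sup>2 < (norm (z - 1))\<^sup>2"
    using z unfolding cmod_power2 by (simp add: power2_eq_square algebra_simps)
  hence "norm z < norm (z - 1)" by (rule power2_less_imp_less) simp
  with \<open>z \<noteq> 1\<close> show ?thesis by (simp add: norm_divide)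
qed

text \<open>
The Moebius map \<open>v \<mapsto> v / (v - 1)\<close> sends the half-plane \<open>Re v < 1/2\<close> into the unit disc.  The right-hand side
is therefore holomorphic on a half-plane that contains \<open>0\<close> and the whole negative axis, and is the
required continuation.
\<close>

lemma hyp2F1_pfaff:
  assumes c: "c \<notin> \<int>\<^sub>\<le>\<^sub>0" and v: "Re v < 1 / 2"
  shows "hyp2F1 a b c v = (1 - v) powr (- a) * hyp2F1_series a (c - b) c (v / (v - 1))"
proof (rule hyp2F1_eqI[where S = "{z. Re z < 1 / 2}" and f = "\<lambda>v. (1 - v) powr (- a) * hyp2F1_series a (c - b) c (v / (v - 1))"])
  show "open {z. Re z < 1 / 2}" by (rule open_halfspace_Re_lt)
  have "convex {z. Re z < 1 / 2}" by (rule convex_halfspace_Re_lt)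
  thus "closed_segment 0 v \<subseteq> {z. Re z < 1 / 2}" using v by (intro closed_segment_subset) auto
  show "(\<lambda>v. (1 - v) powr (- a) * hyp2F1_series a (c - b) c (v / (v - 1))) holomorphic_on {z. Re z < 1 / 2}"
  proof -
    have "(\<lambda>v. (1 - v) powr (- a) * (eval_fps (hyp2F1_fps a (c - b) c) \<circ> (\<lambda>v. v / (v - 1))) v) holomorphic_on {z. Re z < 1 / 2}"
    proof (intro holomorphic_on_mult holomorphic_on_compose)
      show "(\<lambda>v. (1 - v) powr (- a)) holomorphic_on {z. Re z < 1 / 2}"
        by (intro holomorphic_intros) (auto simp: complex_nonpos_Reals_iff)
      show "(\<lambda>v. v / (v - 1)) holomorphic_on {z. Re z < 1 / 2}"
        by (intro holomorphic_intros) auto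
      show "eval_fps (hyp2F1_fps a (c - b) c) holomorphic_on (\<lambda>v. v / (v - 1)) ` {z. Re z < 1 / 2}"
      proof (rule holomorphic_on_eval_fps)
        show "(\<lambda>v. v / (v - 1)) ` {z. Re z < 1 / 2} \<subseteq> eball 0 (fps_conv_radius (hyp2F1_fps a (c - b) c))"
        proof safe
          fix z :: complex assume "Re z < 1 / 2"
          hence "ereal (norm (z / (z - 1))) < 1" using norm_pfaff_arg_less[of z] by simp
          also have "1 \<le> fps_conv_radius (hyp2F1_fps a (c - b) c)" by (rule fps_conv_radius_hyp2F1_fps[OF c])
          finally show "z / (z - 1) \<in> eball 0 (fps_conv_radius (hyp2F1_fps a (c - b) c))"
            by (simp add: in_eball_iff)
        qed
      qed
    qed
    thus ?thesis by (simp add: o_def eval_hyp2F1_fps)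
  qed
qed (rule pfaff_near_0[OF c])

section \<open>Complex Beta integrals and a change of variables\<close>

text \<open>
The pattern of every integral evaluated below: termwise integration yields a multiple of a Gauss series.
The bound on the integrals of the absolute values has the exponent with which the terms of that series decay, so
the condition for its convergence also justifies the exchange of sum and integral.
\<close>

lemma integral_gauss_series:
  fixes f :: "nat \<Rightarrow> real \<Rightarrow> complex"
  assumes int: "\<And>n. set_integrable lborel A (f n)"
    and val: "\<And>n. (LBINT z:A. f n z) = K * gauss_term a b c n"
    and bound: "(\<lambda>n. LBINT z:A. norm (f n z)) \<in> O(\<lambda>n. real (n + 1) powr (Re (a + b - c) - 1))"
    and summ: "\<And>z. z \<in> A \<Longrightarrow> summable (\<lambda>n. norm (f n z))"
    and F: "\<And>z. z \<in> A \<Longrightarrow> (\<Sum>n. f n z) = F z"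
    and conv: "Re (c - a - b) > 0"
  shows "set_integrable lborel A F"
    and "(LBINT z:A. F z) = K * (Gamma (c - a - b) * rGamma (c - a) * rGamma (c - b))"
proof -
  define g where "g n z = indicator A z *\<^sub>R f n z" for n z
  have eq: "(\<Sum>n. g n z) = indicator A z *\<^sub>R F z" for z
    by (cases "z \<in> A") (simp_all add: F g_def)
  have n: "norm (g n z) = indicator A z *\<^sub>R norm (f n z)" for n z
    by (simp add: g_def indicator_def)
  have g: "integrable lborel (g n)" for n
    using int unfolding set_integrable_def g_def .
  have 1: "AE z in lborel. summable (\<lambda>n. norm (g n z))"
    by (rule AE_I2) (use summ in \<open>simp add: n indicator_def\<close>)
  have "summable (\<lambda>n. LBINT z:A. norm (f n z))"
    by (rule summable_comparison_test_bigo[OF summable_powr_Suc bound]) (use conv in simp)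
  hence 2: "summable (\<lambda>n. \<integral>z. norm (g n z) \<partial>lborel)"
    unfolding n set_lebesgue_integral_def .
  show "set_integrable lborel A F"
    using integrable_suminf[OF g 1 2] unfolding set_integrable_def eq .
  have "(\<lambda>n. K * gauss_term a b c n) sums (LBINT z:A. F z)"
    using sums_integral[OF g 1 2, unfolded eq, unfolded g_def] unfolding set_lebesgue_integral_def val [symmetric] .
  from sums_unique2[OF this sums_mult[OF gauss_summation[OF conv]]]
  show "(LBINT z:A. F z) = K * (Gamma (c - a - b) * rGamma (c - a) * rGamma (c - b))" .
qed

lemma norm_of_real_powr: "x > 0 \<Longrightarrow> norm (complex_of_real x powr p) = x powr Re p"
  by (simp add: norm_powr_real_powr)

definition beta_kernel :: "complex \<Rightarrow> complex \<Rightarrow> real \<Rightarrow> complex" where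
  "beta_kernel p q z = of_real z powr (p - 1) * of_real (1 - z) powr (q - 1)"

lemma norm_beta_kernel:
  "z \<in> {0<..<1} \<Longrightarrow> norm (beta_kernel p q z) = z powr (Re p - 1) * (1 - z) powr (Re q - 1)"
  using norm_of_real_powr[of z "p - 1"] norm_of_real_powr[of "1 - z" "q - 1"]
  by (simp add: beta_kernel_def norm_mult)

lemma beta_kernel_mult_power:
  "z \<in> {0<..<1} \<Longrightarrow> beta_kernel p q z * of_real z ^ n = beta_kernel (p + of_nat n) q z"
  by (simp add: beta_kernel_def powr_add powr_diff field_simps)

lemma continuous_on_beta_kernel: "continuous_on {0<..<1} (beta_kernel p q)"
  unfolding beta_kernel_def by (intro continuous_intros) (auto simp: complex_nonpos_Reals_iff)

lemma real_beta_integral: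
  fixes a b :: real
  assumes "a > 0" "b > 0"
  shows "set_integrable lborel {0<..<1} (\<lambda>z. z powr (a - 1) * (1 - z) powr (b - 1))" (is ?A)
    and "(LBINT z:{0<..<1}. z powr (a - 1) * (1 - z) powr (b - 1)) = Beta a b" (is ?B)
proof -
  have 1: "((\<lambda>z. z powr (a - 1) * (1 - z) powr (b - 1)) has_integral Beta a b) {0<..<1}"
    using has_integral_Beta_real[OF assms] by (simp add: has_integral_Icc_iff_Ioo)
  hence "(\<lambda>z. z powr (a - 1) * (1 - z) powr (b - 1)) absolutely_integrable_on {0<..<1}"
    by (intro nonnegative_absolutely_integrable_1) (auto simp: integrable_on_def)
  thus ?A unfolding set_integrable_def
    by (subst (asm) integrable_completion) measurable
  from set_borel_integral_eq_integral(2)[OF this] show ?B using 1 by (simp add: integral_unique)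
qed

lemma set_integrable_beta_kernel:
  assumes "Re p > 0" "Re q > 0"
  shows "set_integrable lborel {0<..<1} (beta_kernel p q)"
proof (rule set_integrable_bound)
  show "set_integrable lborel {0<..<1} (\<lambda>z. z powr (Re p - 1) * (1 - z) powr (Re q - 1))"
    by (rule real_beta_integral) (use assms in auto)
  show "set_borel_measurable lborel {0<..<1} (beta_kernel p q)"
    using borel_measurable_continuous_on_indicator[OF _ continuous_on_beta_kernel[of p q]]
    by (simp add: set_borel_measurable_def)
  show "AE z in lborel. z \<in> {0<..<1} \<longrightarrow> norm (beta_kernel p q z) \<le> norm (z powr (Re p - 1) * (1 - z) powr (Re q - 1))"
    by (rule AE_I2) (simp add: norm_beta_kernel)
qed

lemma set_integral_norm_beta_kernel:
  assumes "Re p > 0" "Re q > 0"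
  shows "(LBINT z:{0<..<1}. norm (beta_kernel p q z)) = Beta (Re p) (Re q)"
proof -
  have "(LBINT z:{0<..<1}. norm (beta_kernel p q z)) = (LBINT z:{0<..<1}. z powr (Re p - 1) * (1 - z) powr (Re q - 1))"
    by (rule set_lebesgue_integral_cong) (auto simp: norm_beta_kernel)
  thus ?thesis using real_beta_integral(2)[of "Re p" "Re q"] assms by simp
qed

text \<open>
The primitive \<open>z\<^sup>p / p\<close> is continuous up to \<open>0\<close>, but differentiable only in the open interval.
\<close>

lemma power_integral_0_1:
  assumes "Re p > 0"
  shows "(LBINT z:{0<..<1}. beta_kernel p 1 z) = 1 / p"
proof -
  have p: "p \<noteq> 0" using assms by auto
  have "((\<lambda>z. of_real z powr (p - 1)) has_integral (of_real 1 powr p / p - of_real 0 powr p / p)) {0..1::real}"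
  proof (rule fundamental_theorem_of_calculus_interior)
    show "continuous_on {0..1} (\<lambda>x::real. complex_of_real x powr p / p)"
    proof (rule continuous_on_divide)
      show "continuous_on {0..1::real} (\<lambda>x. complex_of_real x powr p)"
        unfolding continuous_on_def
      proof
        fix x :: real assume x: "x \<in> {0..1}"
        show "((\<lambda>x. complex_of_real x powr p) \<longlongrightarrow> complex_of_real x powr p) (at x within {0..1})"
        proof (cases "x = 0")
          case True
          have "((\<lambda>x::real. x powr Re p) \<longlongrightarrow> 0 powr Re p) (at 0 within {0..1})"
            using assms by (intro tendsto_powr tendsto_intros) (auto simp: eventually_at_filter)
          hence "((\<lambda>x::real. x powr Re p) \<longlongrightarrow> 0) (at 0 within {0..1})" using assms by simp
          hence "((\<lambda>x. complex_of_real x powr p) \<longlongrightarrow> 0) (at 0 within {0..1})"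
            by (rule Lim_null_comparison[rotated])
               (auto simp: eventually_at_filter norm_powr_real_powr)
          thus ?thesis using True assms by simp
        next
          case False
          thus ?thesis using x by (intro tendsto_intros) (auto simp: complex_nonpos_Reals_iff)
        qed
      qed
    qed (use p in auto)
    fix x :: real assume x: "x \<in> {0<..<1}"
    have "((\<lambda>w. w powr p / p) has_field_derivative (of_real x powr (p - 1))) (at (of_real x))"
      using x p by (auto intro!: derivative_eq_intros simp: complex_nonpos_Reals_iff)
    thus "((\<lambda>x::real. complex_of_real x powr p / p) has_vector_derivative complex_of_real x powr (p - 1)) (at x)"
      by (rule has_vector_derivative_real_field)
  qed simp
  hence "((\<lambda>z::real. of_real z powr (p - 1)) has_integral (1 / p)) {0<..<1}"
    using p assms by (simp add: has_integral_Icc_iff_Ioo)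
  hence "(beta_kernel p 1 has_integral (1 / p)) {0<..<1}"
    by (rule has_integral_eq[rotated]) (auto simp: beta_kernel_def)
  with set_borel_integral_eq_integral(2)[OF set_integrable_beta_kernel[of p 1]] assms
  show ?thesis by (simp add: integral_unique)
qed

lemma Gamma_ratio_bigo:
  assumes "Re u > 0"
  shows "(\<lambda>n. norm (Gamma (u + of_nat n) * rGamma (u + v + of_nat n))) \<in> O(\<lambda>n. real (n + 1) powr (- Re v))"
proof -
  have u: "u \<notin> \<int>\<^sub>\<le>\<^sub>0" using assms by (rule Re_pos_not_nonpos_Int)
  let ?w = "\<lambda>a n. fact n * real (n + 1) powr (Re a - 1)"
  have "(\<lambda>n. norm (Gamma u) * (norm (pochhammer u n) * norm (rGamma (u + v + of_nat n)))) \<in> O(\<lambda>n. ?w u n * inverse (?w (u + v) n))"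
    by (intro landau_o.big.cmult_in_iff[THEN iffD2] landau_o.big.mult pochhammer_bigo rGamma_bigo)
       (use u in \<open>simp add: Gamma_eq_zero_iff\<close>)
  also have "(\<lambda>n. ?w u n * inverse (?w (u + v) n)) = (\<lambda>n. real (n + 1) powr (- Re v))"
    by (rule ext) (simp add: powr_add powr_diff powr_minus field_simps del: of_nat_Suc of_nat_add)
  also have "(\<lambda>n. norm (Gamma u) * (norm (pochhammer u n) * norm (rGamma (u + v + of_nat n)))) =
      (\<lambda>n. norm (Gamma (u + of_nat n) * rGamma (u + v + of_nat n)))"
    using pochhammer_Gamma[OF u] u by (simp add: Gamma_eq_zero_iff norm_mult norm_divide)
  finally show ?thesis .
qed

lemma Beta_real_bigo:
  fixes u v :: real
  assumes "u > 0" "v > 0"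
  shows "(\<lambda>n. Beta (u + real n) v) \<in> O(\<lambda>n. real (n + 1) powr (- v))"
proof -
  have "complex_of_real (Gamma (u + real n) * rGamma (u + v + real n)) = Gamma (of_real u + of_nat n) * rGamma (of_real u + of_real v + of_nat n)" for n
    by (simp flip: Gamma_complex_of_real rGamma_complex_of_real)
  hence "norm (Gamma (of_real u + of_nat n) * rGamma (of_real u + of_real v + of_nat n) :: complex) = \<bar>Gamma (u + real n) * rGamma (u + v + real n)\<bar>" for n
    by (metis norm_of_real)
  with Gamma_ratio_bigo[of "of_real u" "of_real v"] assms
  have "(\<lambda>n. Gamma (u + real n) * rGamma (u + v + real n)) \<in> O(\<lambda>n. real (n + 1) powr (- v))" by simp
  hence "(\<lambda>n. Gamma v * (Gamma (u + real n) * rGamma (u + v + real n))) \<in> O(\<lambda>n. real (n + 1) powr (- v))"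
    using Gamma_real_pos[OF assms(2)] by simp
  thus ?thesis by (simp add: Beta_altdef algebra_simps)
qed

lemma binomial_series_complex:
  fixes q :: complex and z :: real
  assumes "z \<in> {0<..<1}"
  shows "(\<lambda>n. pochhammer (1 - q) n / fact n * of_real z ^ n) sums (of_real (1 - z) powr (q - 1))"
proof -
  have "(\<lambda>n. ((q - 1) gchoose n) * (of_real (- z)) ^ n) sums (1 + of_real (- z)) powr (q - 1)"
    using assms by (intro gen_binomial_complex) auto
  also have "(\<lambda>n. ((q - 1) gchoose n) * (of_real (- z)) ^ n) = (\<lambda>n. pochhammer (1 - q) n / fact n * of_real z ^ n)"
  proof
    fix n :: nat
    have "(- complex_of_real z) ^ n = (-1) ^ n * of_real z ^ n" by (rule power_minus)
    thus "((q - 1) gchoose n) * (of_real (- z)) ^ n = pochhammer (1 - q) n / fact n * of_real z ^ n"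
      by (simp add: gbinomial_pochhammer flip: power_mult_distrib)
  qed
  finally show ?thesis by simp
qed

text \<open>
Expanding \<open>(1 - z)\<^sup>q\<^sup>-\<^sup>1\<close> in powers of \<open>z\<close> and integrating termwise gives \<open>\<Sum> (1 - q)\<^sub>n / (n! (p + n))\<close>.  Since
\<open>1 / (p + n) = \<Gamma>(p) (p)\<^sub>n / \<Gamma>(p + 1 + n)\<close>, this is a Gauss series with parameters \<open>p\<close>, \<open>1 - q\<close>, \<open>p + 1\<close>.
\<close>

theorem Beta_integral_complex:
  assumes p: "Re p > 0" and q: "Re q > 0"
  shows "(LBINT z:{0<..<1}. beta_kernel p q z) = Beta p q"
proof -
  define f where "f n z = pochhammer (1 - q) n / fact n * beta_kernel (p + of_nat n) 1 z" for n z
  have pn: "Re (p + of_nat n) > 0" for n using p by simp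
  have int: "set_integrable lborel {0<..<1} (f n)" for n
    unfolding f_def using pn by (intro set_integrable_mult_right set_integrable_beta_kernel) auto
  have val: "(LBINT z:{0<..<1}. f n z) = Gamma p * gauss_term p (1 - q) (p + 1) n" for n
  proof -
    have p0: "p \<notin> \<int>\<^sub>\<le>\<^sub>0" using p by (rule Re_pos_not_nonpos_Int)
    have pn0: "p + of_nat n \<noteq> 0" using pn[of n] by (metis less_irrefl zero_complex.sel(1))
    have "rGamma (p + of_nat n) = (p + of_nat n) * rGamma (p + 1 + of_nat n)"
      using rGamma_plus1[of "p + of_nat n"] by (simp add: add_ac)
    moreover have "rGamma p = pochhammer p n * rGamma (p + of_nat n)" by (rule pochhammer_rGamma)
    moreover have "Gamma p * rGamma p = 1" using p0 by (simp add: rGamma_inverse_Gamma Gamma_eq_zero_iff)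
    ultimately have "Gamma p * (pochhammer p n * ((p + of_nat n) * rGamma (p + 1 + of_nat n))) = 1" by simp
    hence eq: "Gamma p * (pochhammer p n * rGamma (p + 1 + of_nat n)) = 1 / (p + of_nat n)"
      using pn0 by (simp add: field_simps)
    have "(LBINT z:{0<..<1}. f n z) = pochhammer (1 - q) n / fact n * (1 / (p + of_nat n))"
      unfolding f_def by (subst set_integral_mult_right) (use power_integral_0_1[OF pn] in simp)
    also have "\<dots> = Gamma p * gauss_term p (1 - q) (p + 1) n"
      unfolding eq [symmetric] by (simp add: gauss_term_def)
    finally show ?thesis .
  qed
  have "(LBINT z:{0<..<1}. norm (f n z)) = norm (pochhammer (1 - q) n) / fact n * Beta (Re p + real n) 1" for n
    using set_integral_norm_beta_kernel[OF pn, of 1 n] by (simp add: f_def norm_mult norm_divide)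
  moreover have "(\<lambda>n. norm (pochhammer (1 - q) n) / fact n * Beta (Re p + real n) 1)
      \<in> O(\<lambda>n. (fact n * real (n + 1) powr (Re (1 - q) - 1)) / fact n * real (n + 1) powr (- 1))"
    using p by (intro landau_o.big.mult landau_o.big.divide pochhammer_bigo Beta_real_bigo) auto
  moreover have "(\<lambda>n. (fact n * real (n + 1) powr (Re (1 - q) - 1)) / fact n * real (n + 1) powr (- 1)) =
      (\<lambda>n. real (n + 1) powr (Re (p + (1 - q) - (p + 1)) - 1))"
    by (rule ext) (simp add: powr_diff powr_minus field_simps del: of_nat_Suc of_nat_add)
  ultimately have bound: "(\<lambda>n. LBINT z:{0<..<1}. norm (f n z)) \<in> O(\<lambda>n. real (n + 1) powr (Re (p + (1 - q) - (p + 1)) - 1))"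
    by simp
  have fz: "f n z = beta_kernel p 1 z * (pochhammer (1 - q) n / fact n * of_real z ^ n)" if "z \<in> {0<..<1}" for n z
    unfolding f_def using that by (simp only: beta_kernel_mult_power [symmetric] mult_ac)
  have summ: "summable (\<lambda>n. norm (f n z))" if z: "z \<in> {0<..<1}" for z
  proof -
    have "summable (\<lambda>n. norm (hyp2F1_coeff (1 - q) 1 1 n) * norm (complex_of_real z) ^ n)"
      using z by (intro summable_norm_hyp2F1_series) auto
    hence "summable (\<lambda>n. norm (beta_kernel p 1 z) * (norm (pochhammer (1 - q) n / fact n) * norm (complex_of_real z) ^ n))"
      by (intro summable_mult) (simp add: norm_divide pochhammer_fact [symmetric])
    thus ?thesis by (simp only: fz[OF z] norm_mult norm_power)
  qed
  have F: "(\<Sum>n. f n z) = beta_kernel p q z" if z: "z \<in> {0<..<1}" for z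
  proof -
    have "(\<lambda>n. f n z) sums (beta_kernel p 1 z * of_real (1 - z) powr (q - 1))"
      unfolding fz[OF z] by (intro sums_mult binomial_series_complex z)
    thus ?thesis using z by (simp add: sums_iff beta_kernel_def)
  qed
  have conv: "Re (p + 1 - p - (1 - q)) > 0" using q by simp
  have "(LBINT z:{0<..<1}. beta_kernel p q z) = Gamma p * (Gamma (p + 1 - p - (1 - q)) * rGamma (p + 1 - p) * rGamma (p + 1 - (1 - q)))"
    by (rule integral_gauss_series(2)[OF int val bound summ F conv])
  thus ?thesis by (simp add: Beta_altdef)
qed

lemma set_integrable_of_real:
  assumes "set_integrable M A f"
  shows "set_integrable M A (\<lambda>x. complex_of_real (f x))"
  using integrable_of_real[OF assms[unfolded set_integrable_def], where 'a = complex]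
  by (simp add: set_integrable_def scaleR_conv_of_real)

lemma set_integrable_completion_iff:
  fixes f :: "real \<Rightarrow> real"
  assumes "(\<lambda>x. indicator S x *\<^sub>R f x) \<in> borel_measurable borel"
  shows "f absolutely_integrable_on S \<longleftrightarrow> set_integrable lborel S f"
  using assms unfolding set_integrable_def by (subst integrable_completion) auto

lemma image_one_minus_inverse:
  assumes "(x::real) > 0"
  shows "(\<lambda>t. 1 - x / t) ` {x<..} = {0<..<1}"
proof (intro equalityI subsetI)
  fix z :: real assume z: "z \<in> {0<..<1}"
  have "1 - x / (x / (1 - z)) = z" "x / (1 - z) > x" using z assms by (auto simp: field_simps)
  thus "z \<in> (\<lambda>t. 1 - x / t) ` {x<..}" by (intro image_eqI[of _ _ "x / (1 - z)"]) auto
qed (use assms in \<open>auto simp: field_simps\<close>)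

text \<open>
The change-of-variables theorem is about Lebesgue measurable sets and the completed measure; Borel
measurability of the integrands allows the transfer to Borel measure.
\<close>

lemma change_variable_one_minus_inverse_real:
  fixes f :: "real \<Rightarrow> real"
  assumes x: "x > 0" and f: "set_integrable lborel {0<..<1} f"
  shows "set_integrable lborel {x<..} (\<lambda>t. x / t\<^sup>2 * f (1 - x / t))"
    and "(LBINT t:{x<..}. x / t\<^sup>2 * f (1 - x / t)) = (LBINT z:{0<..<1}. f z)"
proof -
  define S where "S = {x<..}"
  define g where "g t = 1 - x / t" for t
  have im: "g ` S = {0<..<1}" using image_one_minus_inverse[OF x] by (simp add: g_def S_def)
  have meas: "(\<lambda>z. indicator {0<..<1} z *\<^sub>R f z) \<in> borel_measurable borel"
    using f unfolding set_integrable_def by (auto dest: borel_measurable_integrable)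
  have ind: "indicator S t *\<^sub>R (\<bar>x / t\<^sup>2\<bar> * f (g t)) = indicator S t *\<^sub>R (x / t\<^sup>2) * (indicator {0<..<1} (g t) *\<^sub>R f (g t))" for t
    using x im by (auto simp: indicator_def)
  have meas2: "(\<lambda>t. indicator S t *\<^sub>R (\<bar>x / t\<^sup>2\<bar> * f (g t))) \<in> borel_measurable borel"
    unfolding ind
  proof (rule borel_measurable_times)
    show "(\<lambda>t. indicator S t *\<^sub>R (x / t\<^sup>2)) \<in> borel_measurable borel" unfolding S_def by measurable
    have "g \<in> borel_measurable borel" unfolding g_def by measurable
    from measurable_compose[OF this meas]
    show "(\<lambda>t. indicat_real {0<..<1} (g t) *\<^sub>R f (g t)) \<in> borel_measurable borel" .
  qed
  have "f absolutely_integrable_on g ` S \<and> integral (g ` S) f = (LBINT z:{0<..<1}. f z)"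
    using f set_integrable_completion_iff[OF meas] set_borel_integral_eq_integral[OF f] by (simp add: im)
  also have "?this \<longleftrightarrow> (\<lambda>t. \<bar>x / t\<^sup>2\<bar> * f (g t)) absolutely_integrable_on S \<and>
      integral S (\<lambda>t. \<bar>x / t\<^sup>2\<bar> * f (g t)) = (LBINT z:{0<..<1}. f z)"
  proof (rule has_absolute_integral_change_of_variables_1' [symmetric])
    show "S \<in> sets lebesgue" by (simp add: S_def)
    show "inj_on g S" using x by (auto simp: inj_on_def g_def S_def field_simps)
    show "(g has_field_derivative x / t\<^sup>2) (at t within S)" if "t \<in> S" for t
      using that x unfolding g_def S_def by (auto intro!: derivative_eq_intros simp: power2_eq_square field_simps)
  qed
  finally have *: "set_integrable lborel S (\<lambda>t. \<bar>x / t\<^sup>2\<bar> * f (g t))"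
     "integral S (\<lambda>t. \<bar>x / t\<^sup>2\<bar> * f (g t)) = (LBINT z:{0<..<1}. f z)"
    using set_integrable_completion_iff[OF meas2] by auto
  have abs: "\<bar>x / t\<^sup>2\<bar> = x / t\<^sup>2" for t using x by simp
  from *(1) show "set_integrable lborel {x<..} (\<lambda>t. x / t\<^sup>2 * f (1 - x / t))"
    unfolding abs by (simp add: S_def g_def)
  from set_borel_integral_eq_integral(2)[OF *(1)] *(2)
  show "(LBINT t:{x<..}. x / t\<^sup>2 * f (1 - x / t)) = (LBINT z:{0<..<1}. f z)"
    unfolding abs by (simp add: S_def g_def)
qed

lemma change_variable_one_minus_inverse:
  fixes f :: "real \<Rightarrow> complex"
  assumes x: "x > 0" and f: "set_integrable lborel {0<..<1} f"
  shows "set_integrable lborel {x<..} (\<lambda>t. of_real (x / t\<^sup>2) * f (1 - x / t))"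
    and "(LBINT t:{x<..}. of_real (x / t\<^sup>2) * f (1 - x / t)) = (LBINT z:{0<..<1}. f z)"
proof -
  have fr: "set_integrable lborel {0<..<1} (\<lambda>z. Re (f z))" "(LBINT z:{0<..<1}. Re (f z)) = Re (LBINT z:{0<..<1}. f z)"
    and fi: "set_integrable lborel {0<..<1} (\<lambda>z. Im (f z))" "(LBINT z:{0<..<1}. Im (f z)) = Im (LBINT z:{0<..<1}. f z)"
    using integrable_Re[OF f[unfolded set_integrable_def]] integrable_Im[OF f[unfolded set_integrable_def]]
      integral_Re[OF f[unfolded set_integrable_def]] integral_Im[OF f[unfolded set_integrable_def]]
    by (simp_all add: set_integrable_def set_lebesgue_integral_def)
  note r = change_variable_one_minus_inverse_real[OF x fr(1)]
  note i = change_variable_one_minus_inverse_real[OF x fi(1)]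
  have eq: "(\<lambda>t. of_real (x / t\<^sup>2) * f (1 - x / t)) = (\<lambda>t. of_real (x / t\<^sup>2 * Re (f (1 - x / t))) + \<i> * of_real (x / t\<^sup>2 * Im (f (1 - x / t))))"
    by (rule ext, rule complex_eqI) auto
  have ri: "set_integrable lborel {x<..} (\<lambda>t. complex_of_real (x / t\<^sup>2 * Re (f (1 - x / t))))"
    "set_integrable lborel {x<..} (\<lambda>t. \<i> * complex_of_real (x / t\<^sup>2 * Im (f (1 - x / t))))"
    by (intro set_integrable_mult_right set_integrable_of_real r i)+
  show "set_integrable lborel {x<..} (\<lambda>t. of_real (x / t\<^sup>2) * f (1 - x / t))"
    unfolding eq by (intro set_integral_add ri)
  show "(LBINT t:{x<..}. of_real (x / t\<^sup>2) * f (1 - x / t)) = (LBINT z:{0<..<1}. f z)"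
    unfolding eq set_integral_add(2)[OF ri]
    by (simp only: set_integral_complex_of_real set_integral_mult_right r(2) i(2) fr fi complex_eq [symmetric])
qed

section \<open>Beta transforms of hypergeometric series\<close>

text \<open>
Integrated termwise, the series becomes a multiple of a Gauss series with parameters \<open>a\<close>, \<open>c - b\<close>,
\<open>c + \<kappa> + a\<close>, whose convergence condition is \<open>Re (\<kappa> + b) > 0\<close>.  Multiplied by \<open>(1 - z)\<^sup>a\<close> the series equals
\<open>\<^sub>2F\<^sub>1(a, b; c; - z / (1 - z))\<close>, which explains why \<open>a\<close> and \<open>b\<close> play symmetric roles in the result.
\<close>

lemma series_beta_integral:
  assumes c: "Re c > 0" and a: "Re (\<kappa> + a) > 0" and b: "Re (\<kappa> + b) > 0"
  shows "set_integrable lborel {0<..<1} (\<lambda>z. beta_kernel c (\<kappa> + a) z * hyp2F1_series a (c - b) c (of_real z))"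
    and "(LBINT z:{0<..<1}. beta_kernel c (\<kappa> + a) z * hyp2F1_series a (c - b) c (of_real z)) =
           Gamma c * Gamma (\<kappa> + a) * Gamma (\<kappa> + b) * rGamma (c + \<kappa>) * rGamma (\<kappa> + a + b)"
proof -
  have c0: "c \<notin> \<int>\<^sub>\<le>\<^sub>0" using c by (rule Re_pos_not_nonpos_Int)
  define e where "e = c + \<kappa> + a"
  define f where "f n z = hyp2F1_coeff a (c - b) c n * beta_kernel (c + of_nat n) (\<kappa> + a) z" for n z
  have cn: "Re (c + of_nat n) > 0" for n using c by simp
  have int: "set_integrable lborel {0<..<1} (f n)" for n
    unfolding f_def using cn a by (intro set_integrable_mult_right set_integrable_beta_kernel) auto
  have val: "(LBINT z:{0<..<1}. f n z) = Gamma c * Gamma (\<kappa> + a) * gauss_term a (c - b) e n" for n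
  proof -
    have nz: "pochhammer c n \<noteq> 0" using c0 by (auto simp: pochhammer_eq_0_iff)
    have "Gamma (c + of_nat n) = Gamma c * pochhammer c n"
      using pochhammer_Gamma[OF c0, of n] c0 by (simp add: Gamma_eq_zero_iff)
    moreover have "(LBINT z:{0<..<1}. f n z) = hyp2F1_coeff a (c - b) c n * Beta (c + of_nat n) (\<kappa> + a)"
      unfolding f_def by (subst set_integral_mult_right) (use Beta_integral_complex[OF cn a] in simp)
    ultimately show ?thesis using nz by (simp add: e_def Beta_altdef gauss_term_def add_ac)
  qed
  have "(LBINT z:{0<..<1}. norm (f n z)) = norm (hyp2F1_coeff a (c - b) c n) * Beta (Re c + real n) (Re (\<kappa> + a))" for n
    using set_integral_norm_beta_kernel[OF cn a, of n]
    by (simp only: f_def norm_mult[of "hyp2F1_coeff a (c - b) c n"] set_integral_mult_right) simp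
  moreover have "(\<lambda>n. norm (hyp2F1_coeff a (c - b) c n) * Beta (Re c + real n) (Re (\<kappa> + a)))
      \<in> O(\<lambda>n. real (n + 1) powr (Re (a + (c - b) - c) - 1) * real (n + 1) powr (- Re (\<kappa> + a)))"
    by (intro landau_o.big.mult hyp2F1_coeff_bigo Beta_real_bigo c0 c a)
  moreover have "(\<lambda>n. real (n + 1) powr (Re (a + (c - b) - c) - 1) * real (n + 1) powr (- Re (\<kappa> + a))) =
      (\<lambda>n. real (n + 1) powr (Re (a + (c - b) - e) - 1))"
    by (rule ext, subst powr_add [symmetric]) (simp add: e_def algebra_simps)
  ultimately have bound: "(\<lambda>n. LBINT z:{0<..<1}. norm (f n z)) \<in> O(\<lambda>n. real (n + 1) powr (Re (a + (c - b) - e) - 1))"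
    by (simp only:)
  have fz: "f n z = beta_kernel c (\<kappa> + a) z * (hyp2F1_coeff a (c - b) c n * of_real z ^ n)" if "z \<in> {0<..<1}" for n z
    unfolding f_def using that by (simp only: beta_kernel_mult_power [symmetric] mult_ac)
  have summ: "summable (\<lambda>n. norm (f n z))" if z: "z \<in> {0<..<1}" for z
  proof -
    have "summable (\<lambda>n. norm (beta_kernel c (\<kappa> + a) z) * (norm (hyp2F1_coeff a (c - b) c n) * norm (complex_of_real z) ^ n))"
      using z by (intro summable_mult summable_norm_hyp2F1_series c0) auto
    thus ?thesis
      by (simp only: fz[OF z] norm_mult[of "beta_kernel c (\<kappa> + a) z"] norm_mult[of "hyp2F1_coeff a (c - b) c _" "_ ^ _"] norm_power)
  qed
  have F: "(\<Sum>n. f n z) = beta_kernel c (\<kappa> + a) z * hyp2F1_series a (c - b) c (of_real z)" if z: "z \<in> {0<..<1}" for z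
    unfolding fz[OF z] using z by (intro sums_unique [symmetric] sums_mult hyp2F1_series_sums c0) auto
  have conv: "Re (e - a - (c - b)) > 0" using b by (simp add: e_def)
  note main = integral_gauss_series[OF int val bound summ F conv]
  show "set_integrable lborel {0<..<1} (\<lambda>z. beta_kernel c (\<kappa> + a) z * hyp2F1_series a (c - b) c (of_real z))"
    by (rule main(1))
  show "(LBINT z:{0<..<1}. beta_kernel c (\<kappa> + a) z * hyp2F1_series a (c - b) c (of_real z)) =
           Gamma c * Gamma (\<kappa> + a) * Gamma (\<kappa> + b) * rGamma (c + \<kappa>) * rGamma (\<kappa> + a + b)"
    using main(2) by (simp add: e_def algebra_simps)
qed

text \<open>
This relation raises the real part of \<open>a\<close>.  Applied with \<open>d = c - b\<close> it keeps \<open>d\<close> fixed in both terms, so that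
its second term belongs to the parameters \<open>a + 1\<close>, \<open>b + 1\<close>, \<open>c + 1\<close>.
\<close>

lemma hyp2F1_series_contiguous:
  assumes c: "c \<notin> \<int>\<^sub>\<le>\<^sub>0" "c + 1 \<notin> \<int>\<^sub>\<le>\<^sub>0" and z: "norm z < 1"
  shows "hyp2F1_series a d c z =
     (1 - z) * hyp2F1_series (a + 1) d c z + (c - d) / c * z * hyp2F1_series (a + 1) d (c + 1) z"
proof -
  let ?p = "hyp2F1_coeff (a + 1) d c" and ?q = "hyp2F1_coeff (a + 1) d (c + 1)"
  \<comment> \<open>The second series minus the first, both multiplied by \<open>z\<close>, so that the indices shift by one.\<close>
  define g where "g n = (if n = 0 then 0 else (c - d) / c * ?q (n - 1) - ?p (n - 1))" for n
  have cz: "c \<noteq> 0" using c by auto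
  have p: "(\<lambda>n. ?p n * z ^ n) sums hyp2F1_series (a + 1) d c z"
    and q: "(\<lambda>n. ?q n * z ^ n) sums hyp2F1_series (a + 1) d (c + 1) z"
    by (intro hyp2F1_series_sums c z)+
  have "(\<lambda>n. z * ((c - d) / c * (?q n * z ^ n) - ?p n * z ^ n)) sums
     (z * ((c - d) / c * hyp2F1_series (a + 1) d (c + 1) z - hyp2F1_series (a + 1) d c z))"
    by (intro sums_mult sums_diff p q)
  also have "(\<lambda>n. z * ((c - d) / c * (?q n * z ^ n) - ?p n * z ^ n)) = (\<lambda>n. g (Suc n) * z ^ Suc n)"
    by (simp add: g_def algebra_simps)
  finally have "(\<lambda>n. g n * z ^ n) sums (z * ((c - d) / c * hyp2F1_series (a + 1) d (c + 1) z - hyp2F1_series (a + 1) d c z) + g 0 * z ^ 0)"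
    by (subst (asm) sums_Suc_iff) simp
  from sums_add[OF p this] have "(\<lambda>n. (?p n + g n) * z ^ n) sums ((1 - z) * hyp2F1_series (a + 1) d c z + (c - d) / c * z * hyp2F1_series (a + 1) d (c + 1) z)"
    by (simp add: g_def algebra_simps)
  moreover have "?p n + g n = hyp2F1_coeff a d c n" for n
  proof (cases n)
    case (Suc m)
    define P where "P = pochhammer (a + 1) m * pochhammer d m / (pochhammer c (Suc m) * fact m)"
    have nz: "pochhammer c k \<noteq> 0" "pochhammer (c + 1) k \<noteq> 0" for k using c by (auto simp: pochhammer_eq_0_iff)
    have nm: "c + of_nat m \<noteq> 0" using nz(1)[of "Suc m"] by (simp add: pochhammer_Suc)
    have 1: "?p m = P * (c + of_nat m)"
      using nz(1)[of "Suc m"] nm by (simp add: P_def pochhammer_Suc)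
    have 2: "?q m = P * c"
    proof -
      have e: "pochhammer (c + 1) m = pochhammer c (Suc m) / c" using cz by (simp add: pochhammer_rec)
      show ?thesis unfolding P_def e using cz by simp
    qed
    have 3: "?p n = P * (a + 1 + of_nat m) * (d + of_nat m) / of_nat (Suc m)"
      unfolding Suc P_def fact_Suc pochhammer_Suc[of "a+1"] pochhammer_Suc[of d] by (simp add: mult_ac)
    have 4: "hyp2F1_coeff a d c n = P * a * (d + of_nat m) / of_nat (Suc m)"
      unfolding Suc P_def fact_Suc pochhammer_rec[of a] pochhammer_Suc[of d] by (simp add: mult_ac)
    have "?p n + g n = P * ((a + 1 + of_nat m) * (d + of_nat m) / of_nat (Suc m) + (c - d) - (c + of_nat m))"
    proof -
      have "g n = (c - d) / c * ?q m - ?p m" by (simp add: g_def Suc)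
      also have "\<dots> = P * (c - d) - P * (c + of_nat m)"
        unfolding 1 2 using cz by simp
      finally show ?thesis unfolding 3 by (simp add: ring_distribs)
    qed
    also have "(a + 1 + of_nat m) * (d + of_nat m) / of_nat (Suc m) + (c - d) - (c + of_nat m) = a * (d + of_nat m) / of_nat (Suc m)"
      by (simp add: field_simps del: of_nat_Suc) (simp add: algebra_simps)
    finally show ?thesis unfolding 4 by simp
  qed (simp add: g_def)
  ultimately have "(\<lambda>n. hyp2F1_coeff a d c n * z ^ n) sums ((1 - z) * hyp2F1_series (a + 1) d c z + (c - d) / c * z * hyp2F1_series (a + 1) d (c + 1) z)" by simp
  from sums_unique2[OF hyp2F1_series_sums[OF c(1) z] this] show ?thesis .
qed

lemma norm_pochhammer_shift_le:
  assumes d: "Re d > 0"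
  obtains C where "C > 0" "\<And>j l. norm (pochhammer (d + of_nat j) l) \<le> C * pochhammer (Re d + real j) l"
proof -
  obtain C where C: "C > 0" "\<And>n. norm (pochhammer d n) \<le> C * pochhammer (Re d) n"
    using norm_pochhammer_le_real[OF d] by blast
  show ?thesis
  proof (rule that[OF C(1)])
    fix j l
    have pos: "pochhammer (Re d) j > 0" using d by (rule pochhammer_pos)
    have "pochhammer (Re d) j * norm (pochhammer (d + of_nat j) l) \<le> norm (pochhammer d j) * norm (pochhammer (d + of_nat j) l)"
      by (intro mult_right_mono norm_pochhammer_ge d) auto
    also have "\<dots> = norm (pochhammer d (j + l))"
      by (simp add: pochhammer_product' norm_mult)
    also have "\<dots> \<le> C * pochhammer (Re d) (j + l)" by (rule C)
    also have "\<dots> = pochhammer (Re d) j * (C * pochhammer (Re d + real j) l)"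
      by (simp add: pochhammer_product')
    finally show "norm (pochhammer (d + of_nat j) l) \<le> C * pochhammer (Re d + real j) l"
      using pos by simp
  qed
qed

text \<open>
Uniformity in \<open>j\<close> is the point.  It holds because \<open>|(d + j)\<^sub>l|\<close> is at most a constant times \<open>(Re d + j)\<^sub>l\<close>, with a constant
independent of \<open>j\<close>: both are quotients of Pochhammer symbols starting at \<open>d\<close> and \<open>Re d\<close>.
\<close>

lemma hyp2F1_series_dominated:
  assumes a: "Re a > 0" and d: "Re d > 0" and c: "Re c > 0"
  obtains C where "C > 0"
    "\<And>j z. z \<in> {0<..<1} \<Longrightarrow> norm (hyp2F1_series a (d + of_nat j) (c + of_nat j) (of_real z))
        \<le> C * Re (hyp2F1_series (of_real (Re a)) (of_real (Re d) + of_nat j) (of_real (Re c) + of_nat j) (of_real z))"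
proof -
  obtain A where A: "A > 0" "\<And>n. norm (pochhammer a n) \<le> A * pochhammer (Re a) n"
    using norm_pochhammer_le_real[OF a] by blast
  obtain D where D: "D > 0" "\<And>j l. norm (pochhammer (d + of_nat j) l) \<le> D * pochhammer (Re d + real j) l"
    using norm_pochhammer_shift_le[OF d] by blast
  show ?thesis
  proof (rule that[of "A * D"])
    fix j :: nat and z :: real assume z: "z \<in> {0<..<1}"
    define r where "r l = pochhammer (Re a) l * pochhammer (Re d + real j) l / (pochhammer (Re c + real j) l * fact l)" for l
    have pp: "pochhammer (Re a) l > 0" "pochhammer (Re d + real j) l > 0" "pochhammer (Re c + real j) l > 0" for l
      using a d c by (auto intro!: pochhammer_pos)
    have c1: "c + of_nat j \<notin> \<int>\<^sub>\<le>\<^sub>0" "of_real (Re c) + of_nat j \<notin> (\<int>\<^sub>\<le>\<^sub>0 :: complex set)"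
      using c by (intro Re_pos_not_nonpos_Int; simp)+
    have s1: "(\<lambda>l. hyp2F1_coeff a (d + of_nat j) (c + of_nat j) l * of_real z ^ l) sums hyp2F1_series a (d + of_nat j) (c + of_nat j) (of_real z)"
      using z by (intro hyp2F1_series_sums c1) auto
    have "hyp2F1_coeff (of_real (Re a)) (of_real (Re d) + of_nat j) (of_real (Re c) + of_nat j) l = complex_of_real (r l)" for l
    proof -
      have "complex_of_real x + of_nat j = of_real (x + real j)" for x by simp
      thus ?thesis
        by (simp only: r_def pochhammer_of_real of_real_mult of_real_divide of_real_fact)
    qed
    moreover have "(\<lambda>l. hyp2F1_coeff (of_real (Re a)) (of_real (Re d) + of_nat j) (of_real (Re c) + of_nat j) l * of_real z ^ l)
       sums hyp2F1_series (of_real (Re a)) (of_real (Re d) + of_nat j) (of_real (Re c) + of_nat j) (of_real z)"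
      using z by (intro hyp2F1_series_sums c1) auto
    ultimately have "(\<lambda>l. complex_of_real (r l) * of_real z ^ l)
       sums hyp2F1_series (of_real (Re a)) (of_real (Re d) + of_nat j) (of_real (Re c) + of_nat j) (of_real z)"
      by simp
    from sums_Re[OF this] have s2: "(\<lambda>l. r l * z ^ l) sums Re (hyp2F1_series (of_real (Re a)) (of_real (Re d) + of_nat j) (of_real (Re c) + of_nat j) (of_real z))"
      by (simp flip: of_real_power of_real_mult)
    have bd: "norm (hyp2F1_coeff a (d + of_nat j) (c + of_nat j) l * of_real z ^ l) \<le> A * D * (r l * z ^ l)" for l
    proof -
      have "norm (hyp2F1_coeff a (d + of_nat j) (c + of_nat j) l) =
         norm (pochhammer a l) * norm (pochhammer (d + of_nat j) l) / (norm (pochhammer (c + of_nat j) l) * fact l)"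
        by (simp add: norm_mult norm_divide)
      also have "\<dots> \<le> (A * pochhammer (Re a) l) * (D * pochhammer (Re d + real j) l) / (pochhammer (Re c + real j) l * fact l)"
      proof (rule frac_le)
        show "pochhammer (Re c + real j) l * fact l \<le> norm (pochhammer (c + of_nat j) l) * fact l"
          using norm_pochhammer_ge[of "c + of_nat j" l] c by (intro mult_right_mono) auto
        show "norm (pochhammer a l) * norm (pochhammer (d + of_nat j) l) \<le> (A * pochhammer (Re a) l) * (D * pochhammer (Re d + real j) l)"
          using A(1) pp[of l] by (intro mult_mono A D) auto
      qed (use A(1) D(1) pp[of l] in auto)
      also have "\<dots> = A * D * r l" by (simp add: r_def)
      finally have "norm (hyp2F1_coeff a (d + of_nat j) (c + of_nat j) l) * z ^ l \<le> A * D * r l * z ^ l"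
        using z by (intro mult_right_mono) auto
      thus ?thesis using z by (simp only: norm_mult[of "hyp2F1_coeff a (d + of_nat j) (c + of_nat j) l"] norm_power norm_of_real mult.assoc) auto
    qed
    have "norm (hyp2F1_series a (d + of_nat j) (c + of_nat j) (of_real z)) = norm (\<Sum>l. hyp2F1_coeff a (d + of_nat j) (c + of_nat j) l * of_real z ^ l)"
      using s1 by (simp only: sums_iff)
    also have "\<dots> \<le> (\<Sum>l. A * D * (r l * z ^ l))"
      using bd s2 by (intro norm_suminf_le summable_mult) (auto simp: sums_iff)
    also have "\<dots> = A * D * Re (hyp2F1_series (of_real (Re a)) (of_real (Re d) + of_nat j) (of_real (Re c) + of_nat j) (of_real z))"
      using sums_mult[OF s2, of "A * D"] by (simp only: sums_iff)
    finally show "norm (hyp2F1_series a (d + of_nat j) (c + of_nat j) (of_real z)) \<le> \<dots>" .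
  qed (use A D in simp)
qed

text \<open>
The absolute version of the integral in \<open>series_beta_integral\<close>, with \<open>c\<close> shifted by \<open>k\<close>.  The parameter \<open>\<kappa>\<close> is real
since the absolute value of the kernel sees only its real part.
\<close>

definition kernel_norm :: "complex \<Rightarrow> complex \<Rightarrow> complex \<Rightarrow> real \<Rightarrow> nat \<Rightarrow> real" where
  "kernel_norm a b c \<kappa> k = (LBINT z:{0<..<1}. norm (beta_kernel (c + of_nat k) (of_real \<kappa> + a) z
      * hyp2F1_series a (c + of_nat k - b) (c + of_nat k) (of_real z)))"

lemma kernel_norm_nonneg: "kernel_norm a b c \<kappa> k \<ge> 0"
  unfolding kernel_norm_def set_lebesgue_integral_def by (intro Bochner_Integration.integral_nonneg) simp

text \<open>
From the index on where \<open>c - b + k\<close> has positive real part, the integrand is dominated by the one with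
real parameters.  The latter is nonnegative, so its integral is known exactly, and it is of the
size of \<open>\<Gamma>(Re c + k) / \<Gamma>(Re c + k + \<kappa>)\<close>.
\<close>

lemma kernel_norm_bigo_pos:
  assumes a: "Re a > 0" and c: "Re c > 0" and \<kappa>a: "\<kappa> + Re a > 0" and \<kappa>b: "\<kappa> + Re b > 0"
  shows "kernel_norm a b c \<kappa> \<in> O(\<lambda>k. real (k + 1) powr (- \<kappa>))"
proof -
  \<comment> \<open>The domination needs \<open>Re (c - b + k) > 0\<close>; smaller \<open>k\<close> do not matter for the asymptotics.\<close>
  obtain k0 :: nat where k0: "real k0 > Re b - Re c" using reals_Archimedean2 by blast
  define d0 where "d0 = c + of_nat k0 - b"
  define c0 where "c0 = c + of_nat k0"
  have d0: "Re d0 > 0" and c0: "Re c0 > 0" using k0 c by (auto simp: d0_def c0_def)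
  let ?u = "\<lambda>j. of_real (Re c0) + of_nat j :: complex"
  let ?H = "\<lambda>j z. hyp2F1_series (of_real (Re a)) (of_real (Re d0) + of_nat j) (?u j) (of_real z)"
  let ?h = "\<lambda>j z. hyp2F1_series a (d0 + of_nat j) (c0 + of_nat j) (of_real z)"
  let ?B = "\<lambda>j. beta_kernel (c0 + of_nat j) (of_real \<kappa> + a)"
  let ?R = "\<lambda>j. beta_kernel (?u j) (of_real \<kappa> + of_real (Re a))"
  obtain C where C: "C > 0" "\<And>j z. z \<in> {0<..<1} \<Longrightarrow> norm (?h j z) \<le> C * Re (?H j z)"
    using hyp2F1_series_dominated[OF a d0 c0] by blast
  define E where "E = Gamma (of_real \<kappa> + of_real (Re a)) * Gamma (of_real \<kappa> + of_real (Re b)) * rGamma (of_real \<kappa> + of_real (Re a) + of_real (Re b) :: complex)"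
  have bound: "kernel_norm a b c \<kappa> (k0 + j) \<le> C * norm E * norm (Gamma (?u j) * rGamma (of_real (Re c0) + of_real \<kappa> + of_nat j))" for j
  proof -
    have ka: "Re (of_real \<kappa> + a) > 0" "Re (of_real \<kappa> + b) > 0"
        "Re (of_real \<kappa> + of_real (Re a)) > 0" "Re (of_real \<kappa> + of_real (Re b)) > 0"
      using \<kappa>a \<kappa>b by auto
    have cj: "Re (c0 + of_nat j) > 0" "Re (?u j) > 0" using c0 by auto
    have eqd: "c0 + of_nat j - b = d0 + of_nat j" "?u j - of_real (Re b) = of_real (Re d0) + of_nat j"
      by (simp_all add: c0_def d0_def)
    note i1 = series_beta_integral(1)[OF cj(1) ka(1,2), unfolded eqd]
    note S = series_beta_integral[OF cj(2) ka(3,4), unfolded eqd]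
    have i2: "set_integrable lborel {0<..<1} (\<lambda>z. C * Re (?R j z * ?H j z))"
      using integrable_Re[OF S(1)[unfolded set_integrable_def]] by (intro set_integrable_mult_right) (simp add: set_integrable_def)
    have "kernel_norm a b c \<kappa> (k0 + j) = (LBINT z:{0<..<1}. norm (?B j z * ?h j z))"
      unfolding kernel_norm_def c0_def d0_def by (simp add: algebra_simps)
    also have "\<dots> \<le> (LBINT z:{0<..<1}. C * Re (?R j z * ?H j z))"
    proof (rule set_integral_mono[OF set_integrable_norm[OF i1] i2])
      fix z :: real assume z: "z \<in> {0<..<1}"
      define r where "r = z powr (Re c0 + real j - 1) * (1 - z) powr (\<kappa> + Re a - 1)"
      have k: "?R j z = of_real r"
      proof -
        have "complex_of_real z powr (?u j - 1) = of_real (z powr (Re c0 + real j - 1))"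
          using z by (subst powr_of_real [symmetric]) auto
        moreover have "complex_of_real (1 - z) powr (of_real \<kappa> + of_real (Re a) - 1) = of_real ((1 - z) powr (\<kappa> + Re a - 1))"
          using z by (subst powr_of_real [symmetric]) auto
        ultimately show ?thesis by (simp only: beta_kernel_def of_real_mult r_def)
      qed
      have "norm (?B j z * ?h j z) = r * norm (?h j z)"
        using norm_beta_kernel[OF z, of "c0 + of_nat j" "of_real \<kappa> + a"] by (simp add: norm_mult r_def)
      also have "\<dots> \<le> r * (C * Re (?H j z))"
        by (intro mult_left_mono C z) (simp add: r_def)
      finally show "norm (?B j z * ?h j z) \<le> C * Re (?R j z * ?H j z)"
        unfolding k by (simp add: mult_ac)
    qed
    also have "\<dots> = C * Re (Gamma (?u j) * rGamma (of_real (Re c0) + of_real \<kappa> + of_nat j) * E)"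
      using integral_Re[OF S(1)[unfolded set_integrable_def]] S(2)
      by (simp add: set_lebesgue_integral_def E_def add_ac mult_ac)
    also have "\<dots> \<le> C * norm (Gamma (?u j) * rGamma (of_real (Re c0) + of_real \<kappa> + of_nat j) * E)"
      using C(1) by (intro mult_left_mono complex_Re_le_cmod) auto
    finally show ?thesis by (simp add: norm_mult mult_ac)
  qed
  have "kernel_norm a b c \<kappa> \<circ> (+) k0 \<in> O(\<lambda>j. norm (Gamma (?u j) * rGamma (of_real (Re c0) + of_real \<kappa> + of_nat j)))"
    by (rule bigoI[of _ "C * norm E"]) (use bound in \<open>simp add: kernel_norm_nonneg\<close>)
  also have "(\<lambda>j. norm (Gamma (?u j) * rGamma (of_real (Re c0) + of_real \<kappa> + of_nat j))) \<in> O(\<lambda>j. real (j + 1) powr (- \<kappa>))"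
    using Gamma_ratio_bigo[of "of_real (Re c0)" "of_real \<kappa>"] c0 by simp
  finally have 1: "(\<lambda>j. kernel_norm a b c \<kappa> (k0 + j)) \<in> O(\<lambda>j. real (j + 1) powr (- \<kappa>))" by (simp add: o_def)
  \<comment> \<open>It remains to undo the shift by \<open>k0\<close>.\<close>
  have "filterlim (\<lambda>k::nat. k - k0) at_top at_top"
    by (rule filterlim_minus_const_nat_at_top)
  from landau_o.big.compose[OF 1 this] have "(\<lambda>k. kernel_norm a b c \<kappa> (k0 + (k - k0))) \<in> O(\<lambda>k. real (k - k0 + 1) powr (- \<kappa>))" .
  also have "(\<lambda>k. real (k - k0 + 1) powr (- \<kappa>)) \<in> \<Theta>(\<lambda>k. (real k - real k0 + 1) powr (- \<kappa>))"
    by (rule bigthetaI_cong, rule eventually_mono[OF eventually_ge_at_top[of k0]]) (simp add: of_nat_diff add_ac)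
  also have "(\<lambda>k::nat. (real k - real k0 + 1) powr (- \<kappa>)) \<in> O(\<lambda>k. real (k + 1) powr (- \<kappa>))"
    by real_asymp
  finally show ?thesis
    by (rule landau_o.big.in_cong[THEN iffD1, rotated]) (rule eventually_mono[OF eventually_ge_at_top[of k0]], simp)
qed

text \<open>
In the second term \<open>\<kappa>\<close> drops by one while \<open>a\<close>, \<open>b\<close>, \<open>c\<close> rise by one, which leaves \<open>\<kappa> + Re a\<close> and \<open>\<kappa> + Re b\<close>
unchanged.  The factor \<open>1 / (c + k)\<close> makes up for the weaker decay that belongs to \<open>\<kappa> - 1\<close>.
\<close>

lemma kernel_norm_step:
  assumes c: "Re c > 0" and \<kappa>a: "\<kappa> + Re a > 0" and \<kappa>b: "\<kappa> + Re b > 0"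
  shows "kernel_norm a b c \<kappa> k \<le> kernel_norm (a + 1) b c \<kappa> k
     + norm b / norm (c + of_nat k) * kernel_norm (a + 1) (b + 1) (c + 1) (\<kappa> - 1) k"
proof -
  let ?c = "c + of_nat k" and ?c1 = "c + 1 + of_nat k"
  let ?f = "\<lambda>z. beta_kernel ?c (of_real \<kappa> + a) z * hyp2F1_series a (?c - b) ?c (of_real z)"
  let ?g = "\<lambda>z. beta_kernel ?c (of_real \<kappa> + (a + 1)) z * hyp2F1_series (a + 1) (?c - b) ?c (of_real z)"
  let ?h = "\<lambda>z. beta_kernel ?c1 (of_real (\<kappa> - 1) + (a + 1)) z * hyp2F1_series (a + 1) (?c1 - (b + 1)) ?c1 (of_real z)"
  have i: "set_integrable lborel {0<..<1} ?f" "set_integrable lborel {0<..<1} ?g" "set_integrable lborel {0<..<1} ?h"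
    by (rule series_beta_integral(1); use assms in simp)+
  have n: "set_integrable lborel {0<..<1} (\<lambda>z. norm (?f z))" "set_integrable lborel {0<..<1} (\<lambda>z. norm (?g z))"
      "set_integrable lborel {0<..<1} (\<lambda>z. norm b / norm ?c * norm (?h z))"
    by (intro set_integrable_mult_right set_integrable_norm i)+
  have "kernel_norm a b c \<kappa> k \<le> (LBINT z:{0<..<1}. norm (?g z) + norm b / norm ?c * norm (?h z))"
    unfolding kernel_norm_def
  proof (rule set_integral_mono[OF n(1) set_integral_add(1)[OF n(2,3)]])
    fix z :: real assume z: "z \<in> {0<..<1}"
    have cn: "?c \<notin> \<int>\<^sub>\<le>\<^sub>0" "?c + 1 \<notin> \<int>\<^sub>\<le>\<^sub>0" using c by (intro Re_pos_not_nonpos_Int; simp)+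
    have k1: "beta_kernel ?c (of_real \<kappa> + a) z * (1 - of_real z) = beta_kernel ?c (of_real \<kappa> + (a + 1)) z"
    proof -
      have "complex_of_real (1 - z) powr (of_real \<kappa> + a) = complex_of_real (1 - z) powr ((of_real \<kappa> + a) - 1) * of_real (1 - z)"
        using z by (simp add: powr_diff)
      thus ?thesis by (simp add: beta_kernel_def add.assoc [symmetric])
    qed
    have k2: "beta_kernel ?c (of_real \<kappa> + a) z * of_real z = beta_kernel ?c1 (of_real (\<kappa> - 1) + (a + 1)) z"
      using beta_kernel_mult_power[OF z, of ?c "of_real \<kappa> + a" 1] by (simp add: add_ac)
    have e: "hyp2F1_series a (?c - b) ?c (of_real z) = (1 - of_real z) * hyp2F1_series (a + 1) (?c - b) ?c (of_real z)
        + (?c - (?c - b)) / ?c * of_real z * hyp2F1_series (a + 1) (?c - b) (?c + 1) (of_real z)"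
      by (rule hyp2F1_series_contiguous[OF cn]) (use z in auto)
    have "?f z = ?g z + b / ?c * ?h z"
      unfolding e k1 [symmetric] k2 [symmetric] by (simp add: algebra_simps)
    also have "norm \<dots> \<le> norm (?g z) + norm (b / ?c * ?h z)" by (rule norm_triangle_ineq)
    finally show "norm (?f z) \<le> norm (?g z) + norm b / norm ?c * norm (?h z)"
      by (simp only: norm_mult[of "b / ?c"] norm_divide)
  qed
  also have "\<dots> = kernel_norm (a + 1) b c \<kappa> k + norm b / norm ?c * kernel_norm (a + 1) (b + 1) (c + 1) (\<kappa> - 1) k"
    unfolding set_integral_add(2)[OF n(2,3)] kernel_norm_def by (simp only: set_integral_mult_right)
  finally show ?thesis .
qed

text \<open>
Cancellations inside the series matter here.  If \<open>a\<close> has negative real part, integrating the absolute values of the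
terms may give sums that decay more slowly in \<open>k\<close>.  The induction is over the number of steps that make the
real part of \<open>a\<close> positive.
\<close>

lemma kernel_norm_bigo:
  assumes "Re c > 0" "\<kappa> + Re a > 0" "\<kappa> + Re b > 0"
  shows "kernel_norm a b c \<kappa> \<in> O(\<lambda>k. real (k + 1) powr (- \<kappa>))"
proof -
  have "kernel_norm a b c \<kappa> \<in> O(\<lambda>k. real (k + 1) powr (- \<kappa>))"
    if "real n > - Re a" "Re c > 0" "\<kappa> + Re a > 0" "\<kappa> + Re b > 0" for n a b c \<kappa>
    using that
  proof (induction n arbitrary: a b c \<kappa>)
    case 0
    thus ?case by (intro kernel_norm_bigo_pos) auto
  next
    case (Suc n)
    have 1: "kernel_norm (a + 1) b c \<kappa> \<in> O(\<lambda>k. real (k + 1) powr (- \<kappa>))"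
      using Suc.prems by (intro Suc.IH) auto
    have 2: "kernel_norm (a + 1) (b + 1) (c + 1) (\<kappa> - 1) \<in> O(\<lambda>k. real (k + 1) powr (- (\<kappa> - 1)))"
      using Suc.prems by (intro Suc.IH) auto
    have 3: "(\<lambda>k. norm b / norm (c + of_nat k)) \<in> O(\<lambda>k. 1 / real (k + 1))"
    proof (rule landau_o.big_trans)
      show "(\<lambda>k. norm b / norm (c + of_nat k)) \<in> O(\<lambda>k. norm b / (Re c + real k))"
      proof (rule landau_o.big_mono, rule always_eventually, rule allI)
        fix k :: nat
        have "Re c + real k \<le> norm (c + of_nat k)" using complex_Re_le_cmod[of "c + of_nat k"] by simp
        thus "norm (norm b / norm (c + of_nat k)) \<le> norm (norm b / (Re c + real k))"
        proof -
          have pos: "0 < Re c + real k" using Suc.prems by simp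
          have "norm b / norm (c + of_nat k) \<le> norm b / (Re c + real k)"
            by (rule frac_le) (use pos \<open>Re c + real k \<le> norm (c + of_nat k)\<close> in auto)
          thus ?thesis using pos by simp
        qed
      qed
      show "(\<lambda>k. norm b / (Re c + real k)) \<in> O(\<lambda>k. 1 / real (k + 1))" by real_asymp
    qed
    have "(\<lambda>k. norm b / norm (c + of_nat k) * kernel_norm (a + 1) (b + 1) (c + 1) (\<kappa> - 1) k)
       \<in> O(\<lambda>k. 1 / real (k + 1) * real (k + 1) powr (- (\<kappa> - 1)))"
      by (intro landau_o.big.mult 3 2)
    also have "(\<lambda>k. 1 / real (k + 1) * real (k + 1) powr (- (\<kappa> - 1))) = (\<lambda>k. real (k + 1) powr (- \<kappa>))"
      by (rule ext) (simp add: powr_diff powr_minus field_simps del: of_nat_Suc of_nat_add)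
    finally have "(\<lambda>k. kernel_norm (a + 1) b c \<kappa> k + norm b / norm (c + of_nat k) * kernel_norm (a + 1) (b + 1) (c + 1) (\<kappa> - 1) k)
       \<in> O(\<lambda>k. real (k + 1) powr (- \<kappa>))"
      by (intro sum_in_bigo 1)
    moreover have "kernel_norm a b c \<kappa> \<in> O(\<lambda>k. kernel_norm (a + 1) b c \<kappa> k + norm b / norm (c + of_nat k) * kernel_norm (a + 1) (b + 1) (c + 1) (\<kappa> - 1) k)"
    proof (rule landau_o.big_mono, rule always_eventually, rule allI)
      fix k
      show "norm (kernel_norm a b c \<kappa> k) \<le> norm (kernel_norm (a + 1) b c \<kappa> k + norm b / norm (c + of_nat k) * kernel_norm (a + 1) (b + 1) (c + 1) (\<kappa> - 1) k)"
        using kernel_norm_step[of c \<kappa> a b k] Suc.prems kernel_norm_nonneg[of a b c \<kappa> k] by simp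
    qed
    ultimately show ?case by (rule landau_o.big_trans[rotated])
  qed
  moreover obtain n :: nat where "real n > - Re a" using reals_Archimedean2 by blast
  ultimately show ?thesis using assms by blast
qed

section \<open>The Appell kernel\<close>

text \<open>
The function \<open>F\<^sub>3\<close> at \<open>u = z\<close>, \<open>v = - z / (1 - z)\<close>, divided by the power of \<open>1 - z\<close> with exponent \<open>a'\<close> that Pfaff's
transformation splits off from every Gauss function.
\<close>

definition appell_series :: "complex \<Rightarrow> complex \<Rightarrow> complex \<Rightarrow> complex \<Rightarrow> complex \<Rightarrow> real \<Rightarrow> complex" where
  "appell_series a a' b b' c z =
     (\<Sum>k. hyp2F1_coeff a b c k * of_real z ^ k
            * hyp2F1_series a' (c + of_nat k - b') (c + of_nat k) (of_real z))"

text \<open>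
The inner series are bounded independently of \<open>k\<close>, because each factor of \<open>(c + k - b')\<^sub>l / (c + k)\<^sub>l\<close> has
absolute value at most \<open>1 + |b'| / (Re c + i)\<close>.
\<close>

lemma summable_appell_series:
  assumes c: "Re c > 0" and z: "z \<in> {0<..<1}"
  shows "summable (\<lambda>k. norm (hyp2F1_coeff a b c k * of_real z ^ k
            * hyp2F1_series a' (c + of_nat k - b') (c + of_nat k) (of_real z)))"
proof -
  define r e where "r = Re c" and "e = Re c + norm b'"
  have r: "r > 0" and e: "e > 0" using c by (auto simp: r_def e_def add_pos_nonneg)
  \<comment> \<open>The majorant has \<open>c + k - b'\<close> replaced by \<open>Re c + |b'|\<close> and \<open>c + k\<close> by \<open>Re c\<close>.\<close>
  let ?m = "\<lambda>l. norm (hyp2F1_coeff a' (of_real e) (of_real r) l) * norm (complex_of_real z) ^ l"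
  let ?H = "\<lambda>k. hyp2F1_series a' (c + of_nat k - b') (c + of_nat k) (of_real z)"
  have c0: "of_real r \<notin> (\<int>\<^sub>\<le>\<^sub>0 :: complex set)" "c \<notin> \<int>\<^sub>\<le>\<^sub>0" using r c by (intro Re_pos_not_nonpos_Int; simp)+
  have sM: "summable ?m" using z by (intro summable_norm_hyp2F1_series c0) auto
  have bound: "norm (?H k) \<le> suminf ?m" for k
  proof -
    let ?q = "hyp2F1_coeff a' (c + of_nat k - b') (c + of_nat k)"
    have ck: "c + of_nat k \<notin> \<int>\<^sub>\<le>\<^sub>0" using c by (intro Re_pos_not_nonpos_Int) simp
    have s: "(\<lambda>l. ?q l * of_real z ^ l) sums ?H k" using z by (intro hyp2F1_series_sums ck) auto
    have le: "norm (?q l) \<le> norm (hyp2F1_coeff a' (of_real e) (of_real r) l)" for l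
    proof -
      have "norm (pochhammer (c + of_nat k - b') l / pochhammer (c + of_nat k) l) =
          (\<Prod>i = 0..<l. norm ((c + of_nat k - b' + of_nat i) / (c + of_nat k + of_nat i)))"
        by (simp add: pochhammer_prod prod_norm prod_dividef norm_divide)
      also have "\<dots> \<le> (\<Prod>i = 0..<l. (e + real i) / (r + real i))"
      proof (rule prod_mono, safe)
        fix i
        let ?w = "c + of_nat k + of_nat i"
        have w: "r + real i \<le> norm ?w" using complex_Re_le_cmod[of ?w] by (simp add: r_def)
        hence w0: "norm ?w > 0" using r by linarith
        have "norm ((c + of_nat k - b' + of_nat i) / ?w) \<le> (norm ?w + norm b') / norm ?w"
          unfolding norm_divide using norm_triangle_ineq4[of ?w b'] by (intro divide_right_mono) (auto simp: algebra_simps)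
        also have "\<dots> = 1 + norm b' / norm ?w" using w0 by (simp add: add_divide_distrib)
        also have "\<dots> \<le> 1 + norm b' / (r + real i)" using w r by (intro add_left_mono frac_le) auto
        also have "\<dots> = (e + real i) / (r + real i)" using r by (simp add: e_def r_def field_simps)
        finally show "norm ((c + of_nat k - b' + of_nat i) / ?w) \<le> (e + real i) / (r + real i)" .
      qed auto
      also have "\<dots> = pochhammer e l / pochhammer r l" by (simp add: pochhammer_prod prod_dividef)
      also have "\<dots> = norm (pochhammer (of_real e) l / pochhammer (of_real r) l :: complex)"
        using pochhammer_pos[OF r, of l] pochhammer_pos[OF e, of l]
        by (simp only: pochhammer_of_real norm_divide norm_of_real abs_of_pos)
      finally have "norm (pochhammer a' l / fact l) * norm (pochhammer (c + of_nat k - b') l / pochhammer (c + of_nat k) l)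
         \<le> norm (pochhammer a' l / fact l) * norm (pochhammer (of_real e) l / pochhammer (of_real r) l :: complex)"
        by (rule mult_left_mono) auto
      thus ?thesis by (simp add: norm_mult norm_divide mult_ac)
    qed
    have "norm (\<Sum>l. ?q l * of_real z ^ l) \<le> suminf ?m"
    proof (rule norm_suminf_le[OF _ sM])
      show "norm (?q l * of_real z ^ l) \<le> ?m l" for l
        using mult_right_mono[OF le[of l], of "norm (complex_of_real z) ^ l"]
        by (simp only: norm_mult[of "?q l"] norm_power) simp
    qed
    with s show ?thesis by (simp only: sums_iff)
  qed
  show ?thesis
  proof (rule summable_comparison_test')
    show "summable (\<lambda>k. norm (hyp2F1_coeff a b c k) * norm (complex_of_real z) ^ k * suminf ?m)"
      using z by (intro summable_mult2 summable_norm_hyp2F1_series c0) auto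
    show "norm (norm (hyp2F1_coeff a b c k * of_real z ^ k * ?H k))
         \<le> norm (hyp2F1_coeff a b c k) * norm (complex_of_real z) ^ k * suminf ?m" if "k \<ge> 0" for k
      unfolding real_norm_def abs_norm_cancel unfolding norm_mult[of "_ * _ ^ _"] norm_mult[of "hyp2F1_coeff _ _ _ _" "_ ^ _"] norm_power
      by (intro mult_left_mono bound) auto
  qed
qed

text \<open>
The values given by \<open>series_beta_integral\<close> for the terms form a Gauss series with parameters \<open>a\<close>, \<open>b\<close>,
\<open>c + \<kappa>\<close>.  It is the bound on \<open>kernel_norm\<close> that allows the exchange of sum and integral.
\<close>

lemma appell_beta_integral:
  assumes c: "Re c > 0" and a: "Re (\<kappa> + a') > 0" and b: "Re (\<kappa> + b') > 0" and conv: "Re (c + \<kappa> - a - b) > 0"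
  shows "set_integrable lborel {0<..<1} (\<lambda>z. beta_kernel c (\<kappa> + a') z * appell_series a a' b b' c z)"
    and "(LBINT z:{0<..<1}. beta_kernel c (\<kappa> + a') z * appell_series a a' b b' c z) =
       Gamma c * Gamma (\<kappa> + a') * Gamma (\<kappa> + b') * rGamma (\<kappa> + a' + b')
       * (Gamma (c + \<kappa> - a - b) * rGamma (c + \<kappa> - a) * rGamma (c + \<kappa> - b))"
proof -
  have c0: "c \<notin> \<int>\<^sub>\<le>\<^sub>0" using c by (rule Re_pos_not_nonpos_Int)
  let ?H = "\<lambda>k z. hyp2F1_series a' (c + of_nat k - b') (c + of_nat k) (of_real z)"
  let ?q = "hyp2F1_coeff a b c"
  define f where "f k z = ?q k * (beta_kernel (c + of_nat k) (\<kappa> + a') z * ?H k z)" for k z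
  have ck: "Re (c + of_nat k) > 0" for k using c by simp
  have int: "set_integrable lborel {0<..<1} (f k)" for k
    unfolding f_def by (intro set_integrable_mult_right series_beta_integral ck a b)
  have val: "(LBINT z:{0<..<1}. f k z) = Gamma c * Gamma (\<kappa> + a') * Gamma (\<kappa> + b') * rGamma (\<kappa> + a' + b') * gauss_term a b (c + \<kappa>) k" for k
  proof -
    have nz: "pochhammer c k \<noteq> 0" using c0 by (auto simp: pochhammer_eq_0_iff)
    have "Gamma (c + of_nat k) = Gamma c * pochhammer c k"
      using pochhammer_Gamma[OF c0, of k] c0 by (simp add: Gamma_eq_zero_iff)
    moreover have "(LBINT z:{0<..<1}. f k z) = ?q k *
       (Gamma (c + of_nat k) * Gamma (\<kappa> + a') * Gamma (\<kappa> + b') * rGamma (c + of_nat k + \<kappa>) * rGamma (\<kappa> + a' + b'))"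
      unfolding f_def set_integral_mult_right by (subst series_beta_integral(2)[OF ck a b]) simp
    ultimately show ?thesis using nz by (simp add: gauss_term_def add_ac)
  qed
  have "(LBINT z:{0<..<1}. norm (f k z)) = norm (?q k) * kernel_norm a' b' c (Re \<kappa>) k" for k
  proof -
    have "(LBINT z:{0<..<1}. norm (beta_kernel (c + of_nat k) (\<kappa> + a') z * ?H k z)) = kernel_norm a' b' c (Re \<kappa>) k"
      unfolding kernel_norm_def
      by (rule set_lebesgue_integral_cong) (auto simp: norm_mult norm_beta_kernel)
    thus ?thesis unfolding f_def by (simp only: norm_mult[of "?q k"] set_integral_mult_right)
  qed
  moreover have "(\<lambda>k. norm (?q k) * kernel_norm a' b' c (Re \<kappa>) k) \<in>
     O(\<lambda>k. real (k + 1) powr (Re (a + b - c) - 1) * real (k + 1) powr (- Re \<kappa>))"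
    using c a b by (intro landau_o.big.mult hyp2F1_coeff_bigo c0 kernel_norm_bigo) auto
  moreover have "(\<lambda>k. real (k + 1) powr (Re (a + b - c) - 1) * real (k + 1) powr (- Re \<kappa>)) =
    (\<lambda>k. real (k + 1) powr (Re (a + b - (c + \<kappa>)) - 1))"
    by (rule ext, subst powr_add [symmetric]) (simp add: algebra_simps)
  ultimately have bound: "(\<lambda>k. LBINT z:{0<..<1}. norm (f k z)) \<in> O(\<lambda>k. real (k + 1) powr (Re (a + b - (c + \<kappa>)) - 1))"
    by (simp only:)
  have fz: "f k z = beta_kernel c (\<kappa> + a') z * (?q k * of_real z ^ k * ?H k z)" if "z \<in> {0<..<1}" for k z
    unfolding f_def using that by (simp only: beta_kernel_mult_power [symmetric] mult_ac)
  have summ: "summable (\<lambda>k. norm (f k z))" if z: "z \<in> {0<..<1}" for z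
    using summable_mult[OF summable_appell_series[OF c z, of a b a' b'], of "norm (beta_kernel c (\<kappa> + a') z)"]
    by (simp only: fz[OF z] norm_mult[of "beta_kernel c (\<kappa> + a') z"])
  have F: "(\<Sum>k. f k z) = beta_kernel c (\<kappa> + a') z * appell_series a a' b b' c z" if z: "z \<in> {0<..<1}" for z
    unfolding appell_series_def fz[OF z]
    by (rule suminf_mult, rule summable_norm_cancel, rule summable_appell_series[OF c z])
  note main = integral_gauss_series[OF int val bound summ F conv]
  show "set_integrable lborel {0<..<1} (\<lambda>z. beta_kernel c (\<kappa> + a') z * appell_series a a' b b' c z)"
    by (rule main(1))
  show "(LBINT z:{0<..<1}. beta_kernel c (\<kappa> + a') z * appell_series a a' b b' c z) =
       Gamma c * Gamma (\<kappa> + a') * Gamma (\<kappa> + b') * rGamma (\<kappa> + a' + b')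
       * (Gamma (c + \<kappa> - a - b) * rGamma (c + \<kappa> - a) * rGamma (c + \<kappa> - b))"
    by (rule main(2))
qed

lemma of_real_powr_exp: "x > 0 \<Longrightarrow> complex_of_real x powr p = exp (p * of_real (ln x))"
  by (simp add: powr_def Ln_of_real)

lemma appell_F3_eq:
  assumes c: "Re c > 0" and x: "x > 0" and t: "t > x"
  shows "appell_F3 a a' b b' c (of_real (1 - x / t)) (of_real (1 - t / x)) =
     of_real (x / t) powr a' * appell_series a a' b b' c (1 - x / t)"
proof -
  define z where "z = 1 - x / t"
  have z: "z \<in> {0<..<1}" using x t by (auto simp: z_def field_simps)
  have v: "1 - t / x \<le> 0" using x t by (auto simp: field_simps)
  have h: "hyp2F1 a' b' (c + of_nat k) (of_real (1 - t / x)) =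
     of_real (x / t) powr a' * hyp2F1_series a' (c + of_nat k - b') (c + of_nat k) (of_real z)" for k
  proof -
    have ck: "c + of_nat k \<notin> \<int>\<^sub>\<le>\<^sub>0" using c by (intro Re_pos_not_nonpos_Int) simp
    have "hyp2F1 a' b' (c + of_nat k) (of_real (1 - t / x)) = (1 - of_real (1 - t / x)) powr (- a') *
       hyp2F1_series a' (c + of_nat k - b') (c + of_nat k) (of_real (1 - t / x) / (of_real (1 - t / x) - 1))"
      by (rule hyp2F1_pfaff[OF ck], unfold Re_complex_of_real) (use v in linarith)
    also have "(1 - of_real (1 - t / x)) = complex_of_real (t / x)" by simp
    also have "complex_of_real (t / x) powr (- a') = of_real (x / t) powr a'"
      using x t by (simp only: of_real_powr_exp[of "t / x"] of_real_powr_exp[of "x / t"] divide_pos_pos less_trans[OF x t] ln_div) (simp add: algebra_simps)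
    also have "of_real (1 - t / x) / (of_real (1 - t / x) - 1) = complex_of_real z"
    proof -
      have "(1 - t / x) / ((1 - t / x) - 1) = z" using x t by (simp add: z_def field_simps)
      thus ?thesis by (metis of_real_1 of_real_diff of_real_divide)
    qed
    finally show ?thesis .
  qed
  have "appell_F3 a a' b b' c (of_real z) (of_real (1 - t / x)) =
     (\<Sum>k. pochhammer a k * pochhammer b k / pochhammer c k * of_real z ^ k / fact k
               * hyp2F1 a' b' (c + of_nat k) (of_real (1 - t / x)))"
    unfolding appell_F3_def using z v by simp
  also have "\<dots> = (\<Sum>k. of_real (x / t) powr a' * (hyp2F1_coeff a b c k * of_real z ^ k
            * hyp2F1_series a' (c + of_nat k - b') (c + of_nat k) (of_real z)))"
    unfolding h by (simp add: field_simps)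
  also have "\<dots> = of_real (x / t) powr a' * appell_series a a' b b' c z"
    unfolding appell_series_def by (rule suminf_mult, rule summable_norm_cancel, rule summable_appell_series[OF c z])
  finally show ?thesis by (simp only: z_def)
qed

lemma msm_integrand_power_eq:
  assumes c: "Re c > 0" and x: "x > 0" and t: "t > x"
  shows "msm_integrand a a' b b' c (\<lambda>t. of_real t powr (- w)) x t =
     of_real x powr (c - a - w) * (of_real (x / t\<^sup>2) * (beta_kernel c (a + w - c + a') (1 - x / t) * appell_series a a' b b' c (1 - x / t)))"
proof -
  define z where "z = 1 - x / t"
  have t0: "t > 0" and z: "z > 0" "x / t > 0" using x t by (auto simp: z_def field_simps)
  define X T Z where "X = complex_of_real (ln x)" and "T = complex_of_real (ln t)" and "Z = complex_of_real (ln z)"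
  have "t - x = t * z" using t0 by (simp add: z_def field_simps)
  hence lz: "complex_of_real (ln (t - x)) = T + Z" using t0 z by (simp add: ln_mult T_def Z_def)
  have lxt: "complex_of_real (ln (x / t)) = X - T" using x t0 by (simp add: ln_div X_def T_def)
  have xt: "complex_of_real (x / t\<^sup>2) = exp (X - 2 * T)"
  proof -
    have "exp (ln x - 2 * ln t) = x / t\<^sup>2" using x t0 by (simp add: exp_diff exp_double)
    hence "complex_of_real (x / t\<^sup>2) = of_real (exp (ln x - 2 * ln t))" by (simp only:)
    also have "\<dots> = exp (of_real (ln x - 2 * ln t))" by (rule exp_of_real [symmetric])
    finally show ?thesis by (simp add: X_def T_def)
  qed
  have oz: "1 - z = x / t" by (simp add: z_def)
  note F3 = appell_F3_eq[OF c x t, folded z_def]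
  have "exp ((c - 1) * (T + Z)) * exp (- a * T) * (exp (a' * (X - T)) * S) * exp (- w * T) =
    exp ((c - a - w) * X) * (exp (X - 2 * T) * (exp ((c - 1) * Z) * exp ((a + w - c + a' - 1) * (X - T)) * S))" for S
  proof -
    have "exp ((c - 1) * (T + Z)) * exp (- a * T) * exp (a' * (X - T)) * exp (- w * T) =
      exp ((c - a - w) * X) * exp (X - 2 * T) * exp ((c - 1) * Z) * exp ((a + w - c + a' - 1) * (X - T))"
      unfolding exp_add [symmetric] by (rule arg_cong[where f = exp]) (simp add: algebra_simps)
    thus ?thesis by (simp only: mult_ac)
  qed
  moreover have "complex_of_real (t - x) powr (c - 1) = exp ((c - 1) * (T + Z))"
    using t by (simp only: of_real_powr_exp diff_gt_0_iff_gt lz)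
  moreover have "complex_of_real t powr p = exp (p * T)" for p using t0 by (simp only: of_real_powr_exp T_def)
  moreover have "complex_of_real x powr p = exp (p * X)" for p using x by (simp only: of_real_powr_exp X_def)
  moreover have "complex_of_real (x / t) powr p = exp (p * (X - T))" for p
    using z by (simp only: of_real_powr_exp lxt)
  moreover have "complex_of_real z powr p = exp (p * Z)" for p using z by (simp only: of_real_powr_exp Z_def)
  ultimately show ?thesis
    unfolding msm_integrand_def z_def [symmetric] F3 beta_kernel_def oz xt by (simp only: mult.assoc)
qed

text \<open>
The Mellin multiplier of the operator.  The factors of the denominator are reciprocal gamma functions, which
vanish at the poles.
\<close>

definition msm_multiplier :: "complex \<Rightarrow> complex \<Rightarrow> complex \<Rightarrow> complex \<Rightarrow> complex \<Rightarrow> complex \<Rightarrow> complex" where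
  "msm_multiplier a a' b b' c w =
     Gamma (w + a + a' - c) * Gamma (w + a + b' - c) * Gamma (w - b)
     * rGamma w * rGamma (w + a + a' + b' - c) * rGamma (w + a - b)"

text \<open>
In the variable \<open>z = 1 - x/t\<close> the integrand is a power of \<open>x\<close> times the kernel of \<open>appell_beta_integral\<close> with
\<open>\<kappa> = a + w - c\<close>.
\<close>

theorem msm_integral_power:
  assumes c: "Re c > 0" and x: "x > 0"
    and w: "Re w > Re b" "Re w > Re (c - a - a')" "Re w > Re (c - a - b')"
  shows "msm_integral_exists a a' b b' c (\<lambda>t. of_real t powr (- w)) x"
    and "msm_integral a a' b b' c (\<lambda>t. of_real t powr (- w)) x =
           msm_multiplier a a' b b' c w * of_real x powr (c - a - a' - w)"
proof -
  define \<kappa> where "\<kappa> = a + w - c"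
  let ?K = "\<lambda>z. beta_kernel c (\<kappa> + a') z * appell_series a a' b b' c z"
  let ?f = "msm_integrand a a' b b' c (\<lambda>t. of_real t powr (- w)) x"
  let ?g = "\<lambda>t. of_real x powr (c - a - w) * (of_real (x / t\<^sup>2) * ?K (1 - x / t))"
  have \<kappa>: "Re (\<kappa> + a') > 0" "Re (\<kappa> + b') > 0" "Re (c + \<kappa> - a - b) > 0" using w by (auto simp: \<kappa>_def)
  note B = appell_beta_integral[OF c \<kappa>]
  note ch = change_variable_one_minus_inverse[OF x B(1)]
  have eq: "?f t =
     ?g t"
    if "t \<in> {x<..}" for t using msm_integrand_power_eq[OF c x] that by (simp add: \<kappa>_def)
  have "set_integrable lborel {x<..} ?g"
    by (intro set_integrable_mult_right ch)
  thus "msm_integral_exists a a' b b' c (\<lambda>t. of_real t powr (- w)) x"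
    unfolding msm_integral_exists_def by (rule set_integrable_cong[THEN iffD1, rotated -1]) (auto simp: eq)
  have "(LBINT t:{x<..}. ?f t) =
     (LBINT t:{x<..}. ?g t)"
    by (rule set_lebesgue_integral_cong) (auto simp: eq)
  also have "\<dots> = of_real x powr (c - a - w) * (Gamma c * Gamma (\<kappa> + a') * Gamma (\<kappa> + b') * rGamma (\<kappa> + a' + b')
       * (Gamma (c + \<kappa> - a - b) * rGamma (c + \<kappa> - a) * rGamma (c + \<kappa> - b)))"
    unfolding set_integral_mult_right ch(2) B(2) ..
  finally have "msm_integral a a' b b' c (\<lambda>t. of_real t powr (- w)) x = of_real x powr (- a') / Gamma c *
     (of_real x powr (c - a - w) * (Gamma c * Gamma (\<kappa> + a') * Gamma (\<kappa> + b') * rGamma (\<kappa> + a' + b')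
       * (Gamma (c + \<kappa> - a - b) * rGamma (c + \<kappa> - a) * rGamma (c + \<kappa> - b))))"
    unfolding msm_integral_def by simp
  also have "\<dots> = (of_real x powr (- a') * of_real x powr (c - a - w)) * (Gamma (\<kappa> + a') * Gamma (\<kappa> + b') * rGamma (\<kappa> + a' + b')
       * (Gamma (c + \<kappa> - a - b) * rGamma (c + \<kappa> - a) * rGamma (c + \<kappa> - b)))"
    using Re_pos_not_nonpos_Int[OF c] by (simp add: Gamma_eq_zero_iff)
  also have "of_real x powr (- a') * of_real x powr (c - a - w) = complex_of_real x powr (c - a - a' - w)"
    by (subst powr_add [symmetric]) (simp add: algebra_simps)
  finally show "msm_integral a a' b b' c (\<lambda>t. of_real t powr (- w)) x =
           msm_multiplier a a' b b' c w * of_real x powr (c - a - a' - w)"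
    by (simp add: msm_multiplier_def \<kappa>_def algebra_simps)
qed

section \<open>Superpositions of powers\<close>

text \<open>
A superposition of the powers \<open>t\<^sup>-\<^sup>w\<close> over the vertical line \<open>Re w = Re q\<close>, parametrised as \<open>w = q - i \<mu> \<tau>\<close>.
\<close>

definition powers_integral :: "(real \<Rightarrow> complex) \<Rightarrow> complex \<Rightarrow> real \<Rightarrow> real \<Rightarrow> complex" where
  "powers_integral h q \<mu> t = (LBINT \<tau>. h \<tau> * of_real t powr (- (q - \<i> * of_real (\<mu> * \<tau>))))"

lemma powr_split_imaginary:
  "t > 0 \<Longrightarrow> complex_of_real t powr (- (q - \<i> * of_real r)) = of_real t powr (- q) * exp (\<i> * of_real (r * ln t))"
  by (simp add: of_real_powr_exp flip: exp_add) (simp add: algebra_simps)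

text \<open>
On the line only the phase of \<open>t\<^sup>-\<^sup>w\<close> varies, so the double integral is absolutely convergent: its absolute value
is the product of the density and the integrand for the single power \<open>t\<^sup>-\<^sup>\<rho>\<close>.
\<close>

theorem msm_integral_powers_integral:
  assumes c: "Re c > 0" and x: "x > 0" and h: "integrable lborel h"
    and r: "Re \<rho> > Re b" "Re \<rho> > Re (c - a - a')" "Re \<rho> > Re (c - a - b')"
    and f: "\<And>t. t > 0 \<Longrightarrow> f t = powers_integral h \<rho> \<mu> t"
  shows "msm_integral_exists a a' b b' c f x"
    and "msm_integral a a' b b' c f x =
       powers_integral (\<lambda>\<tau>. h \<tau> * msm_multiplier a a' b b' c (\<rho> - \<i> * of_real (\<mu> * \<tau>)))
          (\<rho> - c + a + a') \<mu> x"
proof -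
  define w where "w \<tau> = \<rho> - \<i> * of_real (\<mu> * \<tau>)" for \<tau>
  define k where "k t = indicator {x<..} t *\<^sub>R msm_integrand a a' b b' c (\<lambda>t. of_real t powr (- \<rho>)) x t" for t
  define P where "P = (\<lambda>(t, \<tau>). k t * (h \<tau> * exp (\<i> * of_real (\<mu> * \<tau> * ln t))))"
  have k: "integrable lborel k"
    using msm_integral_power(1)[OF c x r] unfolding msm_integral_exists_def set_integrable_def k_def .
  have [measurable]: "k \<in> borel_measurable borel" "h \<in> borel_measurable borel"
    using k h by (auto dest: borel_measurable_integrable)
  have [measurable]: "P \<in> borel_measurable (lborel \<Otimes>\<^sub>M lborel)"
    unfolding P_def by measurable
  have nP: "norm (P (t, \<tau>)) = norm (k t) * norm (h \<tau>)" for t \<tau>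
    by (simp add: P_def norm_mult)
  have intP: "integrable (lborel \<Otimes>\<^sub>M lborel) P"
  proof (rule lborel_pair.Fubini_integrable)
    show "integrable lborel (\<lambda>t. \<integral>\<tau>. norm (P (t, \<tau>)) \<partial>lborel)"
      unfolding nP using k h by simp
    show "AE t in lborel. integrable lborel (\<lambda>\<tau>. P (t, \<tau>))"
    proof (rule AE_I2)
      fix t :: real
      have "integrable lborel (\<lambda>\<tau>. norm (k t) * norm (h \<tau>))" using h by simp
      thus "integrable lborel (\<lambda>\<tau>. P (t, \<tau>))"
        by (rule Bochner_Integration.integrable_bound) (auto simp: nP)
    qed
  qed measurable
  have P1: "P (t, \<tau>) = indicator {x<..} t *\<^sub>R (h \<tau> * msm_integrand a a' b b' c (\<lambda>t. of_real t powr (- w \<tau>)) x t)" for t \<tau>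
  proof (cases "t > x")
    case True
    with x have "t > 0" by simp
    from powr_split_imaginary[OF this, of \<rho> "\<mu> * \<tau>"] True show ?thesis
      by (simp add: P_def k_def msm_integrand_def w_def)
  qed (simp add: P_def k_def)
  have inner1: "(\<integral>\<tau>. P (t, \<tau>) \<partial>lborel) = indicator {x<..} t *\<^sub>R msm_integrand a a' b b' c f x t" for t
  proof (cases "t > x")
    case True
    with x have t: "t > 0" by simp
    have "P (t, \<tau>) = msm_integrand a a' b b' c (\<lambda>t. 1) x t * (h \<tau> * of_real t powr (- w \<tau>))" for \<tau>
      using True unfolding P1 by (simp add: msm_integrand_def)
    hence "(\<integral>\<tau>. P (t, \<tau>) \<partial>lborel) = msm_integrand a a' b b' c (\<lambda>t. 1) x t * powers_integral h \<rho> \<mu> t"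
      by (simp add: powers_integral_def w_def)
    thus ?thesis using True f[OF t] by (simp add: msm_integrand_def)
  qed (simp add: P1)
  show ex: "msm_integral_exists a a' b b' c f x"
    using lborel_pair.integrable_fst'[OF intP] unfolding inner1 msm_integral_exists_def set_integrable_def .
  have rw: "Re (w \<tau>) > Re b" "Re (w \<tau>) > Re (c - a - a')" "Re (w \<tau>) > Re (c - a - b')" for \<tau>
    using r by (simp_all add: w_def)
  have inner2: "of_real x powr (- a') / Gamma c * (\<integral>t. P (t, \<tau>) \<partial>lborel) =
      h \<tau> * msm_multiplier a a' b b' c (w \<tau>) * of_real x powr (c - a - a' - w \<tau>)" for \<tau>
  proof -
    have "(\<integral>t. P (t, \<tau>) \<partial>lborel) = h \<tau> * (LBINT t:{x<..}. msm_integrand a a' b b' c (\<lambda>t. of_real t powr (- w \<tau>)) x t)"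
      unfolding P1 set_lebesgue_integral_def by (simp only: mult_scaleR_right [symmetric] integral_mult_right_zero)
    thus ?thesis using msm_integral_power(2)[OF c x rw, of \<tau>] unfolding msm_integral_def by (simp add: mult_ac)
  qed
  have "msm_integral a a' b b' c f x = of_real x powr (- a') / Gamma c * (\<integral>t. (\<integral>\<tau>. P (t, \<tau>) \<partial>lborel) \<partial>lborel)"
    unfolding inner1 msm_integral_def set_lebesgue_integral_def ..
  also have "(\<integral>t. (\<integral>\<tau>. P (t, \<tau>) \<partial>lborel) \<partial>lborel) = (\<integral>\<tau>. (\<integral>t. P (t, \<tau>) \<partial>lborel) \<partial>lborel)"
    using intP by (intro lborel_pair.Fubini_integral [symmetric]) simp
  also have "of_real x powr (- a') / Gamma c * \<dots> = (\<integral>\<tau>. of_real x powr (- a') / Gamma c * (\<integral>t. P (t, \<tau>) \<partial>lborel) \<partial>lborel)"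
    by (simp only: integral_mult_right_zero)
  also have "\<dots> = powers_integral (\<lambda>\<tau>. h \<tau> * msm_multiplier a a' b b' c (w \<tau>)) (\<rho> - c + a + a') \<mu> x"
    unfolding inner2 powers_integral_def w_def by (simp add: algebra_simps)
  finally show "msm_integral a a' b b' c f x =
       powers_integral (\<lambda>\<tau>. h \<tau> * msm_multiplier a a' b b' c (\<rho> - \<i> * of_real (\<mu> * \<tau>)))
          (\<rho> - c + a + a') \<mu> x" unfolding w_def .
qed

lemma norm_powr_difference_le:
  fixes q :: complex and u v y :: real
  assumes y: "y > 0" and u: "u \<in> {y/2..2*y}" and v: "v \<in> {y/2..2*y}"
  shows "norm (of_real u powr (- q) - of_real v powr (- q))
     \<le> norm q * ((y/2) powr (- Re q - 1) + (2*y) powr (- Re q - 1)) * \<bar>u - v\<bar>"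
proof -
  define S where "S = closed_segment (complex_of_real (y/2)) (of_real (2*y))"
  define B where "B = (y/2) powr (- Re q - 1) + (2*y) powr (- Re q - 1)"
  have S: "S = of_real ` {y/2..2*y}"
    using y unfolding S_def closed_segment_of_real closed_segment_eq_real_ivl by simp
  have bd: "s powr e \<le> (y/2) powr e + (2*y) powr e" if "s \<in> {y/2..2*y}" for s e
  proof (cases "e \<ge> 0")
    case True
    hence "s powr e \<le> (2*y) powr e" using that y by (intro powr_mono2) auto
    thus ?thesis by (simp add: add_increasing)
  next
    case False
    hence "s powr e \<le> (y/2) powr e" using that y by (intro powr_mono2') auto
    thus ?thesis by (simp add: add_increasing2)
  qed
  have "norm (of_real u powr (- q) - of_real v powr (- q)) \<le> (norm q * B) * norm (complex_of_real u - of_real v)"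
  proof (rule field_differentiable_bound[where S = S and f = "\<lambda>z. z powr (- q)" and f' = "\<lambda>z. (- q) * z powr (- q - 1)"])
    show "convex S" by (simp add: S_def)
    fix z assume "z \<in> S"
    then obtain s where s: "z = of_real s" "s \<in> {y/2..2*y}" unfolding S by auto
    hence s0: "s > 0" using y by auto
    show "((\<lambda>z. z powr (- q)) has_field_derivative (- q) * z powr (- q - 1)) (at z within S)"
      using s s0 by (auto intro!: derivative_eq_intros simp: complex_nonpos_Reals_iff)
    show "norm ((- q) * z powr (- q - 1)) \<le> norm q * B"
      using bd[OF s(2), of "- Re q - 1"] s0 unfolding s(1) B_def
      by (simp add: norm_mult norm_of_real_powr mult_left_mono)
  qed (use u v in \<open>auto simp: S\<close>)
  thus ?thesis by (simp add: B_def flip: of_real_diff)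
qed

lemma has_vector_derivative_quotientI:
  fixes f :: "real \<Rightarrow> 'a :: real_normed_vector"
  assumes "((\<lambda>u. (f u - f y) /\<^sub>R (u - y)) \<longlongrightarrow> D) (at y)"
  shows "(f has_vector_derivative D) (at y)"
  unfolding has_vector_derivative_def has_derivative_iff_norm
proof
  show "bounded_linear (\<lambda>x. x *\<^sub>R D)" by (rule bounded_linear_scaleR_left)
  have "((\<lambda>u. norm ((f u - f y) /\<^sub>R (u - y) - D)) \<longlongrightarrow> 0) (at y)"
    using assms by (simp add: LIM_zero tendsto_norm_zero)
  moreover have "\<forall>\<^sub>F u in at y. norm ((f u - f y) /\<^sub>R (u - y) - D) = norm (f u - f y - (u - y) *\<^sub>R D) / norm (u - y)"
    unfolding eventually_at_filter
  proof (rule always_eventually, intro allI impI)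
    fix u assume "u \<noteq> y"
    hence "(f u - f y) /\<^sub>R (u - y) - D = (f u - f y - (u - y) *\<^sub>R D) /\<^sub>R (u - y)"
      by (simp add: scaleR_diff_right)
    thus "norm ((f u - f y) /\<^sub>R (u - y) - D) = norm (f u - f y - (u - y) *\<^sub>R D) / norm (u - y)"
      by (simp add: divide_inverse mult.commute)
  qed
  ultimately show "((\<lambda>u. norm (f u - f y - (u - y) *\<^sub>R D) / norm (u - y)) \<longlongrightarrow> 0) (at y)"
    by (rule Lim_transform_eventually)
qed

text \<open>
By \<open>norm_powr_difference_le\<close> the difference quotients of \<open>u\<^sup>-\<^sup>q\<close> are bounded near \<open>y\<close> by a constant times \<open>|q|\<close>, with a
constant depending only on \<open>Re q\<close>.  Thus \<open>|d q|\<close> is a majorant for dominated convergence.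
\<close>

lemma powers_integral_has_vector_derivative:
  fixes d :: "real \<Rightarrow> complex" and q0 :: complex and \<mu> y :: real
  defines "q \<equiv> \<lambda>\<tau>. q0 - \<i> * of_real (\<mu> * \<tau>)"
  assumes d: "integrable lborel d" and dq: "integrable lborel (\<lambda>\<tau>. d \<tau> * q \<tau>)" and y: "y > 0"
  shows "(powers_integral d q0 \<mu> has_vector_derivative - powers_integral (\<lambda>\<tau>. d \<tau> * q \<tau>) (q0 + 1) \<mu> y) (at y)"
proof -
  let ?S = "{y/2<..<2*y}"
  let ?D = "\<lambda>u \<tau>. (of_real u powr (- q \<tau>) - of_real y powr (- q \<tau>)) / of_real (u - y)"
  let ?L = "\<lambda>\<tau>. - q \<tau> * of_real y powr (- q \<tau> - 1)"
  have [measurable]: "d \<in> borel_measurable borel" using d by (auto dest: borel_measurable_integrable)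
  have [measurable]: "q \<in> borel_measurable borel" unfolding q_def by measurable
  have Re_q: "Re (q \<tau>) = Re q0" for \<tau> by (simp add: q_def)
  have int: "integrable lborel (\<lambda>\<tau>. d \<tau> * of_real u powr (- q \<tau>))" if "u > 0" for u
  proof (rule Bochner_Integration.integrable_bound)
    show "integrable lborel (\<lambda>\<tau>. of_real (u powr (- Re q0)) * d \<tau>)" using d by simp
    show "(\<lambda>\<tau>. d \<tau> * of_real u powr (- q \<tau>)) \<in> borel_measurable lborel"
      using that by (simp add: of_real_powr_exp)
    show "AE \<tau> in lborel. norm (d \<tau> * of_real u powr (- q \<tau>)) \<le> norm (of_real (u powr (- Re q0)) * d \<tau>)"
      using that by (intro AE_I2) (simp add: norm_mult norm_of_real_powr Re_q)
  qed
  define M where "M = (y/2) powr (- Re q0 - 1) + (2*y) powr (- Re q0 - 1)"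
  have lim: "((\<lambda>u. \<integral>\<tau>. d \<tau> * ?D u \<tau> \<partial>lborel)
     \<longlongrightarrow> (\<integral>\<tau>. d \<tau> * ?L \<tau> \<partial>lborel)) (at y within ?S)"
    unfolding tendsto_at_iff_sequentially o_def
  proof (intro allI impI)
    fix X :: "nat \<Rightarrow> real" assume X: "\<forall>i. X i \<in> ?S - {y}" "X \<longlonglongrightarrow> y"
    have X0: "X i > 0" for i using X(1) y by (metis DiffD1 greaterThanLessThan_iff half_gt_zero less_trans)
    show "(\<lambda>i. \<integral>\<tau>. d \<tau> * ?D (X i) \<tau> \<partial>lborel)
       \<longlonglongrightarrow> (\<integral>\<tau>. d \<tau> * ?L \<tau> \<partial>lborel)"
    proof (rule integral_dominated_convergence[where w = "\<lambda>\<tau>. M * norm (d \<tau> * q \<tau>)"])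
      show "integrable lborel (\<lambda>\<tau>. M * norm (d \<tau> * q \<tau>))" using dq by simp
      show "(\<lambda>\<tau>. d \<tau> * ?L \<tau>) \<in> borel_measurable lborel"
        using y by (simp add: of_real_powr_exp)
      show "(\<lambda>\<tau>. d \<tau> * ?D (X i) \<tau>) \<in> borel_measurable lborel" for i
        using y X0[of i] by (simp add: of_real_powr_exp)
      show "AE \<tau> in lborel. norm (d \<tau> * ?D (X i) \<tau>) \<le> M * norm (d \<tau> * q \<tau>)" for i
      proof (rule AE_I2)
        fix \<tau>
        have Xi: "X i \<in> {y/2..2*y}" "X i \<noteq> y" using X(1) by (auto simp: less_imp_le)
        have "norm (of_real (X i) powr (- q \<tau>) - of_real y powr (- q \<tau>)) \<le> norm (q \<tau>) * M * \<bar>X i - y\<bar>"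
          using norm_powr_difference_le[OF y Xi(1), of y "q \<tau>"] y by (simp add: M_def Re_q)
        hence "norm (?D (X i) \<tau>) \<le> norm (q \<tau>) * M"
          using Xi(2) unfolding norm_divide norm_of_real by (subst pos_divide_le_eq) auto
        hence "norm (d \<tau>) * norm (?D (X i) \<tau>) \<le> norm (d \<tau>) * (norm (q \<tau>) * M)"
          by (rule mult_left_mono) simp
        thus "norm (d \<tau> * ?D (X i) \<tau>) \<le> M * norm (d \<tau> * q \<tau>)"
          by (simp only: norm_mult mult_ac)
      qed
      show "AE \<tau> in lborel. (\<lambda>i. d \<tau> * ?D (X i) \<tau>)
          \<longlonglongrightarrow> d \<tau> * ?L \<tau>"
      proof (rule AE_I2, rule tendsto_mult[OF tendsto_const])
        fix \<tau>
        have "((\<lambda>z. z powr (- q \<tau>)) has_field_derivative ?L \<tau>) (at (of_real y))"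
          using y by (auto intro!: derivative_eq_intros simp: complex_nonpos_Reals_iff)
        hence "((\<lambda>z. (z powr (- q \<tau>) - of_real y powr (- q \<tau>)) / (z - of_real y)) \<longlongrightarrow> ?L \<tau>) (at (of_real y))"
          by (simp add: has_field_derivative_iff)
        moreover have "filterlim (\<lambda>i. complex_of_real (X i)) (at (of_real y)) sequentially"
          using X by (intro filterlim_atI tendsto_of_real) auto
        ultimately show "(\<lambda>i. ?D (X i) \<tau>) \<longlonglongrightarrow> ?L \<tau>"
          by (auto dest: filterlim_compose)
      qed
    qed
  qed
  have val: "(\<integral>\<tau>. d \<tau> * ?L \<tau> \<partial>lborel) = - powers_integral (\<lambda>\<tau>. d \<tau> * q \<tau>) (q0 + 1) \<mu> y"
  proof -
    have "- q \<tau> - 1 = - (q0 + 1 - \<i> * of_real (\<mu> * \<tau>))" for \<tau> by (simp add: q_def)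
    hence "d \<tau> * ?L \<tau> =
        - (d \<tau> * q \<tau> * of_real y powr (- (q0 + 1 - \<i> * of_real (\<mu> * \<tau>))))" for \<tau>
      by (simp only: mult_minus_left mult_minus_right mult.assoc)
    thus ?thesis unfolding powers_integral_def by (simp only: integral_minus)
  qed
  have "((\<lambda>u. (powers_integral d q0 \<mu> u - powers_integral d q0 \<mu> y) /\<^sub>R (u - y)) \<longlongrightarrow> - powers_integral (\<lambda>\<tau>. d \<tau> * q \<tau>) (q0 + 1) \<mu> y) (at y within ?S)"
  proof (rule Lim_transform_eventually[OF lim[unfolded val]])
    have "\<forall>\<^sub>F u in at y within ?S. u \<in> ?S" by (simp add: eventually_at_filter)
    thus "\<forall>\<^sub>F u in at y within ?S. (\<integral>\<tau>. d \<tau> * ?D u \<tau> \<partial>lborel) =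
       (powers_integral d q0 \<mu> u - powers_integral d q0 \<mu> y) /\<^sub>R (u - y)"
    proof eventually_elim
      case (elim u)
      hence u: "u > 0" using y by (metis greaterThanLessThan_iff half_gt_zero less_trans)
      have "(powers_integral d q0 \<mu> u - powers_integral d q0 \<mu> y) = (\<integral>\<tau>. d \<tau> * of_real u powr (- q \<tau>) - d \<tau> * of_real y powr (- q \<tau>) \<partial>lborel)"
        unfolding powers_integral_def q_def [symmetric]
        using int[OF u] int[OF y] by (simp add: q_def)
      hence "(powers_integral d q0 \<mu> u - powers_integral d q0 \<mu> y) /\<^sub>R (u - y) = (\<integral>\<tau>. (d \<tau> * of_real u powr (- q \<tau>) - d \<tau> * of_real y powr (- q \<tau>)) / of_real (u - y) \<partial>lborel)"
        by (simp add: scaleR_conv_of_real divide_inverse mult.commute)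
      thus ?case by (simp add: right_diff_distrib diff_divide_distrib)
    qed
  qed
  also have "at y within ?S = at y" using y by (intro at_within_open) auto
  finally show ?thesis by (rule has_vector_derivative_quotientI)
qed

theorem neg_ddx_powers_integral:
  fixes d :: "real \<Rightarrow> complex" and q0 :: complex and \<mu> :: real
  assumes d: "\<And>j. j \<le> N \<Longrightarrow> integrable lborel (\<lambda>\<tau>. d \<tau> * pochhammer (q0 - \<i> * of_real (\<mu> * \<tau>)) j)"
    and g: "\<And>y. y > 0 \<Longrightarrow> g y = powers_integral d q0 \<mu> y"
    and j: "j \<le> N" and y: "y > 0"
  shows "(neg_ddx ^^ j) g y = powers_integral (\<lambda>\<tau>. d \<tau> * pochhammer (q0 - \<i> * of_real (\<mu> * \<tau>)) j) (q0 + of_nat j) \<mu> y"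
    and "j < N \<Longrightarrow> (neg_ddx ^^ j) g differentiable (at y)"
proof -
  define q where "q \<tau> = q0 - \<i> * of_real (\<mu> * \<tau>)" for \<tau>
  define G where "G j = powers_integral (\<lambda>\<tau>. d \<tau> * pochhammer (q \<tau>) j) (q0 + of_nat j) \<mu>" for j
  have G: "(G j has_vector_derivative - G (Suc j) y) (at y)" if "j < N" "y > 0" for j y
  proof -
    have e: "q0 + of_nat j - \<i> * of_real (\<mu> * \<tau>) = q \<tau> + of_nat j" for \<tau> by (simp add: q_def)
    have p: "d \<tau> * pochhammer (q \<tau>) j * (q \<tau> + of_nat j) = d \<tau> * pochhammer (q \<tau>) (Suc j)" for \<tau>
      by (simp add: pochhammer_Suc mult_ac)
    have "(powers_integral (\<lambda>\<tau>. d \<tau> * pochhammer (q \<tau>) j) (q0 + of_nat j) \<mu> has_vector_derivative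
        - powers_integral (\<lambda>\<tau>. d \<tau> * pochhammer (q \<tau>) j * (q0 + of_nat j - \<i> * of_real (\<mu> * \<tau>))) (q0 + of_nat j + 1) \<mu> y) (at y)"
    proof (rule powers_integral_has_vector_derivative)
      show "integrable lborel (\<lambda>\<tau>. d \<tau> * pochhammer (q \<tau>) j)"
        using d[of j] that by (simp add: q_def)
      show "integrable lborel (\<lambda>\<tau>. d \<tau> * pochhammer (q \<tau>) j * (q0 + of_nat j - \<i> * of_real (\<mu> * \<tau>)))"
        unfolding e p using d[of "Suc j"] that by (simp add: q_def)
    qed (use that in auto)
    thus ?thesis unfolding e p G_def by (simp add: add_ac)
  qed
  have open_pos: "open {0::real<..}" by simp
  have *: "j \<le> N \<Longrightarrow> \<forall>y>0. (neg_ddx ^^ j) g y = G j y" for j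
  proof (induction j)
    case 0
    thus ?case using g by (simp add: G_def)
  next
    case (Suc j)
    show ?case
    proof (intro allI impI)
      fix y :: real assume y: "y > 0"
      have "((neg_ddx ^^ j) g has_vector_derivative - G (Suc j) y) (at y)"
        by (rule has_vector_derivative_transform_within_open[OF G open_pos]) (use Suc y in auto)
      thus "(neg_ddx ^^ Suc j) g y = G (Suc j) y"
        by (simp add: neg_ddx_def vector_derivative_at)
    qed
  qed
  show "(neg_ddx ^^ j) g y = powers_integral (\<lambda>\<tau>. d \<tau> * pochhammer (q0 - \<i> * of_real (\<mu> * \<tau>)) j) (q0 + of_nat j) \<mu> y"
    using *[OF j] y by (simp add: G_def q_def)
  show "(neg_ddx ^^ j) g differentiable (at y)" if "j < N"
  proof -
    have "((neg_ddx ^^ j) g has_vector_derivative - G (Suc j) y) (at y)"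
      by (rule has_vector_derivative_transform_within_open[OF G open_pos]) (use *[OF j] that y in auto)
    thus ?thesis by (metis differentiableI_vector)
  qed
qed

section \<open>The gamma function on vertical lines\<close>

text \<open>
This is the logarithm of \<open>|t + iy|\<^sup>2 / t\<^sup>2\<close>, the square of a factor of the product for \<open>\<Gamma>(x) / |\<Gamma>(x + iy)|\<close>.
\<close>

lemma convex_on_log_ratio: "convex_on {0<..} (\<lambda>t::real. ln (1 + y\<^sup>2 / t\<^sup>2))"
proof -
  have pos: "t\<^sup>2 + y\<^sup>2 > 0" if "t > 0" for t :: real using that by (simp add: add_pos_nonneg)
  have "convex_on {0<..} (\<lambda>t. ln (t\<^sup>2 + y\<^sup>2) - 2 * ln t)"
  proof (rule f''_ge0_imp_convex[where f' = "\<lambda>t. 2 * t / (t\<^sup>2 + y\<^sup>2) - 2 / t"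
        and f'' = "\<lambda>t. 2 * (y\<^sup>2 - t\<^sup>2) / (t\<^sup>2 + y\<^sup>2)\<^sup>2 + 2 / t\<^sup>2"])
    fix t :: real assume "t \<in> {0<..}"
    hence t: "t > 0" by simp
    show "((\<lambda>t. ln (t\<^sup>2 + y\<^sup>2) - 2 * ln t) has_field_derivative 2 * t / (t\<^sup>2 + y\<^sup>2) - 2 / t) (at t)"
      using t pos[OF t] by (auto intro!: derivative_eq_intros simp: field_simps)
    show "((\<lambda>t. 2 * t / (t\<^sup>2 + y\<^sup>2) - 2 / t) has_field_derivative 2 * (y\<^sup>2 - t\<^sup>2) / (t\<^sup>2 + y\<^sup>2)\<^sup>2 + 2 / t\<^sup>2) (at t)"
    proof -
      have "((\<lambda>t. 2 * t / (t\<^sup>2 + y\<^sup>2)) has_field_derivative (2 * (t\<^sup>2 + y\<^sup>2) - 2 * t * (2 * t)) / ((t\<^sup>2 + y\<^sup>2) * (t\<^sup>2 + y\<^sup>2))) (at t)"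
        using pos[OF t] by (auto intro!: derivative_eq_intros)
      moreover have "((\<lambda>t. 2 / t) has_field_derivative - 2 / t\<^sup>2) (at t)"
        using t by (auto intro!: derivative_eq_intros simp: power2_eq_square)
      ultimately have "((\<lambda>t. 2 * t / (t\<^sup>2 + y\<^sup>2) - 2 / t) has_field_derivative
          (2 * (t\<^sup>2 + y\<^sup>2) - 2 * t * (2 * t)) / ((t\<^sup>2 + y\<^sup>2) * (t\<^sup>2 + y\<^sup>2)) - (- 2 / t\<^sup>2)) (at t)"
        by (rule DERIV_diff)
      moreover have "(2 * (t\<^sup>2 + y\<^sup>2) - 2 * t * (2 * t)) / ((t\<^sup>2 + y\<^sup>2) * (t\<^sup>2 + y\<^sup>2)) = 2 * (y\<^sup>2 - t\<^sup>2) / (t\<^sup>2 + y\<^sup>2)\<^sup>2"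
        by (simp add: power2_eq_square algebra_simps)
      ultimately show ?thesis by simp
    qed
    have "2 * (y\<^sup>2 - t\<^sup>2) / (t\<^sup>2 + y\<^sup>2)\<^sup>2 + 2 / t\<^sup>2 = (2 * (y\<^sup>2 - t\<^sup>2) * t\<^sup>2 + 2 * (t\<^sup>2 + y\<^sup>2)\<^sup>2) / ((t\<^sup>2 + y\<^sup>2)\<^sup>2 * t\<^sup>2)"
      using t pos[OF t] by (simp add: add_frac_eq)
    also have "2 * (y\<^sup>2 - t\<^sup>2) * t\<^sup>2 + 2 * (t\<^sup>2 + y\<^sup>2)\<^sup>2 = 6 * t\<^sup>2 * y\<^sup>2 + 2 * (y\<^sup>2)\<^sup>2"
      by (simp add: power2_eq_square algebra_simps)
    also have "\<dots> / ((t\<^sup>2 + y\<^sup>2)\<^sup>2 * t\<^sup>2) \<ge> 0" by simp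
    finally show "2 * (y\<^sup>2 - t\<^sup>2) / (t\<^sup>2 + y\<^sup>2)\<^sup>2 + 2 / t\<^sup>2 \<ge> 0" .
  qed auto
  moreover have "ln (t\<^sup>2 + y\<^sup>2) - 2 * ln t = ln (1 + y\<^sup>2 / t\<^sup>2)" if "t \<in> {0<..}" for t
  proof -
    have t: "t > 0" using that by simp
    have "1 + y\<^sup>2 / t\<^sup>2 = (t\<^sup>2 + y\<^sup>2) / t\<^sup>2" using t by (simp add: field_simps)
    thus ?thesis using t pos[OF t] by (simp add: ln_div ln_realpow)
  qed
  ultimately show ?thesis
  proof -
    assume cv: "convex_on {0<..} (\<lambda>t. ln (t\<^sup>2 + y\<^sup>2) - 2 * ln t)"
      and eq: "\<And>t. t \<in> {0<..} \<Longrightarrow> ln (t\<^sup>2 + y\<^sup>2) - 2 * ln t = ln (1 + y\<^sup>2 / t\<^sup>2)"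
    show ?thesis
    proof (rule convex_onI)
      fix l a b :: real assume *: "0 < l" "l < 1" "a \<in> {0<..}" "b \<in> {0<..}"
      have "(1 - l) *\<^sub>R a + l *\<^sub>R b \<in> {0<..}" using * by (simp add: add_pos_pos)
      with convex_onD[OF cv, of l a b] * show "ln (1 + y\<^sup>2 / ((1 - l) *\<^sub>R a + l *\<^sub>R b)\<^sup>2) \<le> (1 - l) * ln (1 + y\<^sup>2 / a\<^sup>2) + l * ln (1 + y\<^sup>2 / b\<^sup>2)"
        by (simp only: eq)
    qed simp
  qed
qed

text \<open>
For \<open>x > 0\<close> this is \<open>\<Gamma>(x) / |\<Gamma>(x + iy)|\<close>, an infinite product with factors \<open>|x + k + iy| / (x + k)\<close>.
\<close>

definition rGamma_quotient :: "real \<Rightarrow> real \<Rightarrow> real" where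
  "rGamma_quotient x y = norm (rGamma (Complex x y)) / rGamma x"

text \<open>
Take the quotient of Gauss's products for \<open>1/\<Gamma>\<close> at \<open>x + iy\<close> and at \<open>x\<close>; the powers of \<open>n\<close> have equal modulus.
\<close>

lemma rGamma_quotient_limit:
  assumes x: "x > 0"
  shows "(\<lambda>n. exp ((\<Sum>k<Suc n. ln (1 + y\<^sup>2 / (x + real k)\<^sup>2)) / 2)) \<longlonglongrightarrow> rGamma_quotient x y"
proof -
  have r0: "rGamma x > 0" using x by (simp add: rGamma_inverse_Gamma)
  have "(\<lambda>n. norm (rGamma_series (Complex x y) n) / rGamma_series x n) \<longlonglongrightarrow> rGamma_quotient x y"
    unfolding rGamma_quotient_def using r0 by (intro tendsto_intros) auto
  moreover have "\<forall>\<^sub>F n in sequentially. norm (rGamma_series (Complex x y) n) / rGamma_series x n =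
      exp ((\<Sum>k<Suc n. ln (1 + y\<^sup>2 / (x + real k)\<^sup>2)) / 2)"
    using eventually_gt_at_top[of 0]
  proof eventually_elim
    case (elim n)
    have p: "norm (Complex x y + of_nat k) / (x + real k) = exp (ln (1 + y\<^sup>2 / (x + real k)\<^sup>2) / 2)" for k
    proof -
      define t where "t = x + real k"
      have t: "t > 0" using x by (simp add: t_def)
      have "Complex x y + of_nat k = Complex t y" by (simp add: t_def complex_eq_iff)
      hence "norm (Complex x y + of_nat k) / t = sqrt (t\<^sup>2 + y\<^sup>2) / t" by (simp add: cmod_def)
      also have "\<dots> = sqrt (1 + y\<^sup>2 / t\<^sup>2)"
      proof -
        have "1 + y\<^sup>2 / t\<^sup>2 = (t\<^sup>2 + y\<^sup>2) / t\<^sup>2" using t by (simp add: field_simps)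
        thus ?thesis using t by (simp add: real_sqrt_divide)
      qed
      also have "\<dots> = exp (ln (1 + y\<^sup>2 / t\<^sup>2) / 2)"
      proof -
        have "1 + y\<^sup>2 / t\<^sup>2 > 0" by (simp add: add_pos_nonneg)
        thus ?thesis by (simp add: powr_half_sqrt [symmetric] powr_def)
      qed
      finally show ?thesis by (simp add: t_def)
    qed
    have e: "norm (exp (Complex x y * of_real (ln (real n)))) = exp (x * ln (real n))"
      by (simp add: Complex_eq)
    have "norm (rGamma_series (Complex x y) n) / rGamma_series x n = norm (pochhammer (Complex x y) (Suc n)) / pochhammer x (Suc n)"
      using pochhammer_pos[OF x, of "Suc n"] by (simp add: rGamma_series_def norm_divide norm_mult e del: pochhammer_Suc)
    also have "\<dots> = (\<Prod>k<Suc n. norm (Complex x y + of_nat k) / (x + real k))"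
      by (simp only: pochhammer_prod prod_norm [symmetric] prod_dividef atLeast0LessThan)
    also have "\<dots> = exp (\<Sum>k<Suc n. ln (1 + y\<^sup>2 / (x + real k)\<^sup>2) / 2)"
      unfolding p by (simp only: exp_sum finite_lessThan)
    finally show ?case by (simp only: sum_divide_distrib)
  qed
  ultimately show ?thesis by (rule Lim_transform_eventually)
qed

lemma rGamma_quotient_log_convex:
  assumes l: "0 \<le> l" "l \<le> 1"
  shows "rGamma_quotient (1/2 + l) y \<le> rGamma_quotient (1/2) y powr (1 - l) * rGamma_quotient (3/2) y powr l"
proof -
  define s where "s x n = (\<Sum>k<Suc n. ln (1 + y\<^sup>2 / (x + real k)\<^sup>2)) / 2" for x n
  have pos: "rGamma_quotient x y > 0" if "x > 0" for x
  proof -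
    have "rGamma x > 0" using that by (simp add: rGamma_inverse_Gamma)
    moreover have "rGamma (Complex x y) \<noteq> 0"
      using that Re_pos_not_nonpos_Int[of "Complex x y"] by (simp add: rGamma_eq_zero_iff)
    ultimately show ?thesis by (simp add: rGamma_quotient_def)
  qed
  show ?thesis
  proof (rule tendsto_le)
    show "(\<lambda>n. exp (s (1/2 + l) n)) \<longlonglongrightarrow> rGamma_quotient (1/2 + l) y"
      unfolding s_def using l by (intro rGamma_quotient_limit) auto
    show "(\<lambda>n. exp (s (1/2) n) powr (1 - l) * exp (s (3/2) n) powr l) \<longlonglongrightarrow> rGamma_quotient (1/2) y powr (1 - l) * rGamma_quotient (3/2) y powr l"
      unfolding s_def using pos[of "1/2"] pos[of "3/2"]
      by (intro tendsto_mult tendsto_powr tendsto_const rGamma_quotient_limit) auto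
    show "\<forall>\<^sub>F n in sequentially. exp (s (1/2 + l) n) \<le> exp (s (1/2) n) powr (1 - l) * exp (s (3/2) n) powr l"
    proof (rule always_eventually, rule allI)
      fix n
      have "s (1/2 + l) n \<le> (1 - l) * s (1/2) n + l * s (3/2) n"
      proof -
        have "ln (1 + y\<^sup>2 / (1/2 + l + real k)\<^sup>2) \<le> (1 - l) * ln (1 + y\<^sup>2 / (1/2 + real k)\<^sup>2) + l * ln (1 + y\<^sup>2 / (3/2 + real k)\<^sup>2)" for k
        proof -
          have "(1 - l) *\<^sub>R (1/2 + real k) + l *\<^sub>R (3/2 + real k) = 1/2 + l + real k" by (simp add: field_simps)
          thus ?thesis
            using convex_onD[OF convex_on_log_ratio[of y] l, of "1/2 + real k" "3/2 + real k"] by simp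
        qed
        hence "(\<Sum>k<Suc n. ln (1 + y\<^sup>2 / (1/2 + l + real k)\<^sup>2)) \<le>
           (\<Sum>k<Suc n. (1 - l) * ln (1 + y\<^sup>2 / (1/2 + real k)\<^sup>2) + l * ln (1 + y\<^sup>2 / (3/2 + real k)\<^sup>2))"
          by (intro sum_mono)
        also have "\<dots> = (1 - l) * (\<Sum>k<Suc n. ln (1 + y\<^sup>2 / (1/2 + real k)\<^sup>2)) + l * (\<Sum>k<Suc n. ln (1 + y\<^sup>2 / (3/2 + real k)\<^sup>2))"
          by (simp only: sum.distrib sum_distrib_left)
        finally show ?thesis by (simp add: s_def field_simps del: sum.lessThan_Suc)
      qed
      thus "exp (s (1/2 + l) n) \<le> exp (s (1/2) n) powr (1 - l) * exp (s (3/2) n) powr l"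
        by (simp add: powr_def exp_add [symmetric])
    qed
  qed auto
qed

text \<open>
On this line \<open>1 - z\<close> is the conjugate of \<open>z\<close>, so the reflection formula evaluates \<open>|1/\<Gamma>(z)|\<^sup>2\<close> as \<open>cosh (\<pi> y) / \<pi>\<close>.
\<close>

lemma norm_rGamma_half_line: "norm (rGamma (Complex (1/2) y)) \<le> exp (pi * \<bar>y\<bar> / 2)"
proof -
  let ?z = "Complex (1/2) y"
  have "1 - ?z = cnj ?z" by (simp add: complex_eq_iff)
  hence "norm (rGamma (1 - ?z)) = norm (rGamma ?z)" by (simp add: cnj_rGamma [symmetric])
  hence "(norm (rGamma ?z))\<^sup>2 = norm (rGamma ?z * rGamma (1 - ?z))"
    by (simp add: norm_mult power2_eq_square)
  also have "\<dots> = norm (sin (of_real pi * ?z)) / pi"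
    by (subst rGamma_reflection_complex) (simp add: norm_divide)
  also have "of_real pi * ?z = of_real (pi / 2) - (- \<i> * of_real (pi * y))"
    by (simp add: complex_eq_iff)
  also have "sin \<dots> = cos (- \<i> * of_real (pi * y))"
    by (simp only: sin_diff sin_of_real cos_of_real) simp
  also have "norm \<dots> \<le> exp (norm (- \<i> * complex_of_real (pi * y)))" by (rule norm_cos_le)
  also have "norm (- \<i> * complex_of_real (pi * y)) = pi * \<bar>y\<bar>" by (simp add: norm_mult abs_mult)
  finally have "(norm (rGamma ?z))\<^sup>2 \<le> exp (pi * \<bar>y\<bar>) / pi" by (simp add: divide_right_mono)
  also have "\<dots> \<le> exp (pi * \<bar>y\<bar>)" using pi_gt3 by (simp add: divide_le_eq)
  also have "\<dots> = (exp (pi * \<bar>y\<bar> / 2))\<^sup>2" by (simp flip: exp_double)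
  finally show ?thesis by (rule power2_le_imp_le) simp
qed

lemma norm_ge_one_plus_abs_Im:
  assumes "Re z \<ge> 1/2"
  shows "norm z \<ge> (1 + \<bar>Im z\<bar>) / 4"
  using assms abs_Re_le_cmod[of z] abs_Im_le_cmod[of z] abs_ge_self[of "Re z"]
  by (simp add: field_simps)


text \<open>
The growth of gamma factors along the line, in a form in which both exponents add up under multiplication.
\<close>

definition line_bound :: "(real \<Rightarrow> complex) \<Rightarrow> real \<Rightarrow> real \<Rightarrow> bool" where
  "line_bound f e d \<longleftrightarrow> (\<exists>C>0. \<forall>\<tau>. norm (f \<tau>) \<le> C * (1 + \<bar>\<tau>\<bar>) powr e * exp (- d * \<bar>\<tau>\<bar>))"

lemma line_bound_mult:
  assumes "line_bound f e d" "line_bound g e' d'"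
  shows "line_bound (\<lambda>\<tau>. f \<tau> * g \<tau>) (e + e') (d + d')"
proof -
  obtain C D where C: "C > 0" "\<And>\<tau>. norm (f \<tau>) \<le> C * (1 + \<bar>\<tau>\<bar>) powr e * exp (- d * \<bar>\<tau>\<bar>)"
    and D: "D > 0" "\<And>\<tau>. norm (g \<tau>) \<le> D * (1 + \<bar>\<tau>\<bar>) powr e' * exp (- d' * \<bar>\<tau>\<bar>)"
    using assms unfolding line_bound_def by blast
  have "norm (f \<tau> * g \<tau>) \<le> C * D * (1 + \<bar>\<tau>\<bar>) powr (e + e') * exp (- (d + d') * \<bar>\<tau>\<bar>)" for \<tau>
  proof -
    have "norm (f \<tau> * g \<tau>) \<le> (C * (1 + \<bar>\<tau>\<bar>) powr e * exp (- d * \<bar>\<tau>\<bar>)) * (D * (1 + \<bar>\<tau>\<bar>) powr e' * exp (- d' * \<bar>\<tau>\<bar>))"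
      unfolding norm_mult using C(1) by (intro mult_mono C D) auto
    also have "\<dots> = C * D * ((1 + \<bar>\<tau>\<bar>) powr e * (1 + \<bar>\<tau>\<bar>) powr e') * (exp (- d * \<bar>\<tau>\<bar>) * exp (- d' * \<bar>\<tau>\<bar>))"
      by (simp only: mult_ac)
    also have "\<dots> = C * D * (1 + \<bar>\<tau>\<bar>) powr (e + e') * exp (- (d + d') * \<bar>\<tau>\<bar>)"
      unfolding powr_add [symmetric] exp_add [symmetric] by (simp add: algebra_simps)
    finally show ?thesis .
  qed
  thus ?thesis unfolding line_bound_def using C(1) D(1) by (intro exI[of _ "C * D"]) auto
qed

lemma line_bound_prod:
  assumes "finite I" "\<And>i. i \<in> I \<Longrightarrow> line_bound (f i) (e i) (d i)"
  shows "line_bound (\<lambda>\<tau>. \<Prod>i\<in>I. f i \<tau>) (\<Sum>i\<in>I. e i) (\<Sum>i\<in>I. d i)"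
  using assms
proof (induction I)
  case empty
  thus ?case unfolding line_bound_def by (intro exI[of _ 1]) auto
next
  case (insert i I)
  thus ?case using line_bound_mult[of "f i" "e i" "d i"] by simp
qed

lemma line_bound_powr:
  assumes "line_bound f e d" "\<kappa> > 0" "\<And>\<tau>. norm (g \<tau>) = norm (f \<tau>) powr \<kappa>"
  shows "line_bound g (\<kappa> * e) (\<kappa> * d)"
proof -
  obtain C where C: "C > 0" "\<And>\<tau>. norm (f \<tau>) \<le> C * (1 + \<bar>\<tau>\<bar>) powr e * exp (- d * \<bar>\<tau>\<bar>)"
    using assms unfolding line_bound_def by blast
  have "norm (g \<tau>) \<le> C powr \<kappa> * (1 + \<bar>\<tau>\<bar>) powr (\<kappa> * e) * exp (- (\<kappa> * d) * \<bar>\<tau>\<bar>)" for \<tau>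
  proof -
    have "norm (g \<tau>) \<le> (C * (1 + \<bar>\<tau>\<bar>) powr e * exp (- d * \<bar>\<tau>\<bar>)) powr \<kappa>"
      unfolding assms(3) using assms(2) by (intro powr_mono2 C) auto
    also have "\<dots> = C powr \<kappa> * ((1 + \<bar>\<tau>\<bar>) powr e) powr \<kappa> * exp (- d * \<bar>\<tau>\<bar>) powr \<kappa>"
      using C(1) by (simp add: powr_mult)
    also have "\<dots> = C powr \<kappa> * (1 + \<bar>\<tau>\<bar>) powr (\<kappa> * e) * exp (- (\<kappa> * d) * \<bar>\<tau>\<bar>)"
      by (simp add: powr_powr mult_ac exp_powr_real)
    finally show ?thesis .
  qed
  thus ?thesis unfolding line_bound_def using C(1) by (intro exI[of _ "C powr \<kappa>"]) auto
qed

text \<open>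
The exponents at the two ends of the strip are \<open>0\<close> and \<open>-1\<close>; log-convexity interpolates between them.
\<close>

lemma line_bound_rGamma_strip:
  assumes l: "0 \<le> l" "l \<le> 1"
  shows "line_bound (\<lambda>y. rGamma (Complex (1/2 + l) y)) (1/2 - (1/2 + l)) (- (pi / 2))"
proof -
  define c1 c3 c where "c1 = rGamma (1/2 :: real)" and "c3 = rGamma (3/2 :: real)" and "c = rGamma (1/2 + l)"
  have cpos: "c1 > 0" "c3 > 0" "c > 0" using l by (auto simp: c1_def c3_def c_def rGamma_inverse_Gamma)
  define K where "K = c * (1 / c1) powr (1 - l) * (4 / c3) powr l"
  have "norm (rGamma (Complex (1/2 + l) y)) \<le> K * (1 + \<bar>y\<bar>) powr (1/2 - (1/2 + l)) * exp (- (- (pi / 2)) * \<bar>y\<bar>)" for y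
  proof -
    define E where "E = exp (pi * \<bar>y\<bar> / 2)"
    have q1: "rGamma_quotient (1/2) y \<le> 1 / c1 * E"
      unfolding rGamma_quotient_def c1_def [symmetric] E_def using norm_rGamma_half_line[of y] cpos
      by (simp add: divide_right_mono)
    have q3: "rGamma_quotient (3/2) y \<le> 4 / c3 * (E / (1 + \<bar>y\<bar>))"
    proof -
      have z: "Complex (1/2) y + 1 = Complex (3/2) y" by (simp add: complex_eq_iff)
      have "rGamma (Complex (1/2) y) = Complex (1/2) y * rGamma (Complex (3/2) y)"
        using rGamma_plus1[of "Complex (1/2) y"] by (simp add: z)
      hence "norm (Complex (1/2) y) * norm (rGamma (Complex (3/2) y)) \<le> E"
        using norm_rGamma_half_line[of y] by (simp add: norm_mult E_def)
      moreover have "(1 + \<bar>y\<bar>) / 4 * norm (rGamma (Complex (3/2) y)) \<le> norm (Complex (1/2) y) * norm (rGamma (Complex (3/2) y))"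
        using norm_ge_one_plus_abs_Im[of "Complex (1/2) y"] by (intro mult_right_mono) auto
      ultimately have "(1 + \<bar>y\<bar>) * norm (rGamma (Complex (3/2) y)) \<le> 4 * E" by simp
      hence "norm (rGamma (Complex (3/2) y)) \<le> 4 * (E / (1 + \<bar>y\<bar>))" by (simp add: field_simps)
      hence "norm (rGamma (Complex (3/2) y)) / c3 \<le> 4 * (E / (1 + \<bar>y\<bar>)) / c3"
        using cpos by (intro divide_right_mono) auto
      thus ?thesis by (simp add: rGamma_quotient_def c3_def mult.commute)
    qed
    have nn: "rGamma_quotient (1/2) y \<ge> 0" "rGamma_quotient (3/2) y \<ge> 0"
      unfolding rGamma_quotient_def c1_def[symmetric] c3_def[symmetric] using cpos by auto
    have "norm (rGamma (Complex (1/2 + l) y)) = c * rGamma_quotient (1/2 + l) y"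
      using cpos by (simp add: rGamma_quotient_def c_def)
    also have "\<dots> \<le> c * (rGamma_quotient (1/2) y powr (1 - l) * rGamma_quotient (3/2) y powr l)"
      using cpos by (intro mult_left_mono rGamma_quotient_log_convex l) auto
    also have "\<dots> \<le> c * ((1 / c1 * E) powr (1 - l) * (4 / c3 * (E / (1 + \<bar>y\<bar>))) powr l)"
      using cpos l nn by (intro mult_left_mono mult_mono powr_mono2 q1 q3) auto
    also have "(1 / c1 * E) powr (1 - l) = (1 / c1) powr (1 - l) * E powr (1 - l)"
      by (rule powr_mult)
    also have "(4 / c3 * (E / (1 + \<bar>y\<bar>))) powr l = (4 / c3) powr l * (E powr l / (1 + \<bar>y\<bar>) powr l)"
      using cpos by (subst powr_mult) (auto simp: E_def powr_divide)
    also have "c * ((1 / c1) powr (1 - l) * E powr (1 - l) * ((4 / c3) powr l * (E powr l / (1 + \<bar>y\<bar>) powr l))) =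
        K * ((1 + \<bar>y\<bar>) powr (- l)) * (E powr (1 - l) * E powr l)"
      by (simp add: K_def powr_minus divide_inverse mult_ac)
    also have "E powr (1 - l) * E powr l = E" by (subst powr_add [symmetric]) (simp add: E_def)
    finally show ?thesis by (simp add: E_def)
  qed
  moreover have "K > 0" using cpos by (simp add: K_def)
  ultimately show ?thesis unfolding line_bound_def by blast
qed

text \<open>
\<open>1/\<Gamma>(z - 1) = (z - 1)/\<Gamma>(z)\<close>, and \<open>z - 1\<close> grows linearly.
\<close>

lemma line_bound_rGamma_left:
  assumes "line_bound (\<lambda>y. rGamma (Complex x y)) (1/2 - x) d"
  shows "line_bound (\<lambda>y. rGamma (Complex (x - 1) y)) (1/2 - (x - 1)) d"
proof -
  have "line_bound (Complex (x - 1)) 1 0" unfolding line_bound_def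
  proof (intro exI[of _ "1 + \<bar>x - 1\<bar>"] conjI allI)
    fix y
    have "(1 + \<bar>x - 1\<bar>) * (1 + \<bar>y\<bar>) = 1 + \<bar>y\<bar> + \<bar>x - 1\<bar> + \<bar>x - 1\<bar> * \<bar>y\<bar>" by (simp add: algebra_simps)
    moreover have "0 \<le> \<bar>x - 1\<bar> * \<bar>y\<bar>" by simp
    moreover have "norm (Complex (x - 1) y) \<le> \<bar>x - 1\<bar> + \<bar>y\<bar>" using cmod_le[of "Complex (x - 1) y"] by simp
    ultimately have "norm (Complex (x - 1) y) \<le> (1 + \<bar>x - 1\<bar>) * (1 + \<bar>y\<bar>)" by linarith
    thus "norm (Complex (x - 1) y) \<le> (1 + \<bar>x - 1\<bar>) * (1 + \<bar>y\<bar>) powr 1 * exp (- 0 * \<bar>y\<bar>)"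
      by simp
  qed simp
  from line_bound_mult[OF this assms]
  have "line_bound (\<lambda>y. Complex (x - 1) y * rGamma (Complex x y)) (1/2 - (x - 1)) d" by (simp add: algebra_simps)
  moreover have "Complex (x - 1) y * rGamma (Complex x y) = rGamma (Complex (x - 1) y)" for y
    using rGamma_plus1[of "Complex (x - 1) y"] by (simp add: plus_complex.code one_complex.code)
  ultimately show ?thesis by simp
qed

text \<open>
\<open>1/\<Gamma>(z + 1) = 1/(z \<Gamma>(z))\<close>; to the right of \<open>1/2\<close> the factor \<open>1/z\<close> is bounded and decays like \<open>1/|y|\<close>.
\<close>

lemma line_bound_rGamma_right:
  assumes "line_bound (\<lambda>y. rGamma (Complex x y)) (1/2 - x) d" and x: "x \<ge> 1/2"
  shows "line_bound (\<lambda>y. rGamma (Complex (x + 1) y)) (1/2 - (x + 1)) d"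
proof -
  have nz: "Complex x y \<noteq> 0" for y using x by (auto simp: complex_eq_iff)
  have "line_bound (\<lambda>y. inverse (Complex x y)) (- 1) 0" unfolding line_bound_def
  proof (intro exI[of _ 4] conjI allI)
    fix y
    have "inverse (norm (Complex x y)) \<le> inverse ((1 + \<bar>y\<bar>) / 4)"
      using norm_ge_one_plus_abs_Im[of "Complex x y"] x by (intro le_imp_inverse_le) auto
    thus "norm (inverse (Complex x y)) \<le> 4 * (1 + \<bar>y\<bar>) powr (- 1) * exp (- 0 * \<bar>y\<bar>)"
      by (simp add: norm_inverse powr_neg_one)
  qed simp
  moreover have "- 1 + (1/2 - x) = 1/2 - (x + 1)" by simp
  ultimately have "line_bound (\<lambda>y. inverse (Complex x y) * rGamma (Complex x y)) (1/2 - (x + 1)) d"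
    using line_bound_mult[OF _ assms(1), of "\<lambda>y. inverse (Complex x y)" "- 1" 0] by simp
  moreover have "inverse (Complex x y) * rGamma (Complex x y) = rGamma (Complex (x + 1) y)" for y
    using rGamma_plus1[of "Complex x y"] nz[of y] by (simp add: plus_complex.code one_complex.code field_simps)
  ultimately show ?thesis by simp
qed

text \<open>
The upper bound for \<open>1/\<Gamma>\<close> that Stirling's formula predicts, in a form valid for all \<open>y\<close>.  Every vertical line
is reached from the strip by integer translations.
\<close>

theorem line_bound_rGamma_Complex: "line_bound (\<lambda>y. rGamma (Complex x y)) (1/2 - x) (- (pi / 2))"
proof -
  let ?P = "\<lambda>x. line_bound (\<lambda>y. rGamma (Complex x y)) (1/2 - x) (- (pi / 2))"
  have R: "?P (x0 + real n)" if "1/2 \<le> x0" "x0 \<le> 3/2" for x0 n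
  proof (induction n)
    case 0
    thus ?case using line_bound_rGamma_strip[of "x0 - 1/2"] that by simp
  next
    case (Suc n)
    thus ?case using line_bound_rGamma_right[of "x0 + real n"] that by (simp add: add_ac)
  qed
  have L: "?P (x0 - real n)" if "1/2 \<le> x0" "x0 \<le> 3/2" for x0 n
  proof (induction n)
    case 0
    thus ?case using R[OF that, of 0] by simp
  next
    case (Suc n)
    thus ?case using line_bound_rGamma_left[of "x0 - real n"] by (simp add: algebra_simps)
  qed
  define k where "k = \<lfloor>x - 1/2\<rfloor>"
  have x0: "1/2 \<le> x - of_int k" "x - of_int k \<le> 3/2" unfolding k_def by linarith+
  show ?thesis
  proof (cases "k \<ge> 0")
    case True
    thus ?thesis using R[OF x0, of "nat k"] by simp
  next
    case False
    thus ?thesis using L[OF x0, of "nat (- k)"] by simp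
  qed
qed

lemma one_plus_abs_affine_le: "1 + \<bar>w + v * \<tau>\<bar> \<le> (1 + \<bar>w\<bar> + \<bar>v\<bar>) * (1 + \<bar>\<tau>\<bar>)" for w v \<tau> :: real
proof -
  have "\<bar>w + v * \<tau>\<bar> \<le> \<bar>w\<bar> + \<bar>v\<bar> * \<bar>\<tau>\<bar>" using abs_triangle_ineq[of w "v * \<tau>"] by (simp add: abs_mult)
  moreover have "0 \<le> \<bar>w\<bar> * \<bar>\<tau>\<bar>" by simp
  moreover have "(1 + \<bar>w\<bar> + \<bar>v\<bar>) * (1 + \<bar>\<tau>\<bar>) = 1 + \<bar>w\<bar> + \<bar>v\<bar> + \<bar>\<tau>\<bar> + \<bar>w\<bar> * \<bar>\<tau>\<bar> + \<bar>v\<bar> * \<bar>\<tau>\<bar>" by (simp add: algebra_simps)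
  ultimately show ?thesis by linarith
qed

text \<open>
The quotient of \<open>1 + |w + v \<tau>|\<close> and \<open>1 + |\<tau>|\<close> is bounded above and below; which of the two bounds matters depends on
the sign of \<open>e\<close>.  The lower one is the upper one for the inverse affine map.
\<close>

lemma powr_affine_bound:
  fixes v w e :: real
  assumes v: "v \<noteq> 0"
  obtains K where "K > 0" "\<And>\<tau>. (1 + \<bar>w + v * \<tau>\<bar>) powr e \<le> K * (1 + \<bar>\<tau>\<bar>) powr e"
proof (cases "e \<ge> 0")
  case True
  show ?thesis
  proof (rule that)
    show "(1 + \<bar>w\<bar> + \<bar>v\<bar>) powr e > 0" by (simp add: add_pos_nonneg)
    show "(1 + \<bar>w + v * \<tau>\<bar>) powr e \<le> (1 + \<bar>w\<bar> + \<bar>v\<bar>) powr e * (1 + \<bar>\<tau>\<bar>) powr e" for \<tau>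
      unfolding powr_mult [symmetric] using True by (intro powr_mono2 one_plus_abs_affine_le) auto
  qed
next
  case False
  define B where "B = 1 + \<bar>- w / v\<bar> + \<bar>1 / v\<bar>"
  have B: "B > 0" by (simp add: B_def add_pos_nonneg)
  show ?thesis
  proof (rule that)
    show "B powr (- e) > 0" using B by simp
    fix \<tau>
    have "- w / v + 1 / v * (w + v * \<tau>) = \<tau>" using v by (simp add: field_simps)
    hence "1 + \<bar>\<tau>\<bar> \<le> B * (1 + \<bar>w + v * \<tau>\<bar>)"
      unfolding B_def using one_plus_abs_affine_le[of "- w / v" "1 / v" "w + v * \<tau>"] by simp
    hence "(B * (1 + \<bar>w + v * \<tau>\<bar>)) powr e \<le> (1 + \<bar>\<tau>\<bar>) powr e" using False by (intro powr_mono2') auto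
    hence "B powr e * (1 + \<bar>w + v * \<tau>\<bar>) powr e \<le> (1 + \<bar>\<tau>\<bar>) powr e" by (simp only: powr_mult)
    thus "(1 + \<bar>w + v * \<tau>\<bar>) powr e \<le> B powr (- e) * (1 + \<bar>\<tau>\<bar>) powr e"
      using B by (simp add: powr_minus field_simps)
  qed
qed

lemma line_bound_affine:
  assumes f: "line_bound f e d" and v: "v \<noteq> 0"
  shows "line_bound (\<lambda>\<tau>. f (w + v * \<tau>)) e (d * \<bar>v\<bar>)"
proof -
  obtain C where C: "C > 0" "\<And>\<tau>. norm (f \<tau>) \<le> C * (1 + \<bar>\<tau>\<bar>) powr e * exp (- d * \<bar>\<tau>\<bar>)"
    using f unfolding line_bound_def by blast
  obtain K where K: "K > 0" "\<And>\<tau>. (1 + \<bar>w + v * \<tau>\<bar>) powr e \<le> K * (1 + \<bar>\<tau>\<bar>) powr e"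
    using powr_affine_bound[OF v] by blast
  have "norm (f (w + v * \<tau>)) \<le> (C * K * exp (\<bar>d\<bar> * \<bar>w\<bar>)) * (1 + \<bar>\<tau>\<bar>) powr e * exp (- (d * \<bar>v\<bar>) * \<bar>\<tau>\<bar>)" for \<tau>
  proof -
    have "\<bar>d * (\<bar>w + v * \<tau>\<bar> - \<bar>v * \<tau>\<bar>)\<bar> \<le> \<bar>d\<bar> * \<bar>w\<bar>"
      unfolding abs_mult[of d] by (intro mult_left_mono) auto
    hence "- (d * (\<bar>w + v * \<tau>\<bar> - \<bar>v * \<tau>\<bar>)) \<le> \<bar>d\<bar> * \<bar>w\<bar>" by linarith
    hence "exp (- d * \<bar>w + v * \<tau>\<bar>) \<le> exp (\<bar>d\<bar> * \<bar>w\<bar> + - (d * \<bar>v\<bar>) * \<bar>\<tau>\<bar>)"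
      by (simp add: algebra_simps abs_mult)
    hence "C * (1 + \<bar>w + v * \<tau>\<bar>) powr e * exp (- d * \<bar>w + v * \<tau>\<bar>) \<le> C * (K * (1 + \<bar>\<tau>\<bar>) powr e) * exp (\<bar>d\<bar> * \<bar>w\<bar> + - (d * \<bar>v\<bar>) * \<bar>\<tau>\<bar>)"
      using C(1) K by (intro mult_mono) auto
    with C(2)[of "w + v * \<tau>"] show ?thesis by (simp only: exp_add mult_ac)
  qed
  thus ?thesis unfolding line_bound_def using C(1) K(1) by (intro exI[of _ "C * K * exp (\<bar>d\<bar> * \<bar>w\<bar>)"]) auto
qed

lemma line_bound_rGamma:
  assumes v: "v \<noteq> 0"
  shows "line_bound (\<lambda>\<tau>. rGamma (u + of_real v * (\<i> * of_real \<tau>))) (1/2 - Re u) (- (pi / 2 * \<bar>v\<bar>))"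
proof -
  have "u + of_real v * (\<i> * of_real \<tau>) = Complex (Re u) (Im u + v * \<tau>)" for \<tau> by (simp add: complex_eq_iff)
  with line_bound_affine[OF line_bound_rGamma_Complex[of "Re u"] v, of "Im u"] show ?thesis by simp
qed

lemma norm_sin_ge:
  fixes z :: complex
  assumes "\<bar>Im z\<bar> \<ge> 1"
  shows "norm (sin z) \<ge> exp \<bar>Im z\<bar> / 4"
proof -
  define y where "y = \<bar>Im z\<bar>"
  have "exp (2 * y) + inverse (exp (2 * y)) = exp (2 * Im z) + inverse (exp (2 * Im z))"
    by (cases "Im z \<ge> 0") (auto simp: y_def exp_minus)
  hence "(norm (sin z))\<^sup>2 = (exp (2 * y) + inverse (exp (2 * y)) - 2 * cos (2 * Re z)) / 4"
    by (simp add: norm_sin_squared)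
  moreover have "2 * cos (2 * Re z) \<le> 2" by simp
  moreover have "inverse (exp (2 * y)) \<ge> 0" by simp
  moreover have "exp (2 * y) \<ge> 3"
    using exp_ge_add_one_self[of "2 * y"] assms unfolding y_def by linarith
  moreover have "E / 16 \<le> (E + I - 2 * c) / 4" if "2 * c \<le> 2" "I \<ge> 0" "E \<ge> 3" for E I c :: real
    using that by (simp add: field_simps)
  ultimately have "(norm (sin z))\<^sup>2 \<ge> exp (2 * y) / 16" by metis
  also have "exp (2 * y) / 16 = (exp y / 4)\<^sup>2" by (simp add: power_divide exp_double)
  finally show ?thesis unfolding y_def by (rule power2_le_imp_le) simp
qed

text \<open>
Away from the real axis the reflection formula turns the bound for \<open>1/\<Gamma>(1 - z)\<close> into one for \<open>\<Gamma>(z)\<close>, as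
\<open>sin (\<pi> z)\<close> grows like \<open>exp (\<pi> |Im z|)\<close>.  The segment \<open>|y| \<le> 1\<close> is covered by continuity, for which
the line must not contain a pole.
\<close>

lemma line_bound_Gamma_Complex:
  assumes np: "\<And>y. Complex x y \<notin> \<int>\<^sub>\<le>\<^sub>0"
  shows "line_bound (\<lambda>y. Gamma (Complex x y)) (x - 1/2) (pi / 2)"
proof -
  define W where "W y = (1 + \<bar>y\<bar>) powr (x - 1/2) * exp (- (pi / 2) * \<bar>y\<bar>)" for y
  have W: "W y > 0" for y by (simp add: W_def)
  have eq: "Complex (1 - x) (0 + -1 * y) = 1 - Complex x y" for y by (simp add: complex_eq_iff)
  have "line_bound (\<lambda>y. rGamma (1 - Complex x y)) (x - 1/2) (- (pi / 2))"
    using line_bound_affine[OF line_bound_rGamma_Complex[of "1 - x"], of "-1" 0] unfolding eq by simp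
  then obtain C where C: "C > 0" "\<And>y. norm (rGamma (1 - Complex x y)) \<le> C * (1 + \<bar>y\<bar>) powr (x - 1/2) * exp (pi / 2 * \<bar>y\<bar>)"
    unfolding line_bound_def by auto
  have far: "norm (Gamma (Complex x y)) \<le> (4 * pi * C) * W y" if "\<bar>y\<bar> \<ge> 1" for y
  proof -
    let ?z = "Complex x y"
    have Im: "\<bar>Im (of_real pi * ?z)\<bar> = pi * \<bar>y\<bar>" by (simp add: abs_mult)
    have "1 * 1 \<le> pi * \<bar>y\<bar>" using that pi_gt3 by (intro mult_mono) auto
    hence s: "norm (sin (of_real pi * ?z)) \<ge> exp (pi * \<bar>y\<bar>) / 4"
      using norm_sin_ge[of "of_real pi * ?z"] unfolding Im by simp
    hence s0: "norm (sin (of_real pi * ?z)) > 0" by (rule less_le_trans[rotated]) simp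
    have "Gamma ?z * sin (of_real pi * ?z) = of_real pi * rGamma (1 - ?z)"
      using rGamma_reflection_complex[of ?z] np by (simp add: rGamma_inverse_Gamma[of ?z] Gamma_eq_zero_iff field_simps)
    hence "norm (Gamma ?z) * norm (sin (of_real pi * ?z)) = pi * norm (rGamma (1 - ?z))"
      by (metis norm_mult norm_of_real abs_of_pos pi_gt_zero)
    hence "norm (Gamma ?z) = pi * norm (rGamma (1 - ?z)) / norm (sin (of_real pi * ?z))" using s0 by (simp add: field_simps)
    also have "\<dots> \<le> pi * (C * (1 + \<bar>y\<bar>) powr (x - 1/2) * exp (pi / 2 * \<bar>y\<bar>)) / (exp (pi * \<bar>y\<bar>) / 4)"
      using C(1) by (intro frac_le mult_left_mono C(2) s) auto
    also have "\<dots> = 4 * pi * C * (1 + \<bar>y\<bar>) powr (x - 1/2) * (exp (pi / 2 * \<bar>y\<bar>) / exp (pi * \<bar>y\<bar>))" by simp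
    also have "exp (pi / 2 * \<bar>y\<bar>) / exp (pi * \<bar>y\<bar>) = exp (- (pi / 2) * \<bar>y\<bar>)"
      unfolding exp_diff [symmetric] by (rule arg_cong[where f = exp]) simp
    finally show ?thesis by (simp add: W_def mult_ac)
  qed
  have "continuous_on {-1..1} (\<lambda>y. norm (Gamma (Complex x y)) / W y)"
  proof (rule continuous_on_divide)
    show "continuous_on {-1..1} W" unfolding W_def by (intro continuous_intros) auto
    show "\<forall>y\<in>{-1..1}. W y \<noteq> 0" using W less_irrefl by metis
    show "continuous_on {-1..1} (\<lambda>y. norm (Gamma (Complex x y)))"
    proof (rule continuous_on_norm, rule continuous_on_compose2[OF continuous_on_Gamma[of "range (Complex x)"]])
      show "continuous_on {-1..1} (Complex x)" unfolding Complex_eq by (intro continuous_intros)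
    qed (use np in blast)+
  qed
  hence "bounded ((\<lambda>y. norm (Gamma (Complex x y)) / W y) ` {-1..1})"
    by (intro compact_imp_bounded compact_continuous_image) auto
  then obtain B where B: "\<And>y. y \<in> {-1..1} \<Longrightarrow> \<bar>norm (Gamma (Complex x y)) / W y\<bar> \<le> B"
    unfolding bounded_iff real_norm_def by blast
  define M where "M = max B (4 * pi * C)"
  have "norm (Gamma (Complex x y)) \<le> M * W y" for y
  proof (cases "y \<in> {-1..1}")
    case True
    from B[OF this] have "norm (Gamma (Complex x y)) / W y \<le> M" unfolding M_def by linarith
    thus ?thesis using W[of y] by (simp add: field_simps)
  next
    case False
    hence "norm (Gamma (Complex x y)) \<le> (4 * pi * C) * W y" by (intro far) auto
    also have "\<dots> \<le> M * W y" using W[of y] by (intro mult_right_mono) (auto simp: M_def)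
    finally show ?thesis .
  qed
  moreover have "M > 0" using C(1) by (simp add: M_def less_max_iff_disj)
  ultimately show ?thesis unfolding line_bound_def W_def
    by (intro exI[of _ M]) (auto simp: mult.assoc)
qed

lemma line_bound_Gamma:
  assumes v: "v \<noteq> 0" and np: "\<And>\<tau>. u + of_real v * (\<i> * of_real \<tau>) \<notin> \<int>\<^sub>\<le>\<^sub>0"
  shows "line_bound (\<lambda>\<tau>. Gamma (u + of_real v * (\<i> * of_real \<tau>))) (Re u - 1/2) (pi / 2 * \<bar>v\<bar>)"
proof -
  have eq: "u + of_real v * (\<i> * of_real \<tau>) = Complex (Re u) (Im u + v * \<tau>)" for \<tau> by (simp add: complex_eq_iff)
  have "Complex (Re u) y \<notin> \<int>\<^sub>\<le>\<^sub>0" for y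
    using np[of "(y - Im u) / v"] v unfolding eq by simp
  from line_bound_affine[OF line_bound_Gamma_Complex[OF this] v, of "Im u"] show ?thesis unfolding eq .
qed

lemma integrable_one_plus_abs_powr:
  assumes "e < -1"
  shows "integrable lborel (\<lambda>\<tau>::real. (1 + \<bar>\<tau>\<bar>) powr e)"
proof -
  define f :: "real \<Rightarrow> real" where "f x = indicator {1..} x *\<^sub>R x powr e" for x
  have "(\<lambda>x. x powr e) absolutely_integrable_on {1..}"
    using has_integral_powr_to_inf[OF assms, of 1] by (intro nonnegative_absolutely_integrable_1) (auto simp: integrable_on_def)
  moreover have [measurable]: "f \<in> borel_measurable borel" unfolding f_def by measurable
  ultimately have f: "integrable lborel f"
    unfolding set_integrable_def f_def by (subst (asm) integrable_completion) auto
  have "integrable lborel (\<lambda>x. f (1 + 1 * x) + f (1 + (-1) * x))"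
    using f by (intro Bochner_Integration.integrable_add lborel_integrable_real_affine) auto
  thus ?thesis
  proof (rule Bochner_Integration.integrable_bound)
    show "AE x in lborel. norm ((1 + \<bar>x\<bar>) powr e) \<le> norm (f (1 + 1 * x) + f (1 + (-1) * x))"
      by (rule AE_I2) (auto simp: f_def indicator_def abs_if)
  qed measurable
qed

text \<open>
Exponential decay is traded for a polynomial decay of order \<open>2\<close>.
\<close>

lemma line_bound_integrable:
  assumes f: "line_bound f e d" and m: "f \<in> borel_measurable borel"
    and c: "d > 0 \<or> (d = 0 \<and> e < -1)"
  shows "integrable lborel f"
proof -
  obtain C where C: "C > 0" "\<And>\<tau>. norm (f \<tau>) \<le> C * (1 + \<bar>\<tau>\<bar>) powr e * exp (- d * \<bar>\<tau>\<bar>)"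
    using f unfolding line_bound_def by blast
  have "\<exists>K e'. e' < -1 \<and> (\<forall>\<tau>. (1 + \<bar>\<tau>\<bar>) powr e * exp (- d * \<bar>\<tau>\<bar>) \<le> K * (1 + \<bar>\<tau>\<bar>) powr e')"
    using c
  proof
    assume d: "d > 0"
    define g where "g t = t powr (e + 2) * exp (- d * (t - 1))" for t :: real
    have "(g \<longlongrightarrow> 0) at_top" unfolding g_def using d by real_asymp
    hence "\<forall>\<^sub>F t in at_top. g t < 1" by (rule order_tendstoD) simp
    then obtain T where T: "\<And>t. t \<ge> T \<Longrightarrow> g t < 1" unfolding eventually_at_top_linorder by blast
    have "continuous_on {1..max 1 T} g" unfolding g_def by (intro continuous_intros) auto
    hence "bounded (g ` {1..max 1 T})" by (intro compact_imp_bounded compact_continuous_image) auto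
    then obtain B where B: "\<And>t. t \<in> {1..max 1 T} \<Longrightarrow> \<bar>g t\<bar> \<le> B" unfolding bounded_iff real_norm_def by blast
    have gb: "g t \<le> max 1 B" if "t \<ge> 1" for t
    proof (cases "t \<ge> T")
      case True thus ?thesis using T[of t] by linarith
    next
      case False
      thus ?thesis using B[of t] that by (simp add: max_def abs_le_iff split: if_splits)
    qed
    have "(1 + \<bar>\<tau>\<bar>) powr e * exp (- d * \<bar>\<tau>\<bar>) \<le> max 1 B * (1 + \<bar>\<tau>\<bar>) powr (- 2)" for \<tau>
    proof -
      have "(1 + \<bar>\<tau>\<bar>) powr e * exp (- d * \<bar>\<tau>\<bar>) = g (1 + \<bar>\<tau>\<bar>) * (1 + \<bar>\<tau>\<bar>) powr (- 2)"
      proof -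
        have "(1 + \<bar>\<tau>\<bar>) powr e = (1 + \<bar>\<tau>\<bar>) powr (e + 2) * (1 + \<bar>\<tau>\<bar>) powr (- 2)"
          by (subst powr_add [symmetric]) simp
        thus ?thesis by (simp add: g_def)
      qed
      also have "\<dots> \<le> max 1 B * (1 + \<bar>\<tau>\<bar>) powr (- 2)" by (intro mult_right_mono gb) auto
      finally show ?thesis .
    qed
    thus ?thesis by (intro exI[of _ "max 1 B"] exI[of _ "-2"]) auto
  next
    assume "d = 0 \<and> e < -1"
    thus ?thesis by (intro exI[of _ 1] exI[of _ e]) auto
  qed
  then obtain K e' where K: "e' < -1" "\<And>\<tau>. (1 + \<bar>\<tau>\<bar>) powr e * exp (- d * \<bar>\<tau>\<bar>) \<le> K * (1 + \<bar>\<tau>\<bar>) powr e'" by blast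
  have "integrable lborel (\<lambda>\<tau>. C * K * (1 + \<bar>\<tau>\<bar>) powr e')"
    using integrable_one_plus_abs_powr[OF K(1)] by simp
  thus ?thesis
  proof (rule Bochner_Integration.integrable_bound)
    show "AE \<tau> in lborel. norm (f \<tau>) \<le> norm (C * K * (1 + \<bar>\<tau>\<bar>) powr e')"
    proof (rule AE_I2)
      fix \<tau>
      have "norm (f \<tau>) \<le> C * ((1 + \<bar>\<tau>\<bar>) powr e * exp (- d * \<bar>\<tau>\<bar>))" using C(2)[of \<tau>] by (simp add: mult.assoc)
      also have "\<dots> \<le> C * (K * (1 + \<bar>\<tau>\<bar>) powr e')" using C(1) by (intro mult_left_mono K) auto
      also have "\<dots> \<le> norm (C * K * (1 + \<bar>\<tau>\<bar>) powr e')" by (simp add: mult.assoc)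
      finally show "norm (f \<tau>) \<le> norm (C * K * (1 + \<bar>\<tau>\<bar>) powr e')" .
    qed
  qed (use m in measurable)
qed

section \<open>Absolute convergence of the I-function\<close>

text \<open>
The modulus does not depend on the chosen branch.  At a pole both sides are \<open>0\<close> by convention.
\<close>

lemma norm_Gamma_pow:
  assumes "is_gamma_branch lg" "v \<noteq> 0" "\<kappa> > 0"
  shows "norm (Gamma_pow lg u v \<kappa> (\<i> * of_real \<tau>)) = norm (Gamma (u + of_real v * (\<i> * of_real \<tau>))) powr \<kappa>"
proof (cases "u + of_real v * (\<i> * of_real \<tau>) \<in> \<int>\<^sub>\<le>\<^sub>0")
  case True
  thus ?thesis by (simp add: Gamma_pow_def Gamma_eq_zero_iff[THEN iffD2])
next
  case False
  define s where "s = \<i> * complex_of_real \<tau>"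
  have "Re s = 0" by (simp add: s_def)
  with assms False have "Gamma (u + of_real v * s) = exp (lg u v \<kappa> s)"
    unfolding is_gamma_branch_def s_def [symmetric] by simp
  hence "norm (Gamma (u + of_real v * s)) powr \<kappa> = exp (\<kappa> * Re (lg u v \<kappa> s))"
    by (simp add: powr_def)
  thus ?thesis using False unfolding s_def [symmetric] by (simp add: Gamma_pow_def)
qed

lemma Gamma_pow_1:
  assumes "is_gamma_branch lg" "v \<noteq> 0"
  shows "Gamma_pow lg u v 1 (\<i> * of_real \<tau>) = Gamma (u + of_real v * (\<i> * of_real \<tau>))"
proof (cases "u + of_real v * (\<i> * of_real \<tau>) \<in> \<int>\<^sub>\<le>\<^sub>0")
  case True
  thus ?thesis by (simp add: Gamma_pow_def Gamma_eq_zero_iff[THEN iffD2])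
next
  case False
  define s where "s = \<i> * complex_of_real \<tau>"
  have "Re s = 0" by (simp add: s_def)
  with assms False have "Gamma (u + of_real v * s) = exp (lg u v 1 s)"
    unfolding is_gamma_branch_def s_def [symmetric] by simp
  thus ?thesis using False unfolding s_def [symmetric] by (simp add: Gamma_pow_def)
qed

text \<open>
A branch is continuous only off the poles of the gamma factor, but these form a closed set.
\<close>

lemma borel_measurable_Gamma_pow:
  assumes "is_gamma_branch lg" "v \<noteq> 0" "\<kappa> > 0"
  shows "(\<lambda>\<tau>. Gamma_pow lg u v \<kappa> (\<i> * of_real \<tau>)) \<in> borel_measurable borel"
proof -
  define E where "E = {\<tau>. u + of_real v * (\<i> * complex_of_real \<tau>) \<notin> \<int>\<^sub>\<le>\<^sub>0}"
  have "open ((\<lambda>\<tau>. u + of_real v * (\<i> * complex_of_real \<tau>)) -` (- \<int>\<^sub>\<le>\<^sub>0))"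
    by (intro open_vimage continuous_intros) (simp add: open_Compl)
  hence E: "open E" by (simp add: E_def vimage_def)
  have "continuous_on {s. Re s = 0 \<and> u + of_real v * s \<notin> \<int>\<^sub>\<le>\<^sub>0} (lg u v \<kappa>)"
    using assms unfolding is_gamma_branch_def by blast
  hence "continuous_on E (\<lambda>\<tau>. lg u v \<kappa> (\<i> * complex_of_real \<tau>))"
    by (rule continuous_on_compose2) (auto intro!: continuous_intros simp: E_def)
  hence "continuous_on E (\<lambda>\<tau>. exp (of_real \<kappa> * lg u v \<kappa> (\<i> * complex_of_real \<tau>)))"
    by (intro continuous_intros)
  hence "(\<lambda>\<tau>. indicator E \<tau> *\<^sub>R exp (of_real \<kappa> * lg u v \<kappa> (\<i> * complex_of_real \<tau>))) \<in> borel_measurable borel"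
    using E by (intro borel_measurable_continuous_on_indicator) auto
  moreover have "(\<lambda>\<tau>. indicator E \<tau> *\<^sub>R exp (of_real \<kappa> * lg u v \<kappa> (\<i> * complex_of_real \<tau>))) =
     (\<lambda>\<tau>. Gamma_pow lg u v \<kappa> (\<i> * of_real \<tau>))"
    by (auto simp: fun_eq_iff Gamma_pow_def E_def indicator_def)
  ultimately show ?thesis by simp
qed

lemma line_bound_Gamma_pow:
  assumes "is_gamma_branch lg" "v \<noteq> 0" "\<kappa> > 0" "\<And>\<tau>. u + of_real v * (\<i> * of_real \<tau>) \<notin> \<int>\<^sub>\<le>\<^sub>0"
  shows "line_bound (\<lambda>\<tau>. Gamma_pow lg u v \<kappa> (\<i> * of_real \<tau>)) (\<kappa> * (Re u - 1/2)) (\<kappa> * (pi / 2 * \<bar>v\<bar>))"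
  by (rule line_bound_powr[OF line_bound_Gamma]) (use assms norm_Gamma_pow in auto)

lemma line_bound_inverse_Gamma_pow:
  assumes "is_gamma_branch lg" "v \<noteq> 0" "\<kappa> > 0"
  shows "line_bound (\<lambda>\<tau>. inverse (Gamma_pow lg u v \<kappa> (\<i> * of_real \<tau>))) (\<kappa> * (1/2 - Re u)) (\<kappa> * (- (pi / 2 * \<bar>v\<bar>)))"
  by (rule line_bound_powr[OF line_bound_rGamma])
    (use assms in \<open>auto simp: norm_inverse norm_Gamma_pow rGamma_inverse_Gamma inverse_powr\<close>)

lemma sum_list_take_nth:
  fixes f :: "'a \<Rightarrow> real"
  assumes "n \<le> length xs"
  shows "sum_list (map f (take n xs)) = (\<Sum>i<n. f (xs ! i))"
    and "sum_list (map f (drop n xs)) = (\<Sum>i=n..<length xs. f (xs ! i))"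
proof -
  show "sum_list (map f (take n xs)) = (\<Sum>i<n. f (xs ! i))"
    using assms by (simp add: sum_list_sum_nth atLeast0LessThan)
  have "sum_list (map f (drop n xs)) = (\<Sum>i=0..<length xs - n. f (xs ! (n + i)))"
    using assms by (simp add: sum_list_sum_nth)
  also have "\<dots> = (\<Sum>i=n..<length xs. f (xs ! i))"
    using assms by (intro sum.reindex_bij_witness[of _ "\<lambda>i. i - n" "\<lambda>i. n + i"]) auto
  finally show "sum_list (map f (drop n xs)) = (\<Sum>i=n..<length xs. f (xs ! i))" .
qed

lemma sum_list_split: "sum_list (map f xs) = sum_list (map f (take n xs)) + sum_list (map f (drop n xs))"
  for f :: "'a \<Rightarrow> real"
  by (metis append_take_drop_id map_append sum_list_append)

text \<open>
The polynomial exponent that Stirling's formula attaches to \<open>\<Gamma>\<^sup>\<kappa>(c + C s)\<close> on the imaginary axis.  For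
\<open>\<Gamma>\<^sup>\<kappa>(1 - c - C s)\<close> it changes sign.
\<close>

definition triple_exponent :: "triple \<Rightarrow> real" where
  "triple_exponent T = (case T of (c, C, \<kappa>) \<Rightarrow> \<kappa> * (Re c - 1/2))"

text \<open>
The exponential decay rate of the gamma factor of a triple on the imaginary axis, the same for \<open>\<Gamma>\<^sup>\<kappa>(c + C s)\<close> and
\<open>\<Gamma>\<^sup>\<kappa>(1 - c - C s)\<close>.
\<close>

definition triple_type :: "triple \<Rightarrow> real" where
  "triple_type T = (case T of (c, C, \<kappa>) \<Rightarrow> \<kappa> * (pi / 2 * C))"

lemma gamma_factor_line_bounds:
  assumes lg: "is_gamma_branch lg" and T: "case T of (c, C, \<kappa>) \<Rightarrow> C > 0 \<and> \<kappa> > 0"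
  shows "line_bound (\<lambda>\<tau>. inverse (Gamma_plus lg T (\<i> * of_real \<tau>))) (- triple_exponent T) (- triple_type T)"
    and "line_bound (\<lambda>\<tau>. inverse (Gamma_minus lg T (\<i> * of_real \<tau>))) (triple_exponent T) (- triple_type T)"
    and "(\<And>\<tau>. case T of (c, C, \<kappa>) \<Rightarrow> c + of_real C * (\<i> * of_real \<tau>) \<notin> \<int>\<^sub>\<le>\<^sub>0) \<Longrightarrow>
      line_bound (\<lambda>\<tau>. Gamma_plus lg T (\<i> * of_real \<tau>)) (triple_exponent T) (triple_type T)"
    and "(\<And>\<tau>. case T of (c, C, \<kappa>) \<Rightarrow> 1 - c - of_real C * (\<i> * of_real \<tau>) \<notin> \<int>\<^sub>\<le>\<^sub>0) \<Longrightarrow>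
      line_bound (\<lambda>\<tau>. Gamma_minus lg T (\<i> * of_real \<tau>)) (- triple_exponent T) (triple_type T)"
    and "(\<lambda>\<tau>. Gamma_plus lg T (\<i> * of_real \<tau>)) \<in> borel_measurable borel"
    and "(\<lambda>\<tau>. Gamma_minus lg T (\<i> * of_real \<tau>)) \<in> borel_measurable borel"
proof -
  obtain c C \<kappa> where e: "T = (c, C, \<kappa>)" by (cases T) auto
  have p: "C \<noteq> 0" "- C \<noteq> 0" "\<kappa> > 0" "\<bar>C\<bar> = C" "\<bar>- C\<bar> = C" using T e by auto
  have x: "\<kappa> * (Re c - 1/2) = triple_exponent T" "\<kappa> * (1/2 - Re c) = - triple_exponent T"
      "\<kappa> * (Re (1 - c) - 1/2) = - triple_exponent T" "\<kappa> * (1/2 - Re (1 - c)) = triple_exponent T"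
      "\<kappa> * (pi / 2 * C) = triple_type T" "\<kappa> * (- (pi / 2 * C)) = - triple_type T"
    by (simp_all add: e triple_exponent_def triple_type_def algebra_simps)
  have G: "Gamma_plus lg T s = Gamma_pow lg c C \<kappa> s" "Gamma_minus lg T s = Gamma_pow lg (1 - c) (- C) \<kappa> s" for s
    by (simp_all add: e Gamma_plus_def Gamma_minus_def)
  show "line_bound (\<lambda>\<tau>. inverse (Gamma_plus lg T (\<i> * of_real \<tau>))) (- triple_exponent T) (- triple_type T)"
    "line_bound (\<lambda>\<tau>. inverse (Gamma_minus lg T (\<i> * of_real \<tau>))) (triple_exponent T) (- triple_type T)"
    unfolding G using line_bound_inverse_Gamma_pow[OF lg p(1,3), of c] line_bound_inverse_Gamma_pow[OF lg p(2,3), of "1 - c"]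
    by (simp_all only: x p)
  show "line_bound (\<lambda>\<tau>. Gamma_plus lg T (\<i> * of_real \<tau>)) (triple_exponent T) (triple_type T)"
    if "\<And>\<tau>. case T of (c, C, \<kappa>) \<Rightarrow> c + of_real C * (\<i> * of_real \<tau>) \<notin> \<int>\<^sub>\<le>\<^sub>0"
    unfolding G using line_bound_Gamma_pow[OF lg p(1,3), of c] that[unfolded e] by (simp only: x p prod.case) simp
  show "line_bound (\<lambda>\<tau>. Gamma_minus lg T (\<i> * of_real \<tau>)) (- triple_exponent T) (triple_type T)"
    if "\<And>\<tau>. case T of (c, C, \<kappa>) \<Rightarrow> 1 - c - of_real C * (\<i> * of_real \<tau>) \<notin> \<int>\<^sub>\<le>\<^sub>0"
    unfolding G using line_bound_Gamma_pow[OF lg p(2,3), of "1 - c"] that[unfolded e] by (simp only: x p prod.case) simp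
  show "(\<lambda>\<tau>. Gamma_plus lg T (\<i> * of_real \<tau>)) \<in> borel_measurable borel"
    "(\<lambda>\<tau>. Gamma_minus lg T (\<i> * of_real \<tau>)) \<in> borel_measurable borel"
    unfolding G by (intro borel_measurable_Gamma_pow lg p)+
qed

text \<open>
Adding up the contributions of the factors shows where the convergence parameters come from: \<open>\<Omega>\<close> is the
polynomial exponent of \<open>\<chi>\<close> and \<open>\<pi> \<Delta> / 2\<close> its exponential rate of decay.  A lower triple contributes the same
exponent in the numerator as in the denominator, and so does an upper one, whereas the rate changes sign.
\<close>

lemma line_bound_I_chi:
  assumes lg: "is_gamma_branch lg" and m: "m \<le> length lo" and n: "n \<le> length up"
    and pos: "\<forall>(c, C, \<kappa>)\<in>set up \<union> set lo. C > 0 \<and> \<kappa> > 0"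
    and lo: "\<forall>(c, C, \<kappa>)\<in>set (take m lo). \<forall>\<tau>. c + of_real C * (\<i> * of_real \<tau>) \<notin> \<int>\<^sub>\<le>\<^sub>0"
    and up: "\<forall>(c, C, \<kappa>)\<in>set (take n up). \<forall>\<tau>. 1 - c - of_real C * (\<i> * of_real \<tau>) \<notin> \<int>\<^sub>\<le>\<^sub>0"
  shows "line_bound (\<lambda>\<tau>. I_chi lg m n up lo (\<i> * of_real \<tau>)) (I_Omega up lo) (pi / 2 * I_Delta m n up lo)"
    and "(\<lambda>\<tau>. I_chi lg m n up lo (\<i> * of_real \<tau>)) \<in> borel_measurable borel"
proof -
  note gl = gamma_factor_line_bounds[OF lg bspec[OF pos]]
  have 1: "line_bound (\<lambda>\<tau>. Gamma_plus lg (lo ! j) (\<i> * of_real \<tau>)) (triple_exponent (lo ! j)) (triple_type (lo ! j))" if "j < m" for j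
  proof (rule gl(3))
    have "lo ! j \<in> set (take m lo)" using that m by (auto simp: in_set_conv_nth intro!: exI[of _ j])
    from bspec[OF lo this] show "case lo ! j of (c, C, \<kappa>) \<Rightarrow> c + of_real C * (\<i> * of_real \<tau>) \<notin> \<int>\<^sub>\<le>\<^sub>0" for \<tau>
      by (simp split: prod.splits)
  qed (use that m in simp)
  have 2: "line_bound (\<lambda>\<tau>. Gamma_minus lg (up ! i) (\<i> * of_real \<tau>)) (- triple_exponent (up ! i)) (triple_type (up ! i))" if "i < n" for i
  proof (rule gl(4))
    have "up ! i \<in> set (take n up)" using that n by (auto simp: in_set_conv_nth intro!: exI[of _ i])
    from bspec[OF up this] show "case up ! i of (c, C, \<kappa>) \<Rightarrow> 1 - c - of_real C * (\<i> * of_real \<tau>) \<notin> \<int>\<^sub>\<le>\<^sub>0" for \<tau>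
      by (simp split: prod.splits)
  qed (use that n in simp)
  have chi: "I_chi lg m n up lo s = (\<Prod>j<m. Gamma_plus lg (lo ! j) s) * (\<Prod>i<n. Gamma_minus lg (up ! i) s)
     * ((\<Prod>j=m..<length lo. inverse (Gamma_minus lg (lo ! j) s)) * (\<Prod>i=n..<length up. inverse (Gamma_plus lg (up ! i) s)))" for s
    by (simp only: I_chi_def divide_inverse inverse_mult_distrib prod_inversef[unfolded o_def, symmetric])
  have "line_bound (\<lambda>\<tau>. I_chi lg m n up lo (\<i> * of_real \<tau>))
     (((\<Sum>j<m. triple_exponent (lo ! j)) + (\<Sum>i<n. - triple_exponent (up ! i))) + ((\<Sum>j=m..<length lo. triple_exponent (lo ! j)) + (\<Sum>i=n..<length up. - triple_exponent (up ! i))))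
     (((\<Sum>j<m. triple_type (lo ! j)) + (\<Sum>i<n. triple_type (up ! i))) + ((\<Sum>j=m..<length lo. - triple_type (lo ! j)) + (\<Sum>i=n..<length up. - triple_type (up ! i))))"
    unfolding chi by (intro line_bound_mult line_bound_prod 1 2 gl(1,2)) auto
  moreover have "((\<Sum>j<m. triple_exponent (lo ! j)) + (\<Sum>i<n. - triple_exponent (up ! i))) + ((\<Sum>j=m..<length lo. triple_exponent (lo ! j)) + (\<Sum>i=n..<length up. - triple_exponent (up ! i))) = I_Omega up lo"
  proof -
    have "I_Omega up lo = sum_list (map (\<lambda>T. - triple_exponent T) up) - sum_list (map (\<lambda>T. - triple_exponent T) lo)"
      unfolding I_Omega_def by (intro arg_cong2[where f = "(-)"] arg_cong[where f = sum_list] map_cong)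
        (auto simp: triple_exponent_def algebra_simps)
    thus ?thesis
      unfolding sum_list_split[of _ up n] sum_list_split[of _ lo m] sum_list_take_nth[OF m] sum_list_take_nth[OF n]
      by (simp add: sum_negf)
  qed
  moreover have "((\<Sum>j<m. triple_type (lo ! j)) + (\<Sum>i<n. triple_type (up ! i))) + ((\<Sum>j=m..<length lo. - triple_type (lo ! j)) + (\<Sum>i=n..<length up. - triple_type (up ! i))) = pi / 2 * I_Delta m n up lo"
  proof -
    have e: "pi / 2 * sum_list (map (\<lambda>(c, C, \<kappa>). \<kappa> * C) xs) = sum_list (map triple_type xs)" for xs :: "triple list"
      unfolding sum_list_const_mult [symmetric] by (intro arg_cong[where f = sum_list] map_cong) (auto simp: triple_type_def)
    have "pi / 2 * I_Delta m n up lo = sum_list (map triple_type (take m lo)) - sum_list (map triple_type (drop m lo))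
        + sum_list (map triple_type (take n up)) - sum_list (map triple_type (drop n up))"
      unfolding I_Delta_def e [symmetric] by (simp only: right_diff_distrib distrib_left)
    thus ?thesis
      unfolding sum_list_take_nth[OF m] sum_list_take_nth[OF n] by (simp add: sum_negf)
  qed
  ultimately show "line_bound (\<lambda>\<tau>. I_chi lg m n up lo (\<i> * of_real \<tau>)) (I_Omega up lo) (pi / 2 * I_Delta m n up lo)"
    by simp
  show "(\<lambda>\<tau>. I_chi lg m n up lo (\<i> * of_real \<tau>)) \<in> borel_measurable borel"
    unfolding I_chi_def using m n
    by (intro borel_measurable_divide borel_measurable_times borel_measurable_prod gl(5,6)) auto
qed

text \<open>
The integrand of the I-function at \<open>a\<close>, including the constant \<open>1 / (2 \<pi> i)\<close> and \<open>ds = i d\<tau>\<close>.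
\<close>

definition I_density :: "gamma_branch \<Rightarrow> nat \<Rightarrow> nat \<Rightarrow> triple list \<Rightarrow> triple list \<Rightarrow> complex \<Rightarrow> real \<Rightarrow> real \<Rightarrow> complex" where
  "I_density lg m n up lo a \<theta> \<tau> =
     I_chi lg m n up lo (\<i> * of_real \<tau>) * exp (- (\<i> * of_real \<tau>) * (of_real (ln (cmod a)) + \<i> * of_real \<theta>)) / of_real (2 * pi)"

text \<open>
The factor \<open>a\<^sup>-\<^sup>s\<close> has modulus \<open>exp (\<theta> \<tau>)\<close>, so the rate of decay is \<open>\<pi> \<Delta> / 2 - |\<theta>|\<close>: either positive, or zero and
then \<open>\<Omega> < -1\<close> is required.
\<close>

lemma integrable_I_density:
  assumes lg: "is_gamma_branch lg" and m: "m \<le> length lo" and n: "n \<le> length up"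
    and pos: "\<forall>(c, C, \<kappa>)\<in>set up \<union> set lo. C > 0 \<and> \<kappa> > 0"
    and lo: "\<forall>(c, C, \<kappa>)\<in>set (take m lo). \<forall>\<tau>. c + of_real C * (\<i> * of_real \<tau>) \<notin> \<int>\<^sub>\<le>\<^sub>0"
    and up: "\<forall>(c, C, \<kappa>)\<in>set (take n up). \<forall>\<tau>. 1 - c - of_real C * (\<i> * of_real \<tau>) \<notin> \<int>\<^sub>\<le>\<^sub>0"
    and conv: "I_abs_conv m n up lo 0 \<theta>"
  shows "integrable lborel (I_density lg m n up lo a \<theta>)"
proof -
  note chi = line_bound_I_chi[OF lg m n pos lo up]
  define E where "E \<tau> = exp (- (\<i> * complex_of_real \<tau>) * (of_real (ln (cmod a)) + \<i> * of_real \<theta>))" for \<tau>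
  have "line_bound E 0 (- \<bar>\<theta>\<bar>)"
    unfolding line_bound_def
  proof (intro exI[of _ 1] conjI allI)
    fix \<tau> :: real
    have "norm (E \<tau>) = exp (\<theta> * \<tau>)" by (simp add: E_def algebra_simps)
    also have "\<dots> \<le> exp (\<bar>\<theta>\<bar> * \<bar>\<tau>\<bar>)" by (simp flip: abs_mult)
    finally show "norm (E \<tau>) \<le> 1 * (1 + \<bar>\<tau>\<bar>) powr 0 * exp (- (- \<bar>\<theta>\<bar>) * \<bar>\<tau>\<bar>)" by simp
  qed simp
  from line_bound_mult[OF chi(1) this]
  have "line_bound (\<lambda>\<tau>. I_chi lg m n up lo (\<i> * of_real \<tau>) * E \<tau>) (I_Omega up lo) (pi / 2 * I_Delta m n up lo - \<bar>\<theta>\<bar>)"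
    by simp
  moreover have "(\<lambda>\<tau>. I_chi lg m n up lo (\<i> * of_real \<tau>) * E \<tau>) \<in> borel_measurable borel"
    using chi(2) unfolding E_def by measurable
  moreover have "pi / 2 * I_Delta m n up lo - \<bar>\<theta>\<bar> > 0 \<or> (pi / 2 * I_Delta m n up lo - \<bar>\<theta>\<bar> = 0 \<and> I_Omega up lo < -1)"
    using conv unfolding I_abs_conv_def by auto
  ultimately have "integrable lborel (\<lambda>\<tau>. I_chi lg m n up lo (\<i> * of_real \<tau>) * E \<tau>)"
    by (rule line_bound_integrable)
  hence "integrable lborel (\<lambda>\<tau>. I_chi lg m n up lo (\<i> * of_real \<tau>) * E \<tau> / of_real (2 * pi))"
    by (rule integrable_divide_zero) 
  thus ?thesis by (simp add: I_density_def[abs_def] E_def)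
qed

lemma I_function_powers_integral:
  assumes a: "a \<noteq> 0" and t: "t > 0"
  shows "of_real t powr (- r) * I_function lg m n up lo (a * of_real (t powr (- \<mu>))) \<theta> =
     powers_integral (I_density lg m n up lo a \<theta>) r \<mu> t"
proof -
  have l: "ln (cmod (a * of_real (t powr (- \<mu>)))) = ln (cmod a) - \<mu> * ln t"
    using a t by (simp add: norm_mult ln_mult ln_powr)
  have p: "I_density lg m n up lo a \<theta> \<tau> * of_real t powr (- (r - \<i> * of_real (\<mu> * \<tau>))) =
     (of_real t powr (- r) / (2 * of_real pi * \<i>)) *
       (let s = \<i> * of_real \<tau> in I_chi lg m n up lo s * exp (- s * (of_real (ln (cmod (a * of_real (t powr (- \<mu>))))) + \<i> * of_real \<theta>)) * \<i>)" for \<tau>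
  proof -
    have "exp (- (\<i> * complex_of_real \<tau>) * (of_real (ln (cmod (a * of_real (t powr (- \<mu>))))) + \<i> * of_real \<theta>)) =
        exp (- (\<i> * of_real \<tau>) * (of_real (ln (cmod a)) + \<i> * of_real \<theta>)) * exp (\<i> * of_real (\<mu> * \<tau> * ln t))"
      unfolding l exp_add [symmetric] by (rule arg_cong[where f = exp]) (simp add: algebra_simps)
    thus ?thesis unfolding powr_split_imaginary[OF t] Let_def I_density_def by simp
  qed
  show ?thesis unfolding powers_integral_def p integral_mult_right_zero I_function_def by simp
qed

section \<open>The theorem\<close>

text \<open>
For \<open>\<kappa> = 1\<close> a branch of the power is the gamma function itself, so the new triples contribute genuine gamma
functions whatever branches are chosen.
\<close>

lemma I_chi_extend:
  assumes lg: "is_gamma_branch lg" and \<mu>: "\<mu> > 0" and m: "m \<le> length lo" and n: "n \<le> length up"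
  shows "I_chi lg m (n + 3) ([(a1, \<mu>, 1), (a2, \<mu>, 1), (a3, \<mu>, 1)] @ up) (lo @ [(b1, \<mu>, 1), (b2, \<mu>, 1), (b3, \<mu>, 1)]) (\<i> * of_real \<tau>) =
    I_chi lg m n up lo (\<i> * of_real \<tau>) *
     (Gamma (1 - a1 - \<i> * of_real (\<mu> * \<tau>)) * Gamma (1 - a2 - \<i> * of_real (\<mu> * \<tau>)) * Gamma (1 - a3 - \<i> * of_real (\<mu> * \<tau>))
      * rGamma (1 - b1 - \<i> * of_real (\<mu> * \<tau>)) * rGamma (1 - b2 - \<i> * of_real (\<mu> * \<tau>)) * rGamma (1 - b3 - \<i> * of_real (\<mu> * \<tau>)))"
proof -
  define s where "s = \<i> * complex_of_real \<tau>"
  define U L where "U = [(a1, \<mu>, 1), (a2, \<mu>, 1), (a3, \<mu>, 1)] @ up" and "L = lo @ [(b1, \<mu>, 1), (b2, \<mu>, 1), (b3, \<mu>, 1)]"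
  have G: "Gamma_minus lg (c, \<mu>, 1) s = Gamma (1 - c - \<i> * of_real (\<mu> * \<tau>))" for c
    unfolding Gamma_minus_def s_def using Gamma_pow_1[OF lg, of "- \<mu>" "1 - c" \<tau>] \<mu> by (simp add: mult_ac)
  have 1: "(\<Prod>j<m. Gamma_plus lg (L ! j) s) = (\<Prod>j<m. Gamma_plus lg (lo ! j) s)"
    using m by (intro prod.cong) (auto simp: L_def nth_append)
  have 2: "(\<Prod>i<n+3. Gamma_minus lg (U ! i) s) = Gamma_minus lg (a1, \<mu>, 1) s * Gamma_minus lg (a2, \<mu>, 1) s * Gamma_minus lg (a3, \<mu>, 1) s * (\<Prod>i<n. Gamma_minus lg (up ! i) s)"
    unfolding U_def numeral_3_eq_3 add_Suc_right add_0_right prod.lessThan_Suc_shift by (simp add: mult_ac)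
  have 3: "(\<Prod>j=m..<length L. Gamma_minus lg (L ! j) s) = (\<Prod>j=m..<length lo. Gamma_minus lg (lo ! j) s) * (Gamma_minus lg (b1, \<mu>, 1) s * Gamma_minus lg (b2, \<mu>, 1) s * Gamma_minus lg (b3, \<mu>, 1) s)"
  proof -
    have "(\<Prod>j=m..<length lo. Gamma_minus lg (L ! j) s) = (\<Prod>j=m..<length lo. Gamma_minus lg (lo ! j) s)"
      by (intro prod.cong) (auto simp: L_def nth_append)
    moreover have "length L = Suc (Suc (Suc (length lo)))" "L ! length lo = (b1, \<mu>, 1)" "L ! Suc (length lo) = (b2, \<mu>, 1)" "L ! Suc (Suc (length lo)) = (b3, \<mu>, 1)"
      by (simp_all add: L_def nth_append)
    ultimately show ?thesis using m by (simp add: mult_ac)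
  qed
  have 4: "(\<Prod>i=n+3..<length U. Gamma_plus lg (U ! i) s) = (\<Prod>i=n..<length up. Gamma_plus lg (up ! i) s)"
  proof -
    have "(\<Prod>i=n+3..<length up + 3. Gamma_plus lg (U ! i) s) = (\<Prod>i=n..<length up. Gamma_plus lg (U ! (i + 3)) s)"
      by (rule prod.shift_bounds_nat_ivl)
    thus ?thesis by (simp add: U_def numeral_3_eq_3)
  qed
  show ?thesis
    unfolding U_def [symmetric] L_def [symmetric] s_def [symmetric] I_chi_def 1 2 3 4 G
    by (simp add: rGamma_inverse_Gamma divide_inverse mult_ac)
qed

theorem theorem4p2:
  fixes \<alpha> \<alpha>' \<beta> \<beta>' \<gamma> \<rho> a :: complex and \<mu> \<theta> x :: real
    and m n p q :: nat and up lo U L :: "triple list" and lg :: gamma_branch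
  assumes "m \<le> q" and "n \<le> p" and "length up = p" and "length lo = q"
    and "\<forall>(c, C, \<kappa>)\<in>set up \<union> set lo. C > 0 \<and> \<kappa> > 0"
    and "Re \<gamma> > 0" and "a \<noteq> 0" and "\<mu> > 0"
    and "Re \<rho> > Max {Re (- \<beta>'), Re (\<alpha>' + \<beta> - \<gamma>), Re (\<alpha> + \<alpha>' - \<gamma>) + of_int \<lfloor>Re \<gamma>\<rfloor> + 1}"
    and "a = of_real (cmod a) * cis \<theta>"
    and "U = [(1 - \<beta>' - \<rho>, \<mu>, 1), (1 + \<alpha> + \<alpha>' - \<gamma> - \<rho>, \<mu>, 1), (1 + \<alpha>' + \<beta> - \<gamma> - \<rho>, \<mu>, 1)] @ up"
    and "L = lo @ [(1 - \<rho>, \<mu>, 1), (1 + \<alpha>' - \<beta>' - \<rho>, \<mu>, 1), (1 + \<alpha> + \<alpha>' + \<beta> - \<gamma> - \<rho>, \<mu>, 1)]"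
    and "is_gamma_branch lg"
    and "I_separated m n up lo"
    and "I_abs_conv m n up lo 0 \<theta>"
    and "I_abs_conv m (n + 3) U L 0 \<theta>"
    and "x > 0"
  shows "msm_derivative_exists \<alpha> \<alpha>' \<beta> \<beta>' \<gamma>
           (\<lambda>t. of_real t powr (- \<rho>) * I_function lg m n up lo (a * of_real (t powr (- \<mu>))) \<theta>) x
       \<and> msm_derivative \<alpha> \<alpha>' \<beta> \<beta>' \<gamma>
           (\<lambda>t. of_real t powr (- \<rho>) * I_function lg m n up lo (a * of_real (t powr (- \<mu>))) \<theta>) x
         = of_real x powr (\<alpha> + \<alpha>' - \<gamma> - \<rho>)
             * I_function lg m (n + 3) U L (a * of_real (x powr (- \<mu>))) \<theta>"
proof -
  define N where "N = msm_order \<gamma>"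
  have N: "real N = of_int \<lfloor>Re \<gamma>\<rfloor> + 1" using assms(6) by (simp add: N_def msm_order_def)
  define G where "G = - \<gamma> + of_nat N"
  have G: "Re G > 0" using N by (simp add: G_def)
  have r: "Re \<rho> > Re (- \<beta>')" "Re \<rho> > Re (\<alpha>' + \<beta> - \<gamma>)" "Re \<rho> > Re (\<alpha> + \<alpha>' - \<gamma>) + real N"
    using assms(9) N by simp_all
  define f where "f t = of_real t powr (- \<rho>) * I_function lg m n up lo (a * of_real (t powr (- \<mu>))) \<theta>" for t
  define h where "h = I_density lg m n up lo a \<theta>"
  \<comment> \<open>After the fractional integration the powers of \<open>x\<close> are \<open>x\<^sup>-\<^sup>Q\<close>, where \<open>Q\<close> has the constant real part \<open>Re q0\<close>.\<close>
  define q0 where "q0 = \<rho> - G + (- \<alpha>') + (- \<alpha>)"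
  define Q where "Q \<tau> = q0 - \<i> * of_real (\<mu> * \<tau>)" for \<tau>
  define M where "M \<tau> = msm_multiplier (- \<alpha>') (- \<alpha>) (- \<beta>') (- \<beta> + of_nat N) G (\<rho> - \<i> * of_real (\<mu> * \<tau>))" for \<tau>
  define d where "d \<tau> = h \<tau> * M \<tau>" for \<tau>
  define g where "g = msm_integral (- \<alpha>') (- \<alpha>) (- \<beta>') (- \<beta> + of_nat N) G f"
  have q0: "Re q0 > 0" using r(3) by (simp add: q0_def G_def)
  have ReQ: "Re (Q \<tau>) = Re q0" for \<tau> by (simp add: Q_def)
  have npl: "\<forall>(c, C, \<kappa>)\<in>set (take m lo). \<forall>\<tau>. c + of_real C * (\<i> * of_real \<tau>) \<notin> \<int>\<^sub>\<le>\<^sub>0"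
    and npu: "\<forall>(c, C, \<kappa>)\<in>set (take n up). \<forall>\<tau>. 1 - c - of_real C * (\<i> * of_real \<tau>) \<notin> \<int>\<^sub>\<le>\<^sub>0"
    using assms(14) unfolding I_separated_def by fastforce+
  have h: "integrable lborel h"
    unfolding h_def using assms npl npu by (intro integrable_I_density) auto
  have hUL: "integrable lborel (I_density lg m (n + 3) U L a \<theta>)"
  proof (rule integrable_I_density)
    show "\<forall>(c, C, \<kappa>)\<in>set U \<union> set L. C > 0 \<and> \<kappa> > 0"
      using assms(5,8) unfolding assms(11,12) by auto
    show "\<forall>(c, C, \<kappa>)\<in>set (take m L). \<forall>\<tau>. c + of_real C * (\<i> * of_real \<tau>) \<notin> \<int>\<^sub>\<le>\<^sub>0"
      using npl assms(1,4) unfolding assms(12) by simp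
    have new: "1 - c - of_real C * (\<i> * of_real \<tau>) \<notin> \<int>\<^sub>\<le>\<^sub>0"
      if "c = 1 - \<beta>' - \<rho> \<or> c = 1 + \<alpha> + \<alpha>' - \<gamma> - \<rho> \<or> c = 1 + \<alpha>' + \<beta> - \<gamma> - \<rho>" for c C \<tau>
      using r that by (intro Re_pos_not_nonpos_Int) auto
    show "\<forall>(c, C, \<kappa>)\<in>set (take (n + 3) U). \<forall>\<tau>. 1 - c - of_real C * (\<i> * of_real \<tau>) \<notin> \<int>\<^sub>\<le>\<^sub>0"
    proof clarify
      fix c C \<kappa> \<tau>
      assume "(c, C, \<kappa>) \<in> set (take (n + 3) U)" and pole: "1 - c - of_real C * (\<i> * of_real \<tau>) \<in> \<int>\<^sub>\<le>\<^sub>0"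
      hence "(c, C, \<kappa>) \<in> set (take n up)"
        using new[of c C \<tau>] unfolding assms(11) by (auto simp: numeral_3_eq_3 simp del: diff_diff_eq2)
      from bspec[OF npu this] pole show False by simp
    qed
  qed (use assms in auto)
  \<comment> \<open>The factor \<open>\<Gamma>(Q)\<close> of the multiplier absorbs \<open>(Q)\<^sub>N\<close>; this is where the shifts by \<open>N\<close> disappear.\<close>
  have dN: "d \<tau> * pochhammer (Q \<tau>) N = I_density lg m (n + 3) U L a \<theta> \<tau>" for \<tau>
  proof -
    let ?w = "\<rho> - \<i> * of_real (\<mu> * \<tau>)"
    have "Q \<tau> \<notin> \<int>\<^sub>\<le>\<^sub>0" using q0 ReQ by (intro Re_pos_not_nonpos_Int) simp
    hence "Gamma (Q \<tau>) * pochhammer (Q \<tau>) N = Gamma (Q \<tau> + of_nat N)"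
      using pochhammer_Gamma[of "Q \<tau>" N] by (simp add: Gamma_eq_zero_iff)
    moreover have "Q \<tau> + of_nat N = ?w - \<alpha> - \<alpha>' + \<gamma>" by (simp add: Q_def q0_def G_def)
    moreover have "M \<tau> = Gamma (Q \<tau>) * (Gamma (?w - \<alpha>' - \<beta> + \<gamma>) * Gamma (?w + \<beta>') * rGamma ?w * rGamma (?w - \<alpha> - \<alpha>' - \<beta> + \<gamma>) * rGamma (?w - \<alpha>' + \<beta>'))"
    proof -
      have "?w + - \<alpha>' + - \<alpha> - G = Q \<tau>" by (simp add: Q_def q0_def)
      moreover have "?w + - \<alpha>' + (- \<beta> + of_nat N) - G = ?w - \<alpha>' - \<beta> + \<gamma>" by (simp add: G_def)
      moreover have "?w + - \<alpha>' + - \<alpha> + (- \<beta> + of_nat N) - G = ?w - \<alpha> - \<alpha>' - \<beta> + \<gamma>" by (simp add: G_def)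
      moreover have "?w - - \<beta>' = ?w + \<beta>'" "?w + - \<alpha>' - - \<beta>' = ?w - \<alpha>' + \<beta>'" by simp_all
      ultimately show ?thesis unfolding M_def msm_multiplier_def by (simp only: mult.assoc)
    qed
    ultimately have "M \<tau> * pochhammer (Q \<tau>) N = Gamma (?w + \<beta>') * Gamma (?w - \<alpha> - \<alpha>' + \<gamma>) * Gamma (?w - \<alpha>' - \<beta> + \<gamma>)
        * rGamma ?w * rGamma (?w - \<alpha>' + \<beta>') * rGamma (?w - \<alpha> - \<alpha>' - \<beta> + \<gamma>)"
      by (simp add: mult_ac)
    moreover have "1 - (1 - \<beta>' - \<rho>) - \<i> * of_real (\<mu> * \<tau>) = ?w + \<beta>'"
      "1 - (1 + \<alpha> + \<alpha>' - \<gamma> - \<rho>) - \<i> * of_real (\<mu> * \<tau>) = ?w - \<alpha> - \<alpha>' + \<gamma>"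
      "1 - (1 + \<alpha>' + \<beta> - \<gamma> - \<rho>) - \<i> * of_real (\<mu> * \<tau>) = ?w - \<alpha>' - \<beta> + \<gamma>"
      "1 - (1 - \<rho>) - \<i> * of_real (\<mu> * \<tau>) = ?w"
      "1 - (1 + \<alpha>' - \<beta>' - \<rho>) - \<i> * of_real (\<mu> * \<tau>) = ?w - \<alpha>' + \<beta>'"
      "1 - (1 + \<alpha> + \<alpha>' + \<beta> - \<gamma> - \<rho>) - \<i> * of_real (\<mu> * \<tau>) = ?w - \<alpha> - \<alpha>' - \<beta> + \<gamma>"
      by simp_all
    ultimately have "I_chi lg m (n + 3) U L (\<i> * of_real \<tau>) = I_chi lg m n up lo (\<i> * of_real \<tau>) * (M \<tau> * pochhammer (Q \<tau>) N)"
      unfolding assms(11,12) using assms(1-4) by (subst I_chi_extend[OF assms(13) assms(8)]) (simp_all only:)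
    thus ?thesis by (simp add: d_def h_def I_density_def)
  qed
  have dj: "integrable lborel (\<lambda>\<tau>. d \<tau> * pochhammer (Q \<tau>) j)" if j: "j \<le> N" for j
  proof -
    \<comment> \<open>A positive lower bound for \<open>|(Q)\<^sub>N / (Q)\<^sub>j|\<close> along the contour.\<close>
    define K where "K = pochhammer (Re q0 + real j) (N - j)"
    have K: "K > 0" unfolding K_def using q0 by (intro pochhammer_pos) simp
    have nz: "pochhammer (Q \<tau>) N \<noteq> 0" for \<tau>
      using pochhammer_pos[OF q0, of N] norm_pochhammer_ge[of "Q \<tau>" N] q0 by (auto simp: ReQ)
    have meas: "d \<in> borel_measurable borel"
    proof -
      have "I_density lg m (n + 3) U L a \<theta> \<in> borel_measurable borel" using hUL by (auto dest: borel_measurable_integrable)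
      moreover have "(\<lambda>\<tau>. pochhammer (Q \<tau>) N) \<in> borel_measurable borel"
        unfolding pochhammer_prod Q_def by measurable
      moreover have "d = (\<lambda>\<tau>. I_density lg m (n + 3) U L a \<theta> \<tau> / pochhammer (Q \<tau>) N)"
        using nz by (simp add: fun_eq_iff dN [symmetric])
      ultimately show ?thesis by simp
    qed
    have "integrable lborel (\<lambda>\<tau>. of_real (1 / K) * I_density lg m (n + 3) U L a \<theta> \<tau>)"
      using hUL by simp
    thus ?thesis
    proof (rule Bochner_Integration.integrable_bound)
      show "(\<lambda>\<tau>. d \<tau> * pochhammer (Q \<tau>) j) \<in> borel_measurable lborel"
        using meas unfolding pochhammer_prod Q_def by measurable
      show "AE \<tau> in lborel. norm (d \<tau> * pochhammer (Q \<tau>) j) \<le> norm (of_real (1 / K) * I_density lg m (n + 3) U L a \<theta> \<tau>)"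
      proof (rule AE_I2)
        fix \<tau>
        have "K \<le> norm (pochhammer (Q \<tau> + of_nat j) (N - j))"
          using norm_pochhammer_ge[of "Q \<tau> + of_nat j" "N - j"] q0 by (simp add: K_def ReQ)
        hence "norm (d \<tau> * pochhammer (Q \<tau>) j) * K \<le> norm (d \<tau> * pochhammer (Q \<tau>) j) * norm (pochhammer (Q \<tau> + of_nat j) (N - j))"
          by (rule mult_left_mono) simp
        also have "\<dots> = norm (d \<tau> * pochhammer (Q \<tau>) N)"
          unfolding pochhammer_product[OF j] by (simp add: norm_mult)
        finally have "norm (d \<tau> * pochhammer (Q \<tau>) j) \<le> norm (d \<tau> * pochhammer (Q \<tau>) N) / K"
          using K by (simp only: pos_le_divide_eq)
        also have "\<dots> = norm (of_real (1 / K) * I_density lg m (n + 3) U L a \<theta> \<tau>)"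
          using K by (simp add: dN norm_mult norm_divide)
        finally show "norm (d \<tau> * pochhammer (Q \<tau>) j) \<le> norm (of_real (1 / K) * I_density lg m (n + 3) U L a \<theta> \<tau>)" .
      qed
    qed
  qed
  have ex: "msm_integral_exists (- \<alpha>') (- \<alpha>) (- \<beta>') (- \<beta> + of_nat N) G f y"
    and g: "g y = powers_integral d q0 \<mu> y" if y: "y > 0" for y
  proof -
    have c: "Re \<rho> > Re (- \<beta>')" "Re \<rho> > Re (G - (- \<alpha>') - (- \<alpha>))" "Re \<rho> > Re (G - (- \<alpha>') - (- \<beta> + of_nat N))"
      using r by (auto simp: G_def)
    have f: "f t = powers_integral h \<rho> \<mu> t" if "t > 0" for t
      unfolding f_def h_def using I_function_powers_integral[OF assms(7) that] by simp
    show "msm_integral_exists (- \<alpha>') (- \<alpha>) (- \<beta>') (- \<beta> + of_nat N) G f y"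
      by (rule msm_integral_powers_integral(1)[OF G y h c f])
    show "g y = powers_integral d q0 \<mu> y"
      unfolding g_def q0_def d_def M_def by (rule msm_integral_powers_integral(2)[OF G y h c f])
  qed
  have D: "(neg_ddx ^^ j) g y = powers_integral (\<lambda>\<tau>. d \<tau> * pochhammer (Q \<tau>) j) (q0 + of_nat j) \<mu> y"
      "j < N \<Longrightarrow> (neg_ddx ^^ j) g differentiable (at y)" if "j \<le> N" "y > 0" for j y
    using neg_ddx_powers_integral[of N d q0 \<mu> g j y, folded Q_def] dj g that by blast+
  have "msm_derivative_exists \<alpha> \<alpha>' \<beta> \<beta>' \<gamma> f x"
    unfolding msm_derivative_exists_def Let_def N_def [symmetric] G_def [symmetric] g_def [symmetric]
  proof (rule eventually_mono)
    show "\<forall>\<^sub>F y in nhds x. y > 0" using eventually_nhds_in_open[of "{0<..}" x] assms(17) by simp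
    fix y :: real assume y: "y > 0"
    show "msm_integral_exists (- \<alpha>') (- \<alpha>) (- \<beta>') (- \<beta> + of_nat N) G f y \<and> (\<forall>k<N. (neg_ddx ^^ k) g differentiable at y)"
      using ex[OF y] D(2)[OF _ y] less_imp_le by blast
  qed
  moreover have "msm_derivative \<alpha> \<alpha>' \<beta> \<beta>' \<gamma> f x = of_real x powr (\<alpha> + \<alpha>' - \<gamma> - \<rho>)
             * I_function lg m (n + 3) U L (a * of_real (x powr (- \<mu>))) \<theta>"
  proof -
    have "msm_derivative \<alpha> \<alpha>' \<beta> \<beta>' \<gamma> f x = (neg_ddx ^^ N) g x"
      by (simp only: msm_derivative_def Let_def g_def G_def N_def)
    also have "\<dots> = powers_integral (I_density lg m (n + 3) U L a \<theta>) (q0 + of_nat N) \<mu> x"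
      by (subst D(1)) (use assms(17) in \<open>simp_all add: dN\<close>)
    also have "q0 + of_nat N = - (\<alpha> + \<alpha>' - \<gamma> - \<rho>)" by (simp add: q0_def G_def)
    also have "powers_integral (I_density lg m (n + 3) U L a \<theta>) \<dots> \<mu> x = of_real x powr (\<alpha> + \<alpha>' - \<gamma> - \<rho>)
             * I_function lg m (n + 3) U L (a * of_real (x powr (- \<mu>))) \<theta>"
      using I_function_powers_integral[OF assms(7,17), of "- (\<alpha> + \<alpha>' - \<gamma> - \<rho>)"] by simp
    finally show ?thesis .
  qed
  ultimately show ?thesis unfolding f_def by blast
qed

end
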